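(* Let $d\geq 1$ and let $k_{1},\dots,k_{d}$ be positive integers with $k_{d}\geq2$ and $\sum_{j=1}^{d}k_{j}\not\equiv d\pmod{2}$. Then \begin{align*} \zeta(k_{1},\dots,k_{d}) & =\frac{\zeta(k_{1},\dots,k_{d})-\zeta^{\star}(k_{1},\dots,k_{d})}{2}\\ & \quad-\sum_{0\leq i<j\leq d}\ \sum_{\substack{a+2m+b=k_{j}\\ a,b,m\geq0}}(-1)^{m+i+b+k_{1}+\cdots+k_{j}}\frac{(2\pi)^{2m}}{2(2m)!}B_{2m}\\ & \qquad\times\zeta^{\star,*}(k_{1},\dots,k_{i})\,\zeta_{a}^{*}(k_{j-1},\dots,k_{i+1})\,\zeta_{b}(k_{j+1},\dots,k_{d}), \end{align*} where the inner sum is over non-negative integers $a,b,m$.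
   Context: An index is a finite (possibly empty) sequence of positive integers. For positive integers $k_1,\dots,k_d$ with $k_d\ge 2$, the multiple zeta value is $$\zeta(k_{1},\dots,k_{d}):=\sum_{0<m_{1}<\cdots<m_{d}}\frac{1}{m_{1}^{k_{1}}\cdots m_{d}^{k_{d}}}.$$ Stuffle regularized multiple zeta values $\zeta^{*}(k_1,\dots,k_d)\in\mathbb{R}$ (for all indices, without the condition $k_d\geq 2$): the stuffle (harmonic) product $*$ is the $\mathbb{Q}$-bilinear product on the $\mathbb{Q}$-vector space with basis the set of indices, determined by $\emptyset * w=w*\emptyset=w$ and $$(\mathbf{k},a)*(\mathbf{l},b)=(\mathbf{k}*(\mathbf{l},b),a)+((\mathbf{k},a)*\mathbf{l},b)+(\mathbf{k}*\mathbf{l},a+b)$$ for indices $\mathbf{k},\mathbf{l}$ and positive integers $a,b$ (appending a last entry is extended linearly). Then $\zeta^*$ is the unique $\mathbb{Q}$-linear map from this space to $\mathbb{R}$ that is multiplicative for $*$ and satisfies $\zeta^*(\emptyset)=1$, $\zeta^*(1)=0$, and $\zeta^*(k_1,\dots,k_d)=\zeta(k_1,\dots,k_d)$ whenever $k_d\ge2$. Stuffle regularized multiple zeta star values: $$\zeta^{\star,*}(k_{1},\dots,k_{d}):=\sum_{\substack{\square_{j}\in\{\text{comma},\,+\}\\ j=1,\dots,d-1}}\zeta^{*}(k_{1}\,\square_{1}\cdots\square_{d-1}\,k_{d}),$$ the sum over all $2^{d-1}$ choices of replacing each separator by a comma or a plus sign (e.g. $\zeta^{\star,*}(5,3,1)=\zeta^{*}(5,3,1)+\zeta^{*}(5,4)+\zeta^{*}(8,1)+\zeta^{*}(9)$),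 with $\zeta^{\star,*}(\emptyset)=1$. For positive integers $k_1,\dots,k_d$ and an integer $a\ge0$, $$\zeta_{a}^{*}(k_{1},\dots,k_{d}):=(-1)^{a}\sum_{\substack{a_{1}+\cdots+a_{d}=a\\ a_{1},\dots,a_{d}\geq0}}\zeta^{*}(k_{1}+a_{1},\dots,k_{d}+a_{d})\prod_{j=1}^{d}\binom{k_{j}-1+a_{j}}{a_{j}}.$$ For the empty index, $\zeta_0^*(\emptyset)=1$ and $\zeta_a^*(\emptyset)=0$ for $a>0$. When $k_d\ge2$, one writes $\zeta^{\star}(k_1,\dots,k_d)$ and $\zeta_a(k_1,\dots,k_d)$ for $\zeta^{\star,*}(k_1,\dots,k_d)$ and $\zeta_a^*(k_1,\dots,k_d)$; likewise $\zeta_a(\emptyset)=\zeta_a^*(\emptyset)$. In $\zeta^{\star,*}(k_1,\dots,k_i)$ the index is empty if $i=0$; in $\zeta_a^*(k_{j-1},\dots,k_{i+1})$ (entries in decreasing order of subscript) the index is empty if $j=i+1$; in $\zeta_b(k_{j+1},\dots,k_d)$ the index is empty if $j=d$. $B_{n}$ denotes the $n$-th Bernoulli number, so $B_0=1$ and $\zeta(2m)=\frac{(-1)^{m+1}(2\pi)^{2m}}{2(2m)!}B_{2m}$ for $m\ge1$. *)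

theory Defs
  imports
    "HOL-Analysis.Analysis"
    "HOL-Library.Poly_Mapping"
    "HOL-Computational_Algebra.Formal_Power_Series"
begin

definition bernoulli :: "nat \<Rightarrow> real" where
  "bernoulli n = fact n * fps_nth (fps_X / (fps_exp 1 - 1)) n"

definition is_index :: "nat list \<Rightarrow> bool" where
  "is_index w \<longleftrightarrow> (\<forall>k\<in>set w. 0 < k)"

definition mzv :: "nat list \<Rightarrow> real" where
  "mzv ks = (\<Sum>\<^sub>\<infinity>ms\<in>{ms :: nat list. length ms = length ks \<and> sorted_wrt (<) ms \<and> (\<forall>m\<in>set ms. 0 < m)}.
               \<Prod>j<length ks. 1 / real (ms ! j) ^ (ks ! j))"

text \<open>
  The rational vector space with basis the indices is the subspace \<open>index_space\<close> of
  the finitely supported functions on \<^typ>\<open>nat list\<close>.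
\<close>

definition qscale :: "rat \<Rightarrow> ('a \<Rightarrow>\<^sub>0 rat) \<Rightarrow> ('a \<Rightarrow>\<^sub>0 rat)" where
  "qscale c p = Poly_Mapping.map ((*) c) p"

definition word :: "nat list \<Rightarrow> (nat list \<Rightarrow>\<^sub>0 rat)" where
  "word w = Poly_Mapping.single w 1"

definition index_space :: "(nat list \<Rightarrow>\<^sub>0 rat) set" where
  "index_space = {p. \<forall>w\<in>Poly_Mapping.keys p. is_index w}"

definition lin_ext :: "(nat list \<Rightarrow> (nat list \<Rightarrow>\<^sub>0 rat)) \<Rightarrow> (nat list \<Rightarrow>\<^sub>0 rat) \<Rightarrow> (nat list \<Rightarrow>\<^sub>0 rat)" where
  "lin_ext f p = (\<Sum>w\<in>Poly_Mapping.keys p. qscale (Poly_Mapping.lookup p w) (f w))"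

definition append_last :: "nat \<Rightarrow> (nat list \<Rightarrow>\<^sub>0 rat) \<Rightarrow> (nat list \<Rightarrow>\<^sub>0 rat)" where
  "append_last a = lin_ext (\<lambda>w. word (w @ [a]))"

function stuffle_words :: "nat list \<Rightarrow> nat list \<Rightarrow> (nat list \<Rightarrow>\<^sub>0 rat)" where
  "stuffle_words [] w = word w"
| "stuffle_words (k @ [a]) [] = word (k @ [a])"
| "stuffle_words (k @ [a]) (l @ [b]) =
     append_last a (stuffle_words k (l @ [b]))
     + append_last b (stuffle_words (k @ [a]) l)
     + append_last (a + b) (stuffle_words k l)"
proof -
  fix P :: bool and x :: "nat list \<times> nat list"
  assume *: "\<And>w. x = ([], w) \<Longrightarrow> P" "\<And>k a. x = (k @ [a], []) \<Longrightarrow> P"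
    "\<And>k a l b. x = (k @ [a], l @ [b]) \<Longrightarrow> P"
  obtain u v where "x = (u, v)" by fastforce
  with * show P by (cases u rule: rev_cases; cases v rule: rev_cases) auto
qed auto
termination
  by (relation "Wellfounded.measure (\<lambda>(u, v). length u + length v)") auto

definition stuffle :: "(nat list \<Rightarrow>\<^sub>0 rat) \<Rightarrow> (nat list \<Rightarrow>\<^sub>0 rat) \<Rightarrow> (nat list \<Rightarrow>\<^sub>0 rat)" where
  "stuffle p q = lin_ext (\<lambda>u. lin_ext (\<lambda>v. stuffle_words u v) q) p"

text \<open>
  A linear map on \<open>index_space\<close> is represented by its extension by zero to the words
  that have an entry 0; this convention only makes the map unique as a total function.
\<close>

definition is_stuffle_regularization :: "((nat list \<Rightarrow>\<^sub>0 rat) \<Rightarrow> real) \<Rightarrow> bool" where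
  "is_stuffle_regularization Z \<longleftrightarrow>
     Vector_Spaces.linear qscale (\<lambda>c x. of_rat c * x) Z \<and>
     (\<forall>w. \<not> is_index w \<longrightarrow> Z (word w) = 0) \<and>
     (\<forall>p\<in>index_space. \<forall>q\<in>index_space. Z (stuffle p q) = Z p * Z q) \<and>
     Z (word []) = 1 \<and>
     Z (word [1]) = 0 \<and>
     (\<forall>w. is_index w \<and> w \<noteq> [] \<and> 2 \<le> last w \<longrightarrow> Z (word w) = mzv w)"

definition stuffle_regularization :: "(nat list \<Rightarrow>\<^sub>0 rat) \<Rightarrow> real" where
  "stuffle_regularization = (THE Z. is_stuffle_regularization Z)"

definition zeta_stuffle :: "nat list \<Rightarrow> real" where
  "zeta_stuffle w = stuffle_regularization (word w)"

datatype separator = Comma | Plus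

fun join_entries :: "separator list \<Rightarrow> nat list \<Rightarrow> nat list" where
  "join_entries (Comma # s) (k # l # ks) = k # join_entries s (l # ks)"
| "join_entries (Plus # s) (k # l # ks) = join_entries s ((k + l) # ks)"
| "join_entries _ ks = ks"

definition zeta_star_stuffle :: "nat list \<Rightarrow> real" where
  "zeta_star_stuffle ks =
     (\<Sum>s\<in>{s. length s = length ks - 1}. zeta_stuffle (join_entries s ks))"

definition zeta_shift_stuffle :: "nat \<Rightarrow> nat list \<Rightarrow> real" where
  "zeta_shift_stuffle a ks =
     (-1) ^ a * (\<Sum>as\<in>{as. length as = length ks \<and> sum_list as = a}.
       zeta_stuffle (map2 (+) ks as) *
       (\<Prod>j<length ks. real ((ks ! j - 1 + as ! j) choose (as ! j))))"

end

theory Submission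
  imports Defs "HOL-Computational_Algebra.Formal_Laurent_Series" "HOL-Real_Asymp.Real_Asymp"
begin

text \<open>
  For an index \<open>l\<^sub>1, \<dots>, l\<^sub>r\<close> with \<open>l\<^sub>r \<ge> 2\<close> consider the truncated multitangent function
  \<open>F(z) = \<Sum> \<Prod> (z + n\<^sub>i) powi (-l\<^sub>i)\<close>, summed over \<open>-N \<le> n\<^sub>1 < \<dots> < n\<^sub>r \<le> N\<close>. It is a rational function
  of \<open>z\<close> with a zero of order at least two at infinity, so the residues of \<open>F(z)\<close> and those of \<open>F(z)/z\<close> add up to zero. At the
  pole \<open>z = -n\<close> exactly one summation variable equals \<open>n\<close>, and the points to its left and to its right
  contribute Taylor coefficients of truncated multiple zeta values of lengths \<open>N + n\<close> and \<open>N - n\<close>. With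
  \<open>C c (N + n) (N - n)\<close> denoting the coefficient of \<open>(z + n)\<close> to the power \<open>-c\<close>, the two residue
  sums say that the sum over \<open>n\<close> of \<open>C 1 (N + n) (N - n)\<close> vanishes (\<open>sum_polar_coeff_1\<close>) and that the
  constant term of \<open>F\<close> at \<open>z = 0\<close> is the sum of \<open>C c (N + n) (N - n) / n\<^sup>c\<close> over \<open>n \<noteq> 0\<close> and \<open>c \<ge> 1\<close>
  (\<open>constant_term_eq_sum_polar_coeffs\<close>).

  Now let \<open>N\<close> grow. Up to an error of order \<open>1 / sqrt N\<close> times a power of \<open>harm N\<close>, a truncated multiple zeta
  value is a polynomial in the harmonic number \<open>harm N\<close>. As truncated values multiply by the stuffle
  product and the value of the index \<open>1\<close> is \<open>harm N\<close> itself, the constant term of this polynomial is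
  the stuffle regularized value (\<open>zeta_stuffle_eq\<close>). Because of \<open>l\<^sub>r \<ge> 2\<close> only the points on the left
  produce powers of \<open>harm\<close>, so \<open>C c P Q\<close> is asymptotic to a polynomial in \<open>harm P\<close>. For \<open>c = 1\<close> the
  vanishing residue sum forces this polynomial to be zero, hence the terms with \<open>c = 1\<close>, which would
  otherwise converge only conditionally, disappear; for \<open>c \<ge> 2\<close> the sum over \<open>n\<close> yields the factor
  \<open>2 \<zeta>(c)\<close> if \<open>c\<close> is even and \<open>0\<close> if \<open>c\<close> is odd. Comparing the constant terms of the polynomials on both
  sides gives \<open>regularized_multitangent_identity\<close>.

  This identity is used for every suffix \<open>k\<^sub>i\<^sub>+\<^sub>1, \<dots>, k\<^sub>d\<close>, multiplied by the star value of \<open>k\<^sub>1, \<dots>, k\<^sub>i\<close>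
  with the sign of \<open>i + k\<^sub>1 + \<dots> + k\<^sub>i\<close>, and summed over \<open>i\<close>. Star values are, up to sign, the antipode
  of the reversed index (\<open>zeta_star_antipode\<close>), so everything on the left-hand side cancels except the
  zeta value and the star value of the whole index (\<open>parity_identity\<close>). The hypothesis on parity makes
  their sum, rather than their difference, appear. The even zeta values \<open>\<zeta>(2 m)\<close> turn into Bernoulli
  numbers because both satisfy the same quadratic recurrence (\<open>zeta_nat_convolution\<close>,
  \<open>bernoulli_even_fps_convolution\<close>).
\<close>

section \<open>Functions on words and their convolution\<close>

text \<open>Regarding a function on words as a noncommutative formal power series in the letters, this is the
  product of series. Cutting the line at a point turns nested sums into such products.\<close>
definition conv :: "(nat list \<Rightarrow> 'a::semiring_0) \<Rightarrow> (nat list \<Rightarrow> 'a) \<Rightarrow> nat list \<Rightarrow> 'a" where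
  "conv f g w = (\<Sum>i\<le>length w. f (take i w) * g (drop i w))"

definition conv_unit :: "nat list \<Rightarrow> 'a::semiring_1" where
  "conv_unit w = (if w = [] then 1 else 0)"

lemma conv_unit_simps [simp]: "conv_unit [] = 1" "conv_unit (u @ [k]) = 0"
  by (auto simp: conv_unit_def)

lemma conv_Nil [simp]: "conv f g [] = f [] * g []"
  by (simp add: conv_def)

lemma conv_Cons: "conv f g (k # w) = f [] * g (k # w) + conv (\<lambda>u. f (k # u)) g w"
  by (simp add: conv_def sum.atMost_Suc_shift del: sum.atMost_Suc)

lemma conv_snoc: "conv f g (w @ [k]) = conv f (\<lambda>u. g (u @ [k])) w + f (w @ [k]) * g []"
  by (simp add: conv_def)

lemma conv_add_left: "conv (\<lambda>u. f u + f' u) g w = conv f g w + conv f' g w"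
  by (simp add: conv_def algebra_simps sum.distrib)

lemma conv_mult_left: "conv (\<lambda>u. c * f u) g w = c * conv f g w"
  by (simp add: conv_def algebra_simps sum_distrib_left)

lemma conv_diff_left:
  fixes f :: "nat list \<Rightarrow> 'a::ring"
  shows "conv (\<lambda>u. f u - f' u) g w = conv f g w - conv f' g w"
  by (simp add: conv_def algebra_simps sum_subtractf)

lemma conv_assoc: "conv (conv f g) h w = conv f (conv g h) w"
proof (induction w arbitrary: f)
  case (Cons k w)
  have "conv (conv f g) h (k # w)
      = f [] * g [] * h (k # w) + conv (\<lambda>u. f [] * g (k # u) + conv (\<lambda>u. f (k # u)) g u) h w"
    by (simp add: conv_Cons)
  also have "\<dots> = f [] * (g [] * h (k # w) + conv (\<lambda>u. g (k # u)) h w)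
      + conv (\<lambda>u. f (k # u)) (conv g h) w"
    by (simp add: conv_add_left conv_mult_left Cons.IH algebra_simps)
  finally show ?case by (simp add: conv_Cons)
qed (simp add: mult.assoc)

lemma conv_unit_left [simp]: "conv conv_unit g w = g w"
proof -
  have "conv conv_unit g w = (\<Sum>i\<le>length w. if i = 0 then g w else 0)"
    unfolding conv_def by (intro sum.cong) (auto simp: conv_unit_def)
  then show ?thesis by (simp add: sum.delta)
qed

lemma conv_unit_right [simp]: "conv f conv_unit w = f w"
proof -
  have "conv f conv_unit w = (\<Sum>i\<le>length w. if i = length w then f w else 0)"
    unfolding conv_def by (intro sum.cong) (auto simp: conv_unit_def)
  then show ?thesis by (simp add: sum.delta)
qed

text \<open>By induction on the length: \<open>e w\<close> is the only term of the product that does not involve a shorter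
  prefix of \<open>w\<close>.\<close>
lemma conv_eq_0_cancel:
  fixes e b :: "nat list \<Rightarrow> 'a::semiring_1"
  assumes "\<And>w. conv e b w = 0" and "b [] = 1"
  shows "e w = 0"
proof (induction w rule: length_induct)
  case (1 w)
  have "e (take i w) = 0" if "i < length w" for i
    using 1 that by simp
  then have "(\<Sum>i<length w. e (take i w) * b (drop i w)) = 0" by simp
  then have "conv e b w = e w"
    by (simp add: conv_def assms(2) flip: lessThan_Suc_atMost)
  with assms(1) show ?case by simp
qed

text \<open>A right inverse is a left inverse: if \<open>a b = 1\<close> then \<open>(b a - 1) b = 0\<close>, and \<open>b\<close> can be
  cancelled because its constant term is a unit.\<close>
lemma conv_inverse_commute:
  fixes a b :: "nat list \<Rightarrow> 'a::ring_1"
  assumes ab: "\<And>w. conv a b w = conv_unit w" and "b [] = 1"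
  shows "conv b a w = conv_unit w"
proof -
  have eq: "conv a b = conv_unit" using ab by (intro ext)
  have "conv (\<lambda>u. conv b a u - conv_unit u) b w = 0" for w
    by (simp add: conv_diff_left conv_assoc eq)
  from conv_eq_0_cancel[OF this assms(2)] show ?thesis by simp
qed

section \<open>Nested sums over a list of points\<close>

text \<open>The sum of \<open>\<phi> x\<^sub>1 k\<^sub>1 \<cdots> \<phi> x\<^sub>r k\<^sub>r\<close> over the subsequences \<open>x\<^sub>1, \<dots>, x\<^sub>r\<close> of the list of
  points, for the word \<open>k\<^sub>1 \<dots> k\<^sub>r\<close>. Truncated multiple zeta values and truncated multitangent
  functions are instances of it, in the reals and in rings of power or Laurent series.\<close>
fun nested_sum :: "('p \<Rightarrow> nat \<Rightarrow> 'a::comm_ring_1) \<Rightarrow> 'p list \<Rightarrow> nat list \<Rightarrow> 'a" where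
  "nested_sum \<phi> xs [] = 1"
| "nested_sum \<phi> [] (k # w) = 0"
| "nested_sum \<phi> (x # xs) (k # w) = nested_sum \<phi> xs (k # w) + \<phi> x k * nested_sum \<phi> xs w"

lemma nested_sum_no_points: "nested_sum \<phi> [] w = conv_unit w"
  by (cases w) (auto simp: conv_unit_def)

lemma nested_sum_append: "nested_sum \<phi> (xs @ ys) w = conv (nested_sum \<phi> xs) (nested_sum \<phi> ys) w"
proof (induction \<phi> xs w rule: nested_sum.induct)
  case (2 \<phi> k w)
  have "nested_sum \<phi> [] = conv_unit" by (intro ext nested_sum_no_points)
  then show ?case by simp
next
  case (3 \<phi> x xs k w)
  then show ?case
    by (simp add: conv_Cons conv_add_left conv_mult_left algebra_simps)
qed simp

lemma nested_sum_snoc_snoc: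
  "nested_sum \<phi> (xs @ [x]) (w @ [k]) = nested_sum \<phi> xs (w @ [k]) + nested_sum \<phi> xs w * \<phi> x k"
proof -
  have "(\<lambda>u. nested_sum \<phi> [x] (u @ [k])) = (\<lambda>u. conv_unit u * \<phi> x k)"
  proof
    fix u show "nested_sum \<phi> [x] (u @ [k]) = conv_unit u * \<phi> x k"
      by (cases u) (auto simp: nested_sum_no_points conv_unit_def)
  qed
  then have "conv (nested_sum \<phi> xs) (\<lambda>u. nested_sum \<phi> [x] (u @ [k])) w
      = conv (nested_sum \<phi> xs) conv_unit w * \<phi> x k"
    by (simp add: conv_def algebra_simps sum_distrib_left)
  then show ?thesis
    by (simp add: nested_sum_append conv_snoc)
qed

lemma nested_sum_map: "nested_sum \<phi> (map f xs) w = nested_sum (\<lambda>x. \<phi> (f x)) xs w"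
  by (induction \<phi> "map f xs" w arbitrary: xs rule: nested_sum.induct) auto

lemma nested_sum_cong:
  "(\<And>x k. x \<in> set xs \<Longrightarrow> k \<in> set w \<Longrightarrow> \<phi> x k = \<psi> x k) \<Longrightarrow> nested_sum \<phi> xs w = nested_sum \<psi> xs w"
  by (induction \<phi> xs w rule: nested_sum.induct) auto

lemma nested_sum_rev: "nested_sum \<phi> (rev xs) (rev w) = nested_sum \<phi> xs w"
proof (induction \<phi> xs w rule: nested_sum.induct)
  case (2 \<phi> k w)
  then show ?case by (simp add: nested_sum_no_points conv_unit_def)
qed (simp_all add: nested_sum_snoc_snoc algebra_simps)

text \<open>Either no summation variable sits at the point \<open>x\<close>, or exactly one does, namely that of some letter
  \<open>w ! i\<close>. At the pole coming from \<open>x\<close> the second alternative gives the polar part.\<close>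
lemma nested_sum_split_at:
  "nested_sum \<phi> (ls @ x # rs) w
   = conv (nested_sum \<phi> ls) (nested_sum \<phi> rs) w
     + (\<Sum>i<length w. nested_sum \<phi> ls (take i w) * \<phi> x (w ! i) * nested_sum \<phi> rs (drop (Suc i) w))"
proof -
  have "nested_sum \<phi> (x # rs) (drop i w)
      = nested_sum \<phi> rs (drop i w) + \<phi> x (w ! i) * nested_sum \<phi> rs (drop (Suc i) w)"
    if "i < length w" for i
    using that by (simp flip: Cons_nth_drop_Suc)
  then show ?thesis
    by (simp add: nested_sum_append conv_def algebra_simps sum.distrib flip: lessThan_Suc_atMost)
qed

unbundle no vec_syntax
unbundle Formal_Power_Series.fps_syntax
unbundle Formal_Laurent_Series.fps_syntax

section \<open>The residue theorem for products of simple poles\<close>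

text \<open>The Laurent expansion of \<open>1/(z + x)\<close> at \<open>z = -n\<close>. Rational functions with poles at integers are
  handled through the families of their expansions at all \<open>-n\<close>.\<close>
definition pole :: "int \<Rightarrow> int \<Rightarrow> real fls" where
  "pole n x = inverse (fls_X + fls_const (of_int (x - n)))"

lemma fls_X_plus_const_nonzero: "fls_X + fls_const (c::real) \<noteq> 0"
proof
  assume "fls_X + fls_const c = 0"
  then have "(fls_X + fls_const c) $$ 1 = 0" by simp
  then show False by simp
qed

lemma pole_same: "pole n n = fls_X_inv"
  by (simp add: pole_def fls_inverse_X)

lemma pole_other:
  assumes "x \<noteq> n"
  shows "pole n x = fps_to_fls (inverse (fps_X + fps_const (of_int (x - n))))"
proof -
  have "(fps_X + fps_const (of_int (x - n))) $ 0 \<noteq> (0::real)" using assms by simp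
  then have "fps_to_fls (inverse (fps_X + fps_const (of_int (x - n))))
      = inverse (fps_to_fls (fps_X + fps_const (real_of_int (x - n))))"
    by (metis fls_inverse_fps_to_fls subdegree_eq_0_iff)
  then show ?thesis by (simp add: pole_def)
qed

text \<open>Partial fractions for two distinct poles.\<close>
lemma pole_mult_pole:
  assumes "x \<noteq> y"
  shows "pole n x * pole n y = fls_const (1 / of_int (y - x)) * (pole n x - pole n y)"
proof -
  define p q where "p = fls_X + fls_const (real_of_int (x - n))"
    and "q = fls_X + fls_const (real_of_int (y - n))"
  have nz: "p \<noteq> 0" "q \<noteq> 0"
    unfolding p_def q_def by (rule fls_X_plus_const_nonzero)+
  have qp: "q - p = fls_const (of_int (y - x))"
    by (simp add: p_def q_def fls_minus_const)
  have "inverse p - inverse q = (q - p) * (inverse p * inverse q)"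
    using nz by (simp add: field_simps)
  then have "fls_const (1 / of_int (y - x)) * (inverse p - inverse q)
      = (fls_const (1 / of_int (y - x)) * fls_const (of_int (y - x))) * (inverse p * inverse q)"
    unfolding qp by (simp add: mult.assoc)
  also have "fls_const (1 / of_int (y - x)) * fls_const (of_int (y - x)) = (1 :: real fls)"
    using assms by (simp add: fls_const_mult_const)
  finally show ?thesis by (simp add: pole_def p_def q_def)
qed

lemma residue_power_pole: "(pole n x ^ D) $$ (-1) = (if x = n \<and> D = 1 then 1 else 0)"
proof (cases "x = n")
  case True
  then show ?thesis by (auto simp: pole_same)
next
  case False
  then show ?thesis by (simp add: pole_other flip: fps_to_fls_power)
qed

lemma prod_list_map_remove1:
  "x \<in> set xs \<Longrightarrow> prod_list (map f xs) = f x * prod_list (map f (remove1 x xs))"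
  for f :: "'b \<Rightarrow> 'a::comm_monoid_mult"
  by (induction xs) (auto simp: mult_ac)

text \<open>Two different factors can be separated by partial fractions, which lowers the degree; the
  difference of the two resulting sums vanishes, also when both have degree one and equal one.\<close>
lemma sum_residues_prod_pole:
  assumes "finite A" "set ys \<subseteq> A" "ys \<noteq> []"
  shows "(\<Sum>n\<in>A. (\<Prod>x\<leftarrow>ys. pole n x) $$ (-1)) = (if length ys = 1 then 1 else 0)"
  using assms(2,3)
proof (induction "length ys" arbitrary: ys rule: less_induct)
  case less
  show ?case
  proof (cases "\<exists>x\<in>set ys. \<exists>y\<in>set ys. x \<noteq> y")
    case True
    then obtain x y where xy: "x \<in> set ys" "y \<in> set ys" "x \<noteq> y" by blast
    define zs where "zs = remove1 y (remove1 x ys)"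
    have y: "y \<in> set (remove1 x ys)" using xy by (simp add: in_set_remove1)
    have len: "length ys = Suc (Suc (length zs))"
      using xy(1) y length_pos_if_in_set[OF xy(1)] length_pos_if_in_set[OF y]
      by (auto simp: zs_def length_remove1 split: if_splits)
    have zs: "set zs \<subseteq> A"
      using less.prems(1) unfolding zs_def by (meson order_trans set_remove1_subset)
    have prod: "(\<Prod>x\<leftarrow>ys. pole n x) = fls_const (1 / of_int (y - x)) *
        ((\<Prod>x\<leftarrow>x # zs. pole n x) - (\<Prod>x\<leftarrow>y # zs. pole n x))" for n
    proof -
      have "(\<Prod>x\<leftarrow>ys. pole n x) = pole n x * pole n y * (\<Prod>x\<leftarrow>zs. pole n x)"
        using prod_list_map_remove1[OF xy(1), of "pole n"] prod_list_map_remove1[OF y, of "pole n"]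
        by (simp add: zs_def mult.assoc)
      then show ?thesis by (simp add: pole_mult_pole[OF xy(3)] algebra_simps)
    qed
    have "(\<Sum>n\<in>A. (\<Prod>x\<leftarrow>x # zs. pole n x) $$ (-1)) = (\<Sum>n\<in>A. (\<Prod>x\<leftarrow>y # zs. pole n x) $$ (-1))"
      using less.hyps[of "x # zs"] less.hyps[of "y # zs"] less.prems xy zs len
      by (simp add: subset_iff)
    then show ?thesis
      unfolding prod using len
      by (simp add: sum_subtractf flip: sum_divide_distrib)
  next
    case False
    define x where "x = hd ys"
    have "x \<in> A" using less.prems by (auto simp: x_def)
    have "ys = replicate (length ys) x"
      using False less.prems(2) by (metis hd_in_set replicate_length_same x_def)
    then have "(\<Prod>x\<leftarrow>ys. pole n x) = pole n x ^ length ys" for n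
      by (metis map_replicate prod_list_replicate)
    then have "(\<Sum>n\<in>A. (\<Prod>x\<leftarrow>ys. pole n x) $$ (-1))
        = (\<Sum>n\<in>A. if n = x then if length ys = 1 then 1 else 0 else 0)"
      by (intro sum.cong) (auto simp: residue_power_pole)
    then show ?thesis using \<open>x \<in> A\<close> assms(1) by (simp add: sum.delta)
  qed
qed

text \<open>The additional factors \<open>ys\<close> keep the induction over the points going: a letter \<open>k\<close> placed at the
  point \<open>x\<close> adds \<open>k\<close> copies of \<open>x\<close> to them. They also allow the extra pole of \<open>F(z)/z\<close>.\<close>
lemma sum_residues_nested_sum:
  assumes "finite A" "set xs \<subseteq> A" "set ys \<subseteq> A" "length ys + sum_list w \<ge> 2"
  shows "(\<Sum>n\<in>A. ((\<Prod>x\<leftarrow>ys. pole n x) * nested_sum (\<lambda>x k. pole n x ^ k) xs w) $$ (-1)) = 0"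
  using assms(2-4)
proof (induction xs arbitrary: ys w)
  case Nil
  show ?case
  proof (cases w)
    case Nil
    then have "ys \<noteq> []" "length ys \<noteq> 1" using Nil.prems by auto
    then show ?thesis using Nil sum_residues_prod_pole[OF assms(1) Nil.prems(2)] by simp
  qed simp
next
  case (Cons x xs)
  show ?case
  proof (cases w)
    case Nil
    then have "ys \<noteq> []" "length ys \<noteq> 1" using Cons.prems by auto
    then show ?thesis using Nil sum_residues_prod_pole[OF assms(1) Cons.prems(2)] by simp
  next
    case w: (Cons k v)
    have "(\<Prod>x\<leftarrow>ys. pole n x) * nested_sum (\<lambda>x k. pole n x ^ k) (x # xs) w
        = (\<Prod>x\<leftarrow>ys. pole n x) * nested_sum (\<lambda>x k. pole n x ^ k) xs w
        + (\<Prod>x\<leftarrow>replicate k x @ ys. pole n x) * nested_sum (\<lambda>x k. pole n x ^ k) xs v" for n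
      by (simp add: w algebra_simps)
    then show ?thesis
      using Cons.IH[of ys w] Cons.IH[of "replicate k x @ ys" v] Cons.prems
      by (auto simp: sum.distrib w set_replicate_conv_if)
  qed
qed

section \<open>The two residue identities for truncated multitangent functions\<close>

text \<open>The power series of \<open>1/(r + z)\<^sup>k\<close>.\<close>
definition hpow :: "real \<Rightarrow> nat \<Rightarrow> real fps" where
  "hpow r k = inverse (fps_X + fps_const r) ^ k"

definition right_sum :: "nat \<Rightarrow> nat list \<Rightarrow> real fps" where
  "right_sum Q w = nested_sum (\<lambda>m. hpow (real m)) [1..<Suc Q] w"

text \<open>The points \<open>-P, \<dots>, -1\<close> in increasing order, reflected to \<open>1, \<dots>, P\<close>; the reflection reverses the
  word.\<close>
definition left_sum :: "nat \<Rightarrow> nat list \<Rightarrow> real fps" where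
  "left_sum P w = nested_sum (\<lambda>m. hpow (- real m)) [1..<Suc P] (rev w)"

text \<open>The coefficient of \<open>(z + n)\<^sup>-\<^sup>c\<close> (for \<open>c > 0\<close>) in the partial fraction expansion of the nested
  sum over the points from \<open>n - P\<close> to \<open>n + Q\<close>; it does not depend on \<open>n\<close>.\<close>
definition polar_coeff :: "nat list \<Rightarrow> nat \<Rightarrow> nat \<Rightarrow> nat \<Rightarrow> real" where
  "polar_coeff w c P Q = (\<Sum>i<length w. if c \<le> w ! i
     then (left_sum P (take i w) * right_sum Q (drop (Suc i) w)) $ (w ! i - c) else 0)"

lemma pole_eq_hpow: "x \<noteq> n \<Longrightarrow> pole n x ^ k = fps_to_fls (hpow (of_int (x - n)) k)"
  by (simp add: pole_other hpow_def fps_to_fls_power)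

lemma fps_to_fls_sum: "fps_to_fls (sum f A) = (\<Sum>x\<in>A. fps_to_fls (f x))"
  by (induction A rule: infinite_finite_induct) auto

lemma nested_sum_fps_to_fls:
  "nested_sum (\<lambda>x k. fps_to_fls (\<phi> x k)) xs w = fps_to_fls (nested_sum \<phi> xs w)"
  by (induction \<phi> xs w rule: nested_sum.induct) (auto simp: fls_times_fps_to_fls)

lemma nested_sum_pole:
  assumes "- int N \<le> n" "n \<le> int N"
  defines "P \<equiv> nat (int N + n)" and "Q \<equiv> nat (int N - n)"
  shows "nested_sum (\<lambda>x k. pole n x ^ k) [- int N..int N] w
    = fps_to_fls (conv (left_sum P) (right_sum Q) w)
      + (\<Sum>i<length w. fps_to_fls (left_sum P (take i w) * right_sum Q (drop (Suc i) w))
           * fls_X_inv ^ (w ! i))"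
proof -
  have P: "[- int N..n - 1] = map (\<lambda>m. n - int m) (rev [1..<Suc P])"
    using assms(1) unfolding P_def
    by (intro nth_equalityI) (auto simp: rev_nth nth_append of_nat_diff simp del: upt_Suc)
  have Q: "[n + 1..int N] = map (\<lambda>m. n + int m) [1..<Suc Q]"
    using assms(2) unfolding Q_def
    by (intro nth_equalityI) (auto simp del: upt_Suc)
  have pts: "[- int N..int N] = [- int N..n - 1] @ n # [n + 1..int N]"
    using assms(1,2) upto_split2[of "- int N" n "int N"] by (simp add: upto_rec2)
  have "nested_sum (\<lambda>x k. pole n x ^ k) [- int N..n - 1] u
      = nested_sum (\<lambda>m k. fps_to_fls (hpow (- real m) k)) (rev [1..<Suc P]) u" for u
    unfolding P nested_sum_map by (intro nested_sum_cong) (auto simp: pole_eq_hpow)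
  also have "\<dots> u = fps_to_fls (left_sum P u)" for u
    using nested_sum_rev[of _ "[1..<Suc P]" "rev u"]
    by (simp add: nested_sum_fps_to_fls left_sum_def del: upt_Suc)
  finally have l: "nested_sum (\<lambda>x k. pole n x ^ k) [- int N..n - 1] u = fps_to_fls (left_sum P u)" for u .
  have "nested_sum (\<lambda>x k. pole n x ^ k) [n + 1..int N] u
      = nested_sum (\<lambda>m k. fps_to_fls (hpow (real m) k)) [1..<Suc Q] u" for u
    unfolding Q nested_sum_map by (intro nested_sum_cong) (auto simp: pole_eq_hpow)
  then have r: "nested_sum (\<lambda>x k. pole n x ^ k) [n + 1..int N] u = fps_to_fls (right_sum Q u)" for u
    by (simp add: nested_sum_fps_to_fls right_sum_def)
  have conv: "conv (nested_sum (\<lambda>x k. pole n x ^ k) [- int N..n - 1])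
       (nested_sum (\<lambda>x k. pole n x ^ k) [n + 1..int N]) w
     = fps_to_fls (conv (left_sum P) (right_sum Q) w)"
    by (simp add: conv_def l r fls_times_fps_to_fls fps_to_fls_sum)
  show ?thesis
    unfolding pts nested_sum_split_at conv
    by (simp add: l r pole_same fls_times_fps_to_fls mult_ac)
qed

lemma fps_to_fls_times_X_inv_power_nth:
  "(fps_to_fls f * fls_X_inv ^ k) $$ (- int c) = (if c \<le> k then f $ (k - c) else 0)"
proof -
  have "fps_to_fls f * fls_X_inv ^ k = fls_shift (int k) (fps_to_fls f)"
    by (simp add: fls_X_inv_power_times_conv_shift)
  then show ?thesis by (simp add: nat_diff_distrib')
qed

lemma fls_sum_nth: "sum f A $$ n = (\<Sum>x\<in>A. f x $$ n)"
  by (induction A rule: infinite_finite_induct) auto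

text \<open>The residues of the truncated multitangent function itself.\<close>
theorem sum_polar_coeff_1:
  assumes "sum_list w \<ge> 2"
  shows "(\<Sum>n\<in>{- int N..int N}. polar_coeff w 1 (nat (int N + n)) (nat (int N - n))) = 0"
proof -
  have "(nested_sum (\<lambda>x k. pole n x ^ k) [- int N..int N] w) $$ (-1)
      = polar_coeff w 1 (nat (int N + n)) (nat (int N - n))" if "n \<in> {- int N..int N}" for n
    using that unfolding One_nat_def
    by (simp add: nested_sum_pole fls_sum_nth polar_coeff_def
        fps_to_fls_times_X_inv_power_nth[of _ _ "Suc 0", simplified])
  then show ?thesis
    using sum_residues_nested_sum[of "{- int N..int N}" "[- int N..int N]" "[]" w] assms by simp
qed

lemma nth_inverse_X_plus_const:
  assumes "r \<noteq> (0::real)"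
  shows "inverse (fps_X + fps_const r) $ a = (-1) ^ a / r ^ Suc a"
proof -
  have "((fps_X + fps_const r) * Abs_fps (\<lambda>a. (-1) ^ a / r ^ Suc a)) $ a = (1 :: real fps) $ a" for a
    using assms by (cases a) (simp_all add: distrib_right)
  then have "(fps_X + fps_const r) * Abs_fps (\<lambda>a. (-1) ^ a / r ^ Suc a) = (1 :: real fps)"
    by (rule fps_ext)
  then show ?thesis by (simp add: fps_inverse_unique)
qed

text \<open>The residues of \<open>F(z)/z\<close>: at \<open>0\<close> the residue is the constant term of \<open>F\<close>, and at \<open>z = -n\<close> the
  expansion of \<open>1/z\<close> has the coefficients \<open>-1/n\<^sup>c\<close>, which pair with the polar coefficients of \<open>F\<close>.\<close>
theorem constant_term_eq_sum_polar_coeffs: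
  assumes "sum_list w \<ge> 1" "\<And>k. k \<in> set w \<Longrightarrow> k \<le> K"
  shows "conv (left_sum N) (right_sum N) w $ 0 + polar_coeff w 0 N N
    = (\<Sum>n\<in>{- int N..int N} - {0}. \<Sum>c=1..K.
         polar_coeff w c (nat (int N + n)) (nat (int N - n)) / of_int n ^ c)"
proof -
  define F where "F n = pole n 0 * nested_sum (\<lambda>x k. pole n x ^ k) [- int N..int N] w" for n
  have F0: "F 0 $$ (-1) = conv (left_sum N) (right_sum N) w $ 0 + polar_coeff w 0 N N"
  proof -
    have "F 0 $$ (-1) = nested_sum (\<lambda>x k. pole 0 x ^ k) [- int N..int N] w $$ (- int 0)"
      by (simp add: F_def pole_same fls_X_inv_times_conv_shift)
    also have "\<dots> = conv (left_sum N) (right_sum N) w $ 0 + polar_coeff w 0 N N"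
      by (subst nested_sum_pole)
        (simp_all only: fls_plus_nth fls_sum_nth fps_to_fls_times_X_inv_power_nth, simp_all add: polar_coeff_def)
    finally show ?thesis .
  qed
  have Fn: "F n $$ (-1) = - (\<Sum>c=1..K. polar_coeff w c (nat (int N + n)) (nat (int N - n)) / of_int n ^ c)"
    if n: "n \<in> {- int N..int N}" "n \<noteq> 0" for n
  proof -
    define P Q where "P = nat (int N + n)" and "Q = nat (int N - n)"
    define f where "f i = left_sum P (take i w) * right_sum Q (drop (Suc i) w)" for i
    define h where "h = inverse (fps_X + fps_const (- real_of_int n))"
    have h: "h $ a = - 1 / of_int n ^ Suc a" for a
      using n(2) nth_inverse_X_plus_const[of "- real_of_int n" a] by (simp add: h_def power_minus')
    have summand: "(if 1 \<le> w ! i then (f i * h) $ (w ! i - 1) else 0)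
        = - (\<Sum>c=1..K. (if c \<le> w ! i then f i $ (w ! i - c) else 0) / of_int n ^ c)"
      if "i < length w" for i
    proof -
      have "(\<Sum>c=1..K. (if c \<le> w ! i then f i $ (w ! i - c) else 0) / of_int n ^ c)
          = (\<Sum>c=1..w ! i. f i $ (w ! i - c) / of_int n ^ c)"
        using assms(2)[OF nth_mem[OF that]] by (intro sum.mono_neutral_cong_right) auto
      also have "\<dots> = (if 1 \<le> w ! i then - (f i * h) $ (w ! i - 1) else 0)"
      proof (cases "w ! i")
        case (Suc k)
        have "(f i * h) $ k = (\<Sum>a=0..k. h $ a * f i $ (k - a))"
          by (subst mult.commute) (simp add: fps_mult_nth)
        also have "\<dots> = - (\<Sum>a=0..k. f i $ (k - a) / of_int n ^ Suc a)"
          by (simp add: h sum_negf)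
        also have "(\<Sum>a=0..k. f i $ (k - a) / of_int n ^ Suc a)
            = (\<Sum>c=1..Suc k. f i $ (Suc k - c) / of_int n ^ c)"
          by (rule sum.reindex_bij_witness[of _ "\<lambda>c. c - 1" Suc]) auto
        finally show ?thesis using Suc by simp
      qed simp
      finally show ?thesis by simp
    qed
    have "F n = fps_to_fls (h * conv (left_sum P) (right_sum Q) w)
        + (\<Sum>i<length w. fps_to_fls (f i * h) * fls_X_inv ^ (w ! i))"
      using n unfolding F_def
      by (simp add: nested_sum_pole pole_other h_def f_def P_def Q_def fls_times_fps_to_fls
          distrib_left sum_distrib_left mult_ac)
    then have "F n $$ (- int 1) = (\<Sum>i<length w. if 1 \<le> w ! i then (f i * h) $ (w ! i - 1) else 0)"
      by (simp only: fls_plus_nth fls_sum_nth fps_to_fls_times_X_inv_power_nth) simp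
    also have "\<dots> = (\<Sum>i<length w. - (\<Sum>c=1..K. (if c \<le> w ! i then f i $ (w ! i - c) else 0) / of_int n ^ c))"
      by (intro sum.cong refl summand) simp
    also have "\<dots> = - (\<Sum>c=1..K. polar_coeff w c P Q / of_int n ^ c)"
      unfolding polar_coeff_def sum_divide_distrib f_def[symmetric] sum_negf
      by (subst sum.swap) simp
    finally show ?thesis by (simp add: P_def Q_def)
  qed
  have "(\<Sum>n\<in>{- int N..int N}. F n $$ (-1)) = 0"
    using sum_residues_nested_sum[of "{- int N..int N}" "[- int N..int N]" "[0]" w] assms(1)
    by (simp add: F_def)
  then have "F 0 $$ (-1) + (\<Sum>n\<in>{- int N..int N} - {0}. F n $$ (-1)) = 0"
    by (subst (asm) sum.remove[of _ 0]) auto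
  moreover have "(\<Sum>n\<in>{- int N..int N} - {0}. F n $$ (-1)) = - (\<Sum>n\<in>{- int N..int N} - {0}. \<Sum>c=1..K.
         polar_coeff w c (nat (int N + n)) (nat (int N - n)) / of_int n ^ c)"
    using Fn by (simp add: sum_negf)
  ultimately show ?thesis using F0 by simp
qed

section \<open>Sequences asymptotic to polynomials in the harmonic numbers\<close>

text \<open>The error terms allow powers of \<open>harm\<close>, so that the sequences considered are closed under products
  with polynomials in \<open>harm\<close>, and the square root, a crude substitute for the true order \<open>1/n\<close>, so that
  tails of \<open>\<Sum> (1 + harm m)\<^sup>J / m\<^sup>2\<close> can be estimated by a convergent series.\<close>
definition harm_rate :: "nat \<Rightarrow> nat \<Rightarrow> real" where
  "harm_rate J n = (1 + harm n) ^ J / sqrt (real n + 1)"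

definition asym_poly :: "(nat \<Rightarrow> real) \<Rightarrow> real poly \<Rightarrow> bool" where
  "asym_poly f p \<longleftrightarrow> (\<exists>C J. \<forall>n. \<bar>f n - poly p (harm n)\<bar> \<le> C * harm_rate J n)"

lemma harm_rate_pos [simp]: "harm_rate J n > 0"
  using harm_nonneg[of n, where 'a = real] by (auto simp: harm_rate_def intro!: divide_pos_pos zero_less_power)

lemma one_le_1_plus_harm: "1 \<le> 1 + (harm n :: real)"
  using harm_nonneg[of n, where 'a = real] by simp

lemma harm_rate_mono: "J \<le> K \<Longrightarrow> harm_rate J n \<le> harm_rate K n"
  unfolding harm_rate_def using one_le_1_plus_harm
  by (intro divide_right_mono power_increasing) auto

lemma harm_rate_mult_power: "harm_rate J n * (1 + harm n) ^ K = harm_rate (J + K) n"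
  by (simp add: harm_rate_def power_add)

lemma harm_rate_le_power: "harm_rate J n \<le> (1 + harm n) ^ J"
proof -
  have "(1 + harm n :: real) ^ J / sqrt (real n + 1) \<le> (1 + harm n) ^ J / 1"
    using one_le_1_plus_harm[of n] by (intro divide_left_mono) auto
  then show ?thesis by (simp add: harm_rate_def)
qed

lemma harm_le_ln: "n > 0 \<Longrightarrow> harm n \<le> 1 + ln (real n)"
  using euler_mascheroni_sequence_decreasing[of 1 n] by (simp add: harm_expand)

text \<open>The \<open>J\<close>-th power of the limit \<open>(2 + ln n) / n powr (e/J) \<longlonglongrightarrow> 0\<close>.\<close>
lemma power_1_plus_harm_over_root_tendsto_0:
  assumes "e > 0"
  shows "(\<lambda>n. (1 + harm n) ^ J / real n powr e) \<longlonglongrightarrow> 0"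
proof (cases "J = 0")
  case True
  then show ?thesis using assms by simp real_asymp
next
  case False
  define d where "d = e / real J"
  have d: "d > 0" using assms False by (simp add: d_def)
  have "(\<lambda>n. (2 + ln (real n)) / real n powr d) \<longlonglongrightarrow> 0"
    using d by real_asymp
  then have "(\<lambda>n. ((2 + ln (real n)) / real n powr d) ^ J) \<longlonglongrightarrow> 0 ^ J"
    by (rule tendsto_power)
  then have lim: "(\<lambda>n. ((2 + ln (real n)) / real n powr d) ^ J) \<longlonglongrightarrow> 0"
    using False by (simp only: power_0_left if_False)
  show ?thesis
  proof (rule tendsto_sandwich[OF _ _ tendsto_const lim])
    show "\<forall>\<^sub>F n in sequentially. 0 \<le> (1 + harm n) ^ J / real n powr e"
      using one_le_1_plus_harm by (intro always_eventually allI divide_nonneg_nonneg zero_le_power) (auto intro: order_trans)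
    show "\<forall>\<^sub>F n in sequentially. (1 + harm n) ^ J / real n powr e \<le> ((2 + ln (real n)) / real n powr d) ^ J"
      using eventually_gt_at_top[of 0]
    proof eventually_elim
      case (elim n)
      have "(1 + harm n) ^ J / real n powr e \<le> (2 + ln (real n)) ^ J / real n powr e"
        using harm_le_ln[OF elim] harm_nonneg[of n, where 'a = real]
        by (intro divide_right_mono power_mono) auto
      moreover have "real n powr e = (real n powr d) ^ J"
        using elim False by (simp add: powr_realpow[symmetric] powr_powr d_def)
      ultimately show ?case by (simp add: power_divide)
    qed
  qed
qed

lemma harm_rate_tendsto_0: "harm_rate J \<longlonglongrightarrow> 0"
proof (rule tendsto_sandwich[OF _ _ tendsto_const power_1_plus_harm_over_root_tendsto_0[of "1/2" J]])
  show "\<forall>\<^sub>F n in sequentially. harm_rate J n \<le> (1 + harm n) ^ J / real n powr (1/2)"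
    using eventually_gt_at_top[of 0]
  proof eventually_elim
    case (elim n)
    then show ?case
      unfolding harm_rate_def powr_half_sqrt[OF of_nat_0_le_iff] using one_le_1_plus_harm[of n]
      by (intro divide_left_mono) auto
  qed
qed (auto intro!: always_eventually less_imp_le)

lemma asym_polyE:
  assumes "asym_poly f p"
  obtains C J where "C \<ge> 0" "\<And>n. \<bar>f n - poly p (harm n)\<bar> \<le> C * harm_rate J n"
proof -
  from assms obtain C J where *: "\<And>n. \<bar>f n - poly p (harm n)\<bar> \<le> C * harm_rate J n"
    by (auto simp: asym_poly_def)
  have "0 \<le> C * harm_rate J 0" using order_trans[OF abs_ge_zero *[of 0]] .
  then have "C \<ge> 0" using harm_rate_pos[of J 0] by (simp add: zero_le_mult_iff)
  with * that show ?thesis by blast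
qed

lemma asym_poly_exact: "(\<And>n. f n = poly p (harm n)) \<Longrightarrow> asym_poly f p"
  by (auto simp: asym_poly_def intro!: exI[of _ 0])

lemma asym_poly_add:
  assumes "asym_poly f p" "asym_poly g q"
  shows "asym_poly (\<lambda>n. f n + g n) (p + q)"
proof -
  from assms(1) obtain C J where C: "C \<ge> 0" "\<And>n. \<bar>f n - poly p (harm n)\<bar> \<le> C * harm_rate J n"
    by (rule asym_polyE) blast
  from assms(2) obtain D K where D: "D \<ge> 0" "\<And>n. \<bar>g n - poly q (harm n)\<bar> \<le> D * harm_rate K n"
    by (rule asym_polyE) blast
  have "\<bar>f n + g n - poly (p + q) (harm n)\<bar> \<le> (C + D) * harm_rate (J + K) n" for n
  proof -
    have "\<bar>f n + g n - poly (p + q) (harm n)\<bar> \<le> C * harm_rate J n + D * harm_rate K n"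
      using C(2)[of n] D(2)[of n] by (simp add: abs_if split: if_splits)
    also have "\<dots> \<le> C * harm_rate (J + K) n + D * harm_rate (J + K) n"
      using C(1) D(1) by (intro add_mono[OF mult_left_mono mult_left_mono] harm_rate_mono) auto
    finally show ?thesis by (simp add: algebra_simps)
  qed
  then show ?thesis unfolding asym_poly_def by blast
qed

lemma poly_bound:
  fixes p :: "real poly"
  obtains B where "B \<ge> 0" "\<And>x. x \<ge> 0 \<Longrightarrow> \<bar>poly p x\<bar> \<le> B * (1 + x) ^ degree p"
proof
  show "(\<Sum>i\<le>degree p. \<bar>coeff p i\<bar>) \<ge> 0" by (intro sum_nonneg) auto
  fix x :: real assume x: "x \<ge> 0"
  have "\<bar>poly p x\<bar> \<le> (\<Sum>i\<le>degree p. \<bar>coeff p i\<bar> * x ^ i)"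
    unfolding poly_altdef using x by (intro order_trans[OF sum_abs]) (simp add: abs_mult)
  also have "\<dots> \<le> (\<Sum>i\<le>degree p. \<bar>coeff p i\<bar> * (1 + x) ^ degree p)"
  proof (intro sum_mono mult_left_mono)
    fix i assume "i \<in> {..degree p}"
    have "x ^ i \<le> (1 + x) ^ i" using x by (intro power_mono) auto
    also have "\<dots> \<le> (1 + x) ^ degree p" using x \<open>i \<in> _\<close> by (intro power_increasing) auto
    finally show "x ^ i \<le> (1 + x) ^ degree p" .
  qed auto
  finally show "\<bar>poly p x\<bar> \<le> (\<Sum>i\<le>degree p. \<bar>coeff p i\<bar>) * (1 + x) ^ degree p"
    by (simp add: sum_distrib_right)
qed

lemma asym_poly_bounded:
  assumes "asym_poly f p"
  obtains B K where "B \<ge> 0" "\<And>n. \<bar>f n\<bar> \<le> B * (1 + harm n) ^ K"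
proof -
  from assms obtain C J where C: "C \<ge> 0" "\<And>n. \<bar>f n - poly p (harm n)\<bar> \<le> C * harm_rate J n"
    by (rule asym_polyE) blast
  obtain B where B: "B \<ge> 0" "\<And>x. x \<ge> 0 \<Longrightarrow> \<bar>poly p x\<bar> \<le> B * (1 + x) ^ degree p"
    by (rule poly_bound[of p]) blast
  have "\<bar>f n\<bar> \<le> (C + B) * (1 + harm n) ^ (J + degree p)" for n
  proof -
    have "\<bar>f n\<bar> \<le> C * harm_rate J n + B * (1 + harm n) ^ degree p"
      using C(2)[of n] B(2)[of "harm n"] harm_nonneg[of n, where 'a = real] by linarith
    also have "\<dots> \<le> C * (1 + harm n) ^ J + B * (1 + harm n) ^ degree p"
      using C(1) B(1) by (intro add_right_mono mult_left_mono harm_rate_le_power) auto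
    also have "\<dots> \<le> C * (1 + harm n) ^ (J + degree p) + B * (1 + harm n) ^ (J + degree p)"
      using C(1) B(1) one_le_1_plus_harm by (intro add_mono mult_left_mono power_increasing) auto
    finally show ?thesis by (simp add: algebra_simps)
  qed
  with that[of "C + B" "J + degree p"] C(1) B(1) show ?thesis by auto
qed

lemma asym_poly_mult:
  assumes "asym_poly f p" "asym_poly g q"
  shows "asym_poly (\<lambda>n. f n * g n) (p * q)"
proof -
  from assms(1) obtain C J where C: "C \<ge> 0" "\<And>n. \<bar>f n - poly p (harm n)\<bar> \<le> C * harm_rate J n"
    by (rule asym_polyE) blast
  from assms(2) obtain D K where D: "D \<ge> 0" "\<And>n. \<bar>g n - poly q (harm n)\<bar> \<le> D * harm_rate K n"
    by (rule asym_polyE) blast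
  obtain B M where B: "B \<ge> 0" "\<And>n. \<bar>g n\<bar> \<le> B * (1 + harm n) ^ M"
    using asym_poly_bounded[OF assms(2)] by blast
  obtain A where A: "A \<ge> 0" "\<And>x. x \<ge> 0 \<Longrightarrow> \<bar>poly p x\<bar> \<le> A * (1 + x) ^ degree p"
    by (rule poly_bound[of p]) blast
  have "\<bar>f n * g n - poly (p * q) (harm n)\<bar> \<le> (C * B + A * D) * harm_rate (J + M + (K + degree p)) n" for n
  proof -
    have "f n * g n - poly (p * q) (harm n)
        = (f n - poly p (harm n)) * g n + poly p (harm n) * (g n - poly q (harm n))"
      by (simp add: algebra_simps)
    then have "\<bar>f n * g n - poly (p * q) (harm n)\<bar>
        \<le> \<bar>f n - poly p (harm n)\<bar> * \<bar>g n\<bar> + \<bar>poly p (harm n)\<bar> * \<bar>g n - poly q (harm n)\<bar>"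
      by (metis abs_mult abs_triangle_ineq)
    also have "\<dots> \<le> (C * harm_rate J n) * (B * (1 + harm n) ^ M)
        + (A * (1 + harm n) ^ degree p) * (D * harm_rate K n)"
      using B(2)[of n] C(2)[of n] D(2)[of n] A(2)[of "harm n"] A(1) B(1) C(1)
        harm_nonneg[of n, where 'a = real]
      by (intro add_mono mult_mono) (auto intro!: mult_nonneg_nonneg less_imp_le[OF harm_rate_pos])
    also have "\<dots> = C * B * harm_rate (J + M) n + A * D * harm_rate (K + degree p) n"
      by (simp add: algebra_simps flip: harm_rate_mult_power)
    also have "\<dots> \<le> C * B * harm_rate (J + M + (K + degree p)) n
        + A * D * harm_rate (J + M + (K + degree p)) n"
      using A(1) B(1) C(1) D(1) by (intro add_mono[OF mult_left_mono mult_left_mono] harm_rate_mono) auto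
    finally show ?thesis by (simp add: algebra_simps)
  qed
  then show ?thesis unfolding asym_poly_def by blast
qed

lemma asym_poly_const: "asym_poly (\<lambda>_. c) [:c:]"
  by (rule asym_poly_exact) simp

lemma asym_poly_cmult:
  assumes "asym_poly f p" shows "asym_poly (\<lambda>n. c * f n) (smult c p)"
  using asym_poly_mult[OF asym_poly_const[of c] assms] by simp

lemma asym_poly_minus:
  assumes "asym_poly f p" "asym_poly g q" shows "asym_poly (\<lambda>n. f n - g n) (p - q)"
  using asym_poly_add[OF assms(1) asym_poly_cmult[OF assms(2), of "-1"]] by simp

lemma asym_poly_sum:
  assumes "\<And>x. x \<in> A \<Longrightarrow> asym_poly (f x) (p x)"
  shows "asym_poly (\<lambda>n. \<Sum>x\<in>A. f x n) (\<Sum>x\<in>A. p x)"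
  using assms
  by (induction A rule: infinite_finite_induct) (auto intro: asym_poly_add asym_poly_exact)

text \<open>A nonzero real polynomial or its negative is eventually bounded below by its positive leading
  coefficient.\<close>
lemma poly_zero_if_not_bounded_below:
  fixes p :: "real poly"
  assumes "\<And>q c. q = p \<or> q = - p \<Longrightarrow> c > 0 \<Longrightarrow> \<not> (\<exists>x0. \<forall>x\<ge>x0. poly q x \<ge> c)"
  shows "p = 0"
proof (rule ccontr)
  assume "p \<noteq> 0"
  then have "lead_coeff p > 0 \<or> lead_coeff (- p) > 0"
    using leading_coeff_neq_0[of p] by (simp only: degree_minus coeff_minus not_False_eq_True simp_thms \<open>p \<noteq> 0\<close>) linarith
  then obtain q where q: "q = p \<or> q = - p" "lead_coeff q > 0" by blast
  from poly_pinfty_gt_lc[OF q(2)] assms[OF q] show False by blast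
qed

lemma poly_harm_tendsto_0_imp_zero:
  fixes p :: "real poly"
  assumes "(\<lambda>n. poly p (harm n)) \<longlonglongrightarrow> 0"
  shows "p = 0"
proof (rule poly_zero_if_not_bounded_below)
  fix q :: "real poly" and c :: real
  assume q: "q = p \<or> q = - p" and c: "c > 0"
  have lim: "(\<lambda>n. poly q (harm n)) \<longlonglongrightarrow> 0"
    using q assms tendsto_minus[OF assms] by auto
  show "\<not> (\<exists>x0. \<forall>x\<ge>x0. poly q x \<ge> c)"
  proof
    assume "\<exists>x0. \<forall>x\<ge>x0. poly q x \<ge> c"
    then obtain x0 where x0: "\<And>x. x \<ge> x0 \<Longrightarrow> poly q x \<ge> c" by blast
    have "\<forall>\<^sub>F n in sequentially. harm n \<ge> x0"
      using harm_at_top by (auto simp: filterlim_at_top)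
    then have "\<forall>\<^sub>F n in sequentially. poly q (harm n) \<ge> c"
      by eventually_elim (use x0 in auto)
    from tendsto_lowerbound[OF lim this] c show False by simp
  qed
qed

text \<open>The polynomial is determined because \<open>harm\<close> is unbounded; this is what makes regularized values
  well defined.\<close>
lemma asym_poly_unique:
  assumes "asym_poly f p" "asym_poly f q"
  shows "p = q"
proof -
  have "asym_poly (\<lambda>n. 0) (p - q)"
    using asym_poly_minus[OF assms] by simp
  then obtain C J where C: "\<And>n. \<bar>0 - poly (p - q) (harm n)\<bar> \<le> C * harm_rate J n"
    by (rule asym_polyE) blast
  have "(\<lambda>n. C * harm_rate J n) \<longlonglongrightarrow> 0"
    using tendsto_mult_right_zero[OF harm_rate_tendsto_0] by blast
  then have "(\<lambda>n. poly (p - q) (harm n)) \<longlonglongrightarrow> 0"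
    by (rule Lim_null_comparison[rotated]) (use C in \<open>auto simp: abs_minus_commute\<close>)
  from poly_harm_tendsto_0_imp_zero[OF this] show ?thesis by simp
qed

lemma asym_poly_const_tendsto: "asym_poly f [:c:] \<Longrightarrow> f \<longlonglongrightarrow> c"
proof (elim asym_polyE)
  fix C J assume C: "\<And>n. \<bar>f n - poly [:c:] (harm n)\<bar> \<le> C * harm_rate J n"
  have "(\<lambda>n. C * harm_rate J n) \<longlonglongrightarrow> 0"
    using tendsto_mult_right_zero[OF harm_rate_tendsto_0] by blast
  then have "(\<lambda>n. f n - c) \<longlonglongrightarrow> 0"
    by (rule Lim_null_comparison[rotated]) (use C in auto)
  then show "f \<longlonglongrightarrow> c" by (simp add: LIM_zero_iff)
qed

text \<open>One factor \<open>1 / sqrt m\<close> of the summand bounds the tail, and what remains,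
  \<open>(1 + harm m)\<^sup>J / (m * sqrt m)\<close>, is still summable.\<close>
lemma asym_poly_convergent_sum:
  assumes t: "\<And>m. m > 0 \<Longrightarrow> \<bar>t m\<bar> \<le> C * (1 + harm m) ^ J / real m ^ 2"
  shows "\<exists>c. asym_poly (\<lambda>N. \<Sum>m=1..N. t m) [:c:]"
proof -
  have C: "C \<ge> 0" using order_trans[OF abs_ge_zero t[of 1]]
    by (simp add: harm_expand zero_le_mult_iff power_le_zero_eq)
  define s where "s m = (1 + harm (Suc m)) ^ J / (real (Suc m) * sqrt (real (Suc m)))" for m
  have s0: "s m \<ge> 0" for m
    using one_le_1_plus_harm[of "Suc m"] by (simp add: s_def)
  have "(\<lambda>n. (1 + harm n) ^ J / real n powr (1/4)) \<longlonglongrightarrow> 0"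
    by (rule power_1_plus_harm_over_root_tendsto_0) simp
  then have "\<forall>\<^sub>F n in sequentially. (1 + harm n) ^ J / real n powr (1/4) < 1"
    by (rule order_tendstoD) simp
  then have ev: "\<forall>\<^sub>F n in sequentially. (1 + harm (Suc n)) ^ J / real (Suc n) powr (1/4) < 1"
    by (rule eventually_compose_filterlim[OF _ filterlim_Suc])
  have "summable s"
  proof (rule summable_comparison_test_ev)
    show "summable (\<lambda>m. real (Suc m) powr (-5/4))"
      using summable_real_powr_iff[of "-5/4"] by (subst summable_Suc_iff) simp
    show "\<forall>\<^sub>F n in sequentially. norm (s n) \<le> real (Suc n) powr (-5/4)"
      using ev
    proof eventually_elim
      case (elim n)
      define x where "x = real (Suc n)"
      have x: "x > 0" by (simp add: x_def)
      have "(1 + harm (Suc n)) ^ J \<le> x powr (1/4)"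
        using elim x unfolding x_def by (simp add: field_simps del: of_nat_Suc)
      then have "s n \<le> x powr (1/4) / (x * sqrt x)"
        unfolding s_def x_def[symmetric] using x by (intro divide_right_mono) auto
      also have "x * sqrt x = x powr (3/2)"
      proof -
        have "x powr (3/2) = x powr (1 + 1/2)" by simp
        also have "\<dots> = x * sqrt x" using x by (simp only: powr_add powr_half_sqrt powr_one)
        finally show ?thesis ..
      qed
      also have "x powr (1/4) / x powr (3/2) = x powr (-5/4)"
        by (simp flip: powr_diff)
      finally show ?case using s0[of n] by (simp add: x_def)
    qed
  qed
  define u where "u m = t (Suc m)" for m
  have u: "\<bar>u m\<bar> \<le> C * s m / sqrt (real (Suc m))" for m
  proof -
    have "real (Suc m) * sqrt (real (Suc m)) * sqrt (real (Suc m)) = real (Suc m) ^ 2"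
      by (simp add: power2_eq_square mult.assoc)
    then show ?thesis using t[of "Suc m"] by (simp add: u_def s_def mult.assoc del: of_nat_Suc)
  qed
  have u': "\<bar>u m\<bar> \<le> C * s m / sqrt (real n + 1)" if "n \<le> m" for m n
    using that C s0[of m] by (intro order_trans[OF u] divide_left_mono) auto
  have su: "summable u"
    using u'[of 0] by (intro summable_comparison_test[OF _ summable_mult[OF \<open>summable s\<close>, of C]]) auto
  have "\<bar>(\<Sum>m=1..N. t m) - poly [:suminf u:] (harm N)\<bar> \<le> (C * suminf s) * harm_rate 0 N" for N
  proof -
    have "(\<Sum>m=1..N. t m) = (\<Sum>m<N. u m)"
      unfolding u_def by (rule sum.reindex_bij_witness[of _ Suc "\<lambda>m. m - 1"]) auto
    then have "(\<Sum>m=1..N. t m) - suminf u = - suminf (\<lambda>m. u (m + N))"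
      using suminf_split_initial_segment[OF su, of N] by simp
    moreover have "norm (suminf (\<lambda>m. u (m + N))) \<le> (suminf (\<lambda>m. C * s (m + N) / sqrt (real N + 1)))"
      using \<open>summable s\<close> u'[of N]
      by (intro norm_suminf_le) 
         (auto intro!: summable_divide summable_mult summable_ignore_initial_segment)
    moreover have "(suminf (\<lambda>m. C * s (m + N) / sqrt (real N + 1))) = C / sqrt (real N + 1) * suminf (\<lambda>m. s (m + N))"
      using \<open>summable s\<close> suminf_mult[of "\<lambda>m. s (m + N)" "C / sqrt (real N + 1)"]
      by (simp add: summable_ignore_initial_segment)
    moreover have "suminf (\<lambda>m. s (m + N)) \<le> suminf s"
      using suminf_split_initial_segment[OF \<open>summable s\<close>, of N] sum_nonneg[of "{..<N}" s] s0 by simp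
    then have "C / sqrt (real N + 1) * suminf (\<lambda>m. s (m + N)) \<le> C / sqrt (real N + 1) * suminf s"
      using C by (intro mult_left_mono) auto
    ultimately show ?thesis by (simp add: harm_rate_def)
  qed
  then show ?thesis unfolding asym_poly_def by blast
qed

section \<open>Convolution sums over a moving point\<close>

lemma harm_eq_sum: "harm N = (\<Sum>n=1..N. 1 / real n)"
  by (simp add: harm_def inverse_eq_divide)

lemma harm_add_le: "harm (N + n) - harm N \<le> real n / (real N + 1)"
proof (induction n)
  case (Suc n)
  have "inverse (real (Suc (N + n))) \<le> 1 / (real N + 1)"
    by (simp add: inverse_eq_divide divide_left_mono)
  with Suc show ?case by (simp add: harm_Suc add_divide_distrib)
qed simp

lemma harm_double_le: "1 + harm (2 * N) \<le> 2 * (1 + harm N :: real)"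
proof -
  have "real N / (real N + 1) \<le> 1" by (simp add: divide_le_eq)
  then have "harm (N + N) - harm N \<le> (1::real)"
    using harm_add_le[of N N] by linarith
  moreover have "1 + a \<le> 2 * (1 + b)" if "a - b \<le> 1" "0 \<le> b" for a b :: real
    using that by simp
  ultimately show ?thesis unfolding mult_2[of N] using harm_nonneg by blast
qed

text \<open>With \<open>q = N + 1 - n\<close> each summand equals \<open>sqrt q * (1/n + 1/q) / (N + 1)\<close>.\<close>
lemma sum_inverse_times_sqrt_le:
  "(\<Sum>n=1..N. 1 / (real n * sqrt (real (N + 1 - n)))) \<le> 2 * harm N / sqrt (real N + 1)"
proof -
  have "1 / (real n * sqrt (real (N + 1 - n))) \<le> (1 / real n + 1 / real (N + 1 - n)) / sqrt (real N + 1)"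
    if n: "n \<in> {1..N}" for n
  proof -
    define q where "q = real (N + 1 - n)"
    have q: "q > 0" "q \<le> real N + 1" "real n + q = real N + 1" "real n > 0" using n by (auto simp: q_def of_nat_diff)
    have "sqrt q * sqrt (real N + 1) \<le> sqrt (real N + 1) * sqrt (real N + 1)"
      using q by (intro mult_right_mono) auto
    then have "sqrt q * sqrt (real N + 1) \<le> real n + q" using q by simp
    then have "sqrt q * sqrt (real N + 1) / (real n * q * sqrt (real N + 1))
        \<le> (real n + q) / (real n * q * sqrt (real N + 1))"
      using q by (intro divide_right_mono) auto
    moreover have "sqrt q * sqrt (real N + 1) / (real n * q * sqrt (real N + 1)) = 1 / (real n * sqrt q)"
    proof -
      have "q = sqrt q * sqrt q" using q by simp
      then show ?thesis using q by (simp add: divide_simps)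
    qed
    moreover have "(real n + q) / (real n * q * sqrt (real N + 1)) = (1 / real n + 1 / q) / sqrt (real N + 1)"
      using q by (simp add: field_simps)
    ultimately show ?thesis unfolding q_def by simp
  qed
  then have "(\<Sum>n=1..N. 1 / (real n * sqrt (real (N + 1 - n))))
      \<le> (\<Sum>n=1..N. (1 / real n + 1 / real (N + 1 - n)) / sqrt (real N + 1))"
    by (rule sum_mono)
  also have "\<dots> = ((\<Sum>n=1..N. 1 / real n) + (\<Sum>n=1..N. 1 / real (N + 1 - n))) / sqrt (real N + 1)"
    by (simp only: sum_divide_distrib[symmetric] sum.distrib)
  also have "(\<Sum>n=1..N. 1 / real (N + 1 - n)) = (\<Sum>n=1..N. 1 / real n)"
    by (rule sum.reindex_bij_witness[of _ "\<lambda>n. N + 1 - n" "\<lambda>n. N + 1 - n"]) auto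
  finally show ?thesis by (simp add: harm_eq_sum)
qed

lemma asym_poly_sum_remainder:
  assumes e: "\<And>N n. 1 \<le> n \<Longrightarrow> n \<le> N \<Longrightarrow>
      \<bar>e N n\<bar> \<le> C * (1 + harm (2 * N)) ^ J / (real n * sqrt (real (N + 1 - n)))"
  shows "asym_poly (\<lambda>N. \<Sum>n=1..N. e N n) 0"
proof -
  have C: "C \<ge> 0"
    using order_trans[OF abs_ge_zero e[of 1 1]] by (simp add: harm_expand zero_le_mult_iff power_le_zero_eq)
  have "\<bar>(\<Sum>n=1..N. e N n) - poly 0 (harm N)\<bar> \<le> (C * 2 ^ J * 2) * harm_rate (Suc J) N" for N
  proof -
    have "\<bar>\<Sum>n=1..N. e N n\<bar> \<le> (\<Sum>n=1..N. C * (1 + harm (2 * N)) ^ J * (1 / (real n * sqrt (real (N + 1 - n)))))"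
      using e by (intro order_trans[OF sum_abs] sum_mono) auto
    also have "\<dots> \<le> C * (1 + harm (2 * N)) ^ J * (2 * harm N / sqrt (real N + 1))"
      unfolding sum_distrib_left[symmetric] using C one_le_1_plus_harm[of "2 * N"]
      by (intro mult_left_mono sum_inverse_times_sqrt_le) auto
    also have "\<dots> \<le> C * (2 * (1 + harm N)) ^ J * (2 * (1 + harm N) / sqrt (real N + 1))"
      using C harm_double_le[of N] harm_nonneg[of N, where 'a = real] harm_nonneg[of "2 * N", where 'a = real]
      by (intro mult_mono mult_left_mono power_mono divide_right_mono) (auto intro!: mult_nonneg_nonneg)
    also have "\<dots> = (C * 2 ^ J * 2) * harm_rate (Suc J) N"
      unfolding power_mult_distrib harm_rate_def by simp
    finally show ?thesis by simp
  qed
  then show ?thesis unfolding asym_poly_def by blast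
qed

text \<open>Double sequences that approach, when both arguments grow, a polynomial in the harmonic number
  of the first one. In the multitangent sums only the points on the left contribute logarithms.\<close>
definition asym_poly2 :: "(nat \<Rightarrow> nat \<Rightarrow> real) \<Rightarrow> real poly \<Rightarrow> bool" where
  "asym_poly2 g p \<longleftrightarrow> (\<exists>C J. \<forall>P Q. \<bar>g P Q - poly p (harm P)\<bar>
     \<le> C * (1 + harm (P + Q)) ^ J * (1 / sqrt (real P + 1) + 1 / sqrt (real Q + 1)))"

lemma asym_poly2E:
  assumes "asym_poly2 g p"
  obtains C J where "C \<ge> 0" "\<And>P Q. \<bar>g P Q - poly p (harm P)\<bar>
     \<le> C * (1 + harm (P + Q)) ^ J * (1 / sqrt (real P + 1) + 1 / sqrt (real Q + 1))"
proof -
  from assms obtain C J where *: "\<And>P Q. \<bar>g P Q - poly p (harm P)\<bar>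
     \<le> C * (1 + harm (P + Q)) ^ J * (1 / sqrt (real P + 1) + 1 / sqrt (real Q + 1))"
    by (auto simp: asym_poly2_def)
  then have "C \<ge> 0" using order_trans[OF abs_ge_zero *[of 0 0]] by (simp add: harm_expand)
  with * that show ?thesis by blast
qed

lemma asym_poly2_zero: "asym_poly2 (\<lambda>P Q. 0) 0"
  unfolding asym_poly2_def by (rule exI[of _ 0]) simp

lemma asym_poly2_add:
  assumes "asym_poly2 f p" "asym_poly2 g q"
  shows "asym_poly2 (\<lambda>P Q. f P Q + g P Q) (p + q)"
proof -
  let ?r = "\<lambda>P Q. 1 / sqrt (real P + 1) + 1 / sqrt (real Q + 1)"
  from assms(1) obtain C J where C: "C \<ge> 0"
    "\<And>P Q. \<bar>f P Q - poly p (harm P)\<bar> \<le> C * (1 + harm (P + Q)) ^ J * ?r P Q"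
    by (rule asym_poly2E) blast
  from assms(2) obtain D K where D: "D \<ge> 0"
    "\<And>P Q. \<bar>g P Q - poly q (harm P)\<bar> \<le> D * (1 + harm (P + Q)) ^ K * ?r P Q"
    by (rule asym_poly2E) blast
  have "\<bar>f P Q + g P Q - poly (p + q) (harm P)\<bar> \<le> (C + D) * (1 + harm (P + Q)) ^ (J + K) * ?r P Q" for P Q
  proof -
    have "\<bar>f P Q + g P Q - poly (p + q) (harm P)\<bar>
        \<le> C * (1 + harm (P + Q)) ^ J * ?r P Q + D * (1 + harm (P + Q)) ^ K * ?r P Q"
      using C(2)[of P Q] D(2)[of P Q] by (simp add: abs_if split: if_splits)
    also have "\<dots> \<le> C * (1 + harm (P + Q)) ^ (J + K) * ?r P Q + D * (1 + harm (P + Q)) ^ (J + K) * ?r P Q"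
      using C(1) D(1) one_le_1_plus_harm
      by (intro add_mono[OF mult_right_mono mult_right_mono] mult_left_mono power_increasing) auto
    finally show ?thesis by (simp add: algebra_simps)
  qed
  then show ?thesis unfolding asym_poly2_def by blast
qed

lemma asym_poly2_sum:
  assumes "\<And>x. x \<in> A \<Longrightarrow> asym_poly2 (f x) (p x)"
  shows "asym_poly2 (\<lambda>P Q. \<Sum>x\<in>A. f x P Q) (\<Sum>x\<in>A. p x)"
  using assms
  by (induction A rule: infinite_finite_induct) (auto intro: asym_poly2_add asym_poly2_zero)

text \<open>This is the shape of the summands of a polar coefficient: the left factor may carry powers of \<open>harm\<close>,
  the right one converges.\<close>
lemma asym_poly2_mult:
  assumes "asym_poly f p" "asym_poly g [:c:]"
  shows "asym_poly2 (\<lambda>P Q. f P * g Q) (smult c p)"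
proof -
  from assms(1) obtain C J where C: "C \<ge> 0" "\<And>n. \<bar>f n - poly p (harm n)\<bar> \<le> C * harm_rate J n"
    by (rule asym_polyE) blast
  from assms(2) obtain D K where D: "D \<ge> 0" "\<And>n. \<bar>g n - poly [:c:] (harm n)\<bar> \<le> D * harm_rate K n"
    by (rule asym_polyE) blast
  obtain B M where B: "B \<ge> 0" "\<And>n. \<bar>g n\<bar> \<le> B * (1 + harm n) ^ M"
    using asym_poly_bounded[OF assms(2)] by blast
  obtain A where A: "A \<ge> 0" "\<And>x. x \<ge> 0 \<Longrightarrow> \<bar>poly p x\<bar> \<le> A * (1 + x) ^ degree p"
    by (rule poly_bound[of p]) blast
  define L where "L = J + M + (K + degree p)"
  define E where "E = C * B + A * D"
  have "\<bar>f P * g Q - poly (smult c p) (harm P)\<bar>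
      \<le> E * (1 + harm (P + Q)) ^ L * (1 / sqrt (real P + 1) + 1 / sqrt (real Q + 1))" for P Q
  proof -
    define x where "x = 1 + (harm (P + Q) :: real)"
    have x: "1 \<le> x" "1 + harm P \<le> x" "1 + harm Q \<le> x"
      unfolding x_def using one_le_1_plus_harm by (auto intro: harm_mono)
    have h: "0 \<le> (harm P :: real)" "0 \<le> (harm Q :: real)" by (rule harm_nonneg)+
    have rP: "harm_rate J P \<le> x ^ J / sqrt (real P + 1)"
      unfolding harm_rate_def using x h by (intro divide_right_mono power_mono) auto
    have rQ: "harm_rate K Q \<le> x ^ K / sqrt (real Q + 1)"
      unfolding harm_rate_def using x h by (intro divide_right_mono power_mono) auto
    have f: "\<bar>f P - poly p (harm P)\<bar> \<le> C * (x ^ J / sqrt (real P + 1))"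
      using C(1) rP by (intro order_trans[OF C(2)] mult_left_mono)
    have g: "\<bar>g Q - c\<bar> \<le> D * (x ^ K / sqrt (real Q + 1))"
      using D(1) rQ order_trans[OF D(2) mult_left_mono[OF rQ D(1)]] by simp
    have g': "\<bar>g Q\<bar> \<le> B * x ^ M"
      using B x h by (intro order_trans[OF B(2)] mult_left_mono power_mono) auto
    have p: "\<bar>poly p (harm P)\<bar> \<le> A * x ^ degree p"
      using A x h by (intro order_trans[OF A(2)] mult_left_mono power_mono) auto
    have "f P * g Q - poly (smult c p) (harm P)
        = (f P - poly p (harm P)) * g Q + poly p (harm P) * (g Q - c)"
      by (simp add: algebra_simps)
    then have "\<bar>f P * g Q - poly (smult c p) (harm P)\<bar>
        \<le> \<bar>f P - poly p (harm P)\<bar> * \<bar>g Q\<bar> + \<bar>poly p (harm P)\<bar> * \<bar>g Q - c\<bar>"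
      by (metis abs_mult abs_triangle_ineq)
    also have "\<dots> \<le> (C * (x ^ J / sqrt (real P + 1))) * (B * x ^ M)
        + (A * x ^ degree p) * (D * (x ^ K / sqrt (real Q + 1)))"
      using f g g' p A(1) x(1) C(1) by (intro add_mono mult_mono) auto
    also have "\<dots> = C * B * x ^ (J + M) * (1 / sqrt (real P + 1))
        + A * D * x ^ (K + degree p) * (1 / sqrt (real Q + 1))"
      by (simp add: power_add algebra_simps)
    also have "\<dots> \<le> E * x ^ L * (1 / sqrt (real P + 1)) + E * x ^ L * (1 / sqrt (real Q + 1))"
      using A(1) B(1) C(1) D(1) x(1) unfolding E_def
      by (intro add_mono[OF mult_right_mono mult_right_mono] mult_mono power_increasing) (auto simp: L_def)
    finally show ?thesis by (simp add: x_def algebra_simps)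
  qed
  then show ?thesis unfolding asym_poly2_def by blast
qed

lemma asym_poly2_diagonal:
  assumes "asym_poly2 g p"
  shows "asym_poly (\<lambda>N. g N N) p"
proof -
  from assms obtain C J where C: "C \<ge> 0" "\<And>P Q. \<bar>g P Q - poly p (harm P)\<bar>
     \<le> C * (1 + harm (P + Q)) ^ J * (1 / sqrt (real P + 1) + 1 / sqrt (real Q + 1))"
    by (rule asym_poly2E) blast
  have "\<bar>g N N - poly p (harm N)\<bar> \<le> (C * 2 ^ J * 2) * harm_rate J N" for N
  proof -
    have "\<bar>g N N - poly p (harm N)\<bar> \<le> C * (1 + harm (2 * N)) ^ J * (2 / sqrt (real N + 1))"
      using C(2)[of N N] by (simp add: mult_2)
    also have "\<dots> \<le> C * (2 * (1 + harm N)) ^ J * (2 / sqrt (real N + 1))"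
      using C(1) harm_double_le[of N] harm_nonneg[of "2 * N", where 'a = real]
      by (intro mult_right_mono mult_left_mono power_mono) auto
    finally show ?thesis unfolding power_mult_distrib harm_rate_def by (simp add: mult_ac)
  qed
  then show ?thesis unfolding asym_poly_def by blast
qed

lemma poly_lipschitz:
  fixes p :: "real poly"
  obtains B K where "B \<ge> 0"
    "\<And>x y M. 0 \<le> x \<Longrightarrow> x \<le> M \<Longrightarrow> 0 \<le> y \<Longrightarrow> y \<le> M \<Longrightarrow> \<bar>poly p x - poly p y\<bar> \<le> B * (1 + M) ^ K * \<bar>x - y\<bar>"
proof -
  obtain B where B: "B \<ge> 0" "\<And>x. x \<ge> 0 \<Longrightarrow> \<bar>poly (pderiv p) x\<bar> \<le> B * (1 + x) ^ degree (pderiv p)"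
    by (rule poly_bound[of "pderiv p"]) blast
  have "\<bar>poly p x - poly p y\<bar> \<le> B * (1 + M) ^ degree (pderiv p) * \<bar>x - y\<bar>"
    if "0 \<le> x" "x \<le> M" "0 \<le> y" "y \<le> M" for x y M
  proof -
    have "norm (poly p x - poly p y) \<le> B * (1 + M) ^ degree (pderiv p) * norm (x - y)"
    proof (rule field_differentiable_bound[of "{0..M}"])
      fix z assume z: "z \<in> {0..M}"
      show "(poly p has_field_derivative poly (pderiv p) z) (at z within {0..M})"
        by (rule DERIV_subset[OF poly_DERIV]) simp
      show "norm (poly (pderiv p) z) \<le> B * (1 + M) ^ degree (pderiv p)"
        using z B by (simp, intro order_trans[OF B(2)] mult_left_mono power_mono) auto
    qed (use that in auto)
    then show ?thesis by simp
  qed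
  with B(1) that show ?thesis by blast
qed

lemma asym_poly2_near_diagonal:
  assumes "asym_poly2 g p"
  obtains C J where "\<And>N n. 1 \<le> n \<Longrightarrow> n \<le> N \<Longrightarrow>
      \<bar>g (N + n) (N - n) - poly p (harm (N + n))\<bar> \<le> C * (1 + harm (2 * N)) ^ J / sqrt (real (N + 1 - n))"
    "\<And>N n. 1 \<le> n \<Longrightarrow> n \<le> N \<Longrightarrow>
      \<bar>g (N - n) (N + n) - poly p (harm (N - n))\<bar> \<le> C * (1 + harm (2 * N)) ^ J / sqrt (real (N + 1 - n))"
proof -
  from assms obtain C J where C: "C \<ge> 0" "\<And>P Q. \<bar>g P Q - poly p (harm P)\<bar>
     \<le> C * (1 + harm (P + Q)) ^ J * (1 / sqrt (real P + 1) + 1 / sqrt (real Q + 1))"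
    by (rule asym_poly2E) blast
  have le: "1 / sqrt (real (N + n) + 1) + 1 / sqrt (real (N - n) + 1) \<le> 2 / sqrt (real (N + 1 - n))"
    if "n \<le> N" for N n
  proof -
    have "real (N + 1 - n) = real (N - n) + 1" using that by (simp add: of_nat_diff)
    moreover have "1 / sqrt (real (N + n) + 1) \<le> 1 / sqrt (real (N - n) + 1)"
      using that by (intro divide_left_mono) auto
    ultimately show ?thesis by simp
  qed
  have "C * (1 + harm (2 * N)) ^ J * (1 / sqrt (real (N + n) + 1) + 1 / sqrt (real (N - n) + 1))
      \<le> (2 * C) * (1 + harm (2 * N)) ^ J / sqrt (real (N + 1 - n))" if "n \<le> N" for N n
  proof -
    have "C * (1 + harm (2 * N)) ^ J * (1 / sqrt (real (N + n) + 1) + 1 / sqrt (real (N - n) + 1))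
       \<le> C * (1 + harm (2 * N)) ^ J * (2 / sqrt (real (N + 1 - n)))"
      using C(1) one_le_1_plus_harm[of "2 * N"] by (intro mult_left_mono le that) auto
    then show ?thesis by (simp add: mult_ac)
  qed
  note le' = this
  show ?thesis
  proof (rule that[of "2 * C" J])
    fix N n :: nat assume n: "1 \<le> n" "n \<le> N"
    have s: "N + n + (N - n) = 2 * N" "N - n + (N + n) = 2 * N" using n by auto
    show "\<bar>g (N + n) (N - n) - poly p (harm (N + n))\<bar> \<le> 2 * C * (1 + harm (2 * N)) ^ J / sqrt (real (N + 1 - n))"
      using C(2)[of "N + n" "N - n"] le'[OF n(2)] unfolding s by (rule order_trans)
    show "\<bar>g (N - n) (N + n) - poly p (harm (N - n))\<bar> \<le> 2 * C * (1 + harm (2 * N)) ^ J / sqrt (real (N + 1 - n))"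
      using C(2)[of "N - n" "N + n"] le'[OF n(2)] unfolding s by (simp add: add.commute)
  qed
qed

definition zeta_nat :: "nat \<Rightarrow> real" where
  "zeta_nat c = suminf (\<lambda>n. 1 / real (Suc n) ^ c)"

lemma asym_poly_inverse_power_sum:
  assumes "c \<ge> 2"
  shows "asym_poly (\<lambda>N. \<Sum>n=1..N. 1 / real n ^ c) [:zeta_nat c:]"
proof -
  have "\<exists>L. asym_poly (\<lambda>N. \<Sum>n=1..N. 1 / real n ^ c) [:L:]"
  proof (rule asym_poly_convergent_sum[of _ 1 0])
    fix m :: nat assume "m > 0"
    then show "\<bar>1 / real m ^ c\<bar> \<le> 1 * (1 + harm m) ^ 0 / (real m)\<^sup>2"
      using assms by (simp add: divide_left_mono power_increasing)
  qed
  then obtain L where L: "asym_poly (\<lambda>N. \<Sum>n=1..N. 1 / real n ^ c) [:L:]" by blast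
  have "(\<lambda>N. \<Sum>n<N. 1 / real (Suc n) ^ c) = (\<lambda>N. \<Sum>n=1..N. 1 / real n ^ c)"
    by (intro ext sum.reindex_bij_witness[of _ "\<lambda>n. n - 1" Suc]) auto
  then have "(\<lambda>n. 1 / real (Suc n) ^ c) sums L"
    using asym_poly_const_tendsto[OF L] by (simp add: sums_def)
  then show ?thesis using L by (simp add: sums_iff zeta_nat_def)
qed

text \<open>Since \<open>1/n\<^sup>c\<close> with \<open>c \<ge> 2\<close> decays fast, only points \<open>n\<close> that are small compared with \<open>N\<close>
  matter, and there \<open>g (N + n) (N - n)\<close> is close to \<open>p (harm N)\<close>.\<close>
lemma asym_poly_sum_over_moving_point:
  assumes g: "asym_poly2 g p" and c: "c \<ge> 2"
  shows "asym_poly (\<lambda>N. \<Sum>n=1..N. g (N + n) (N - n) / real n ^ c + g (N - n) (N + n) / (- real n) ^ c)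
    (smult (if even c then 2 * zeta_nat c else 0) p)"
proof -
  obtain C J where C:
    "\<And>N n. 1 \<le> n \<Longrightarrow> n \<le> N \<Longrightarrow>
      \<bar>g (N + n) (N - n) - poly p (harm (N + n))\<bar> \<le> C * (1 + harm (2 * N)) ^ J / sqrt (real (N + 1 - n))"
    "\<And>N n. 1 \<le> n \<Longrightarrow> n \<le> N \<Longrightarrow>
      \<bar>g (N - n) (N + n) - poly p (harm (N - n))\<bar> \<le> C * (1 + harm (2 * N)) ^ J / sqrt (real (N + 1 - n))"
    using asym_poly2_near_diagonal[OF g] by blast
  have C0: "C \<ge> 0" using order_trans[OF abs_ge_zero C(1)[of 1 1]]
    by (simp add: harm_expand zero_le_mult_iff power_le_zero_eq)
  obtain B K where B: "B \<ge> 0"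
    "\<And>x y M. 0 \<le> x \<Longrightarrow> x \<le> M \<Longrightarrow> 0 \<le> y \<Longrightarrow> y \<le> M \<Longrightarrow> \<bar>poly p x - poly p y\<bar> \<le> B * (1 + M) ^ K * \<bar>x - y\<bar>"
    by (rule poly_lipschitz[of p]) blast
  \<comment> \<open>The deviation from \<open>p (harm N)\<close> consists of the error of \<open>g\<close> and of the change of \<open>harm\<close>, which is at
    most \<open>n / (N + 1 - n)\<close>; the factor \<open>1/n\<^sup>2\<close> absorbs this \<open>n\<close>.\<close>
  define e where "e N n = (g (N + n) (N - n) - poly p (harm N)) / real n ^ c
      + (g (N - n) (N + n) - poly p (harm N)) / (- real n) ^ c" for N n
  have bound: "\<bar>e N n\<bar> \<le> (2 * (B + C)) * (1 + harm (2 * N)) ^ (J + K) / (real n * sqrt (real (N + 1 - n)))"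
    if n: "1 \<le> n" "n \<le> N" for N n
  proof -
    define x s r where "x = 1 + (harm (2 * N) :: real)" and "s = sqrt (real (N + 1 - n))" and "r = real n"
    have x: "x \<ge> 1" unfolding x_def by (rule one_le_1_plus_harm)
    have s: "s \<ge> 1" "s > 0" "s \<le> s * s"
    proof -
      show "s \<ge> 1" using n by (simp add: s_def)
      then show "s > 0" "s \<le> s * s" by (auto simp: mult_le_cancel_left1)
    qed
    have ss: "s * s = real (N + 1 - n)" by (simp add: s_def)
    have r: "r \<ge> 1" using n by (simp add: r_def)
    have "harm (N + n) - harm N \<le> r / s" "harm N - harm (N - n) \<le> r / s"
    proof -
      have "harm (N + n) - harm N \<le> r / (real N + 1)" using harm_add_le by (simp add: r_def)
      also have "\<dots> \<le> r / (s * s)" using n r s unfolding ss by (intro divide_left_mono mult_pos_pos) auto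
      also have "\<dots> \<le> r / s" using r s by (intro divide_left_mono) auto
      finally show "harm (N + n) - harm N \<le> r / s" .
      have "harm N - harm (N - n) \<le> r / (real (N - n) + 1)"
        using harm_add_le[of "N - n" n] n by (simp add: r_def)
      also have "\<dots> = r / (s * s)" using n unfolding ss by (simp add: of_nat_diff)
      also have "\<dots> \<le> r / s" using r s by (intro divide_left_mono) auto
      finally show "harm N - harm (N - n) \<le> r / s" .
    qed
    moreover have "harm N \<le> (harm (N + n) :: real)" "harm (N - n) \<le> (harm N :: real)"
      by (auto intro: harm_mono)
    ultimately have d: "\<bar>harm (N + n) - harm N\<bar> \<le> r / s" "\<bar>harm (N - n) - harm N\<bar> \<le> r / s"
      by auto
    have h: "harm (N + n) \<le> (harm (2 * N) :: real)" "harm N \<le> (harm (2 * N) :: real)"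
      "harm (N - n) \<le> (harm (2 * N) :: real)"
      using n by (auto intro: harm_mono)
    have q: "C * x ^ J / s + B * x ^ K * (r / s) \<le> (B + C) * x ^ (J + K) * (r / s)"
    proof -
      have "C * x ^ J / s \<le> C * x ^ (J + K) * (r / s)"
      proof -
        have "C * x ^ J \<le> C * x ^ (J + K) * r"
          using C0 x r mult_mono[of "C * x ^ J" "C * x ^ (J + K)" 1 r]
          by (simp add: mult_left_mono power_increasing)
        then show ?thesis using s by (simp add: divide_right_mono)
      qed
      moreover have "B * x ^ K * (r / s) \<le> B * x ^ (J + K) * (r / s)"
        using B(1) x r s by (intro mult_right_mono mult_left_mono power_increasing) auto
      ultimately show ?thesis by (simp add: algebra_simps)
    qed
    have 1: "\<bar>g (N + n) (N - n) - poly p (harm N)\<bar> \<le> (B + C) * x ^ (J + K) * (r / s)"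
    proof -
      have "\<bar>poly p (harm (N + n)) - poly p (harm N)\<bar> \<le> B * x ^ K * \<bar>harm (N + n) - harm N\<bar>"
        using B(2)[of "harm (N + n)" "harm (2 * N)" "harm N"] h by (simp add: x_def harm_nonneg)
      also have "\<dots> \<le> B * x ^ K * (r / s)"
        using B(1) x d by (intro mult_left_mono) auto
      finally show ?thesis using C(1)[OF n, folded x_def s_def] q by linarith
    qed
    have 2: "\<bar>g (N - n) (N + n) - poly p (harm N)\<bar> \<le> (B + C) * x ^ (J + K) * (r / s)"
    proof -
      have "\<bar>poly p (harm (N - n)) - poly p (harm N)\<bar> \<le> B * x ^ K * \<bar>harm (N - n) - harm N\<bar>"
        using B(2)[of "harm (N - n)" "harm (2 * N)" "harm N"] h by (simp add: x_def harm_nonneg)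
      also have "\<dots> \<le> B * x ^ K * (r / s)"
        using B(1) x d by (intro mult_left_mono) auto
      finally show ?thesis using C(2)[OF n, folded x_def s_def] q by linarith
    qed
    define t where "t = (B + C) * x ^ (J + K)"
    have t: "t \<ge> 0" using B(1) C0 x by (simp add: t_def)
    have dv: "\<bar>y / z ^ c\<bar> \<le> t / (r * s)" if "\<bar>y\<bar> \<le> t * (r / s)" "\<bar>z\<bar> = r" for y z
    proof -
      have "\<bar>y / z ^ c\<bar> \<le> t * (r / s) / r ^ c"
        unfolding abs_divide power_abs using that r by (simp only: that(2)) (intro divide_right_mono, auto)
      also have "\<dots> \<le> t * (r / s) / r ^ 2"
        using t r s c by (intro divide_left_mono power_increasing mult_nonneg_nonneg mult_pos_pos) auto
      also have "\<dots> = t / (r * s)" using r by (simp add: power2_eq_square)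
      finally show ?thesis .
    qed
    have "\<bar>e N n\<bar> \<le> \<bar>(g (N + n) (N - n) - poly p (harm N)) / real n ^ c\<bar>
        + \<bar>(g (N - n) (N + n) - poly p (harm N)) / (- real n) ^ c\<bar>"
      unfolding e_def by (rule abs_triangle_ineq)
    also have "\<dots> \<le> t / (r * s) + t / (r * s)"
      using 1 2 by (intro add_mono dv) (auto simp: t_def r_def)
    also have "\<dots> = 2 * t / (r * s)" by simp
    finally show ?thesis unfolding t_def x_def s_def r_def by (simp only: mult.assoc)
  qed
  have "asym_poly (\<lambda>N. \<Sum>n=1..N. e N n) 0"
    using asym_poly_sum_remainder[of e "2 * (B + C)" "J + K"] bound by blast
  moreover have "asym_poly (\<lambda>N. (1 + (-1) ^ c) * (\<Sum>n=1..N. 1 / real n ^ c) * poly p (harm N))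
      (smult (1 + (-1) ^ c) [:zeta_nat c:] * p)"
    by (intro asym_poly_mult asym_poly_cmult asym_poly_inverse_power_sum c asym_poly_exact) simp
  ultimately have "asym_poly (\<lambda>N. (\<Sum>n=1..N. e N n)
      + (1 + (-1) ^ c) * (\<Sum>n=1..N. 1 / real n ^ c) * poly p (harm N))
      (0 + smult (1 + (-1) ^ c) [:zeta_nat c:] * p)"
    by (rule asym_poly_add)
  moreover have "(\<Sum>n=1..N. e N n) + (1 + (-1) ^ c) * (\<Sum>n=1..N. 1 / real n ^ c) * poly p (harm N)
      = (\<Sum>n=1..N. g (N + n) (N - n) / real n ^ c + g (N - n) (N + n) / (- real n) ^ c)" for N
  proof -
    have i: "1 / (- real n) ^ c = (-1) ^ c / real n ^ c" for n
      by (cases "even c") (auto simp: power_minus_odd)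
    have "g (N + n) (N - n) / real n ^ c + g (N - n) (N + n) / (- real n) ^ c
        = e N n + (1 + (-1) ^ c) * (1 / real n ^ c) * poly p (harm N)" for n
      unfolding e_def diff_divide_distrib
      using i[of n] by (simp add: algebra_simps divide_inverse)
    then show ?thesis by (simp add: sum.distrib sum_distrib_left sum_distrib_right)
  qed
  moreover have "0 + smult (1 + (-1) ^ c) [:zeta_nat c:] * p
      = smult (if even c then 2 * zeta_nat c else 0) p" by simp
  ultimately show ?thesis by simp
qed

text \<open>For \<open>c = 1\<close> the leading term would contribute \<open>p (harm (N + n)) - p (harm (N - n))\<close> divided by \<open>n\<close>,
  whose sum over \<open>n\<close> is in general not negligible; hence the hypothesis \<open>p = 0\<close>.\<close>
lemma asym_poly_sum_over_moving_point_1: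
  assumes g: "asym_poly2 g 0"
  shows "asym_poly (\<lambda>N. \<Sum>n=1..N. g (N + n) (N - n) / real n + g (N - n) (N + n) / (- real n)) 0"
proof -
  obtain C J where C:
    "\<And>N n. 1 \<le> n \<Longrightarrow> n \<le> N \<Longrightarrow>
      \<bar>g (N + n) (N - n) - poly 0 (harm (N + n))\<bar> \<le> C * (1 + harm (2 * N)) ^ J / sqrt (real (N + 1 - n))"
    "\<And>N n. 1 \<le> n \<Longrightarrow> n \<le> N \<Longrightarrow>
      \<bar>g (N - n) (N + n) - poly 0 (harm (N - n))\<bar> \<le> C * (1 + harm (2 * N)) ^ J / sqrt (real (N + 1 - n))"
    using asym_poly2_near_diagonal[OF g] by blast
  show ?thesis
  proof (rule asym_poly_sum_remainder[of _ "2 * C" J])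
    fix N n :: nat assume n: "1 \<le> n" "n \<le> N"
    let ?b = "C * (1 + harm (2 * N)) ^ J / sqrt (real (N + 1 - n))"
    have "\<bar>g (N + n) (N - n) / real n + g (N - n) (N + n) / - real n\<bar>
        \<le> \<bar>g (N + n) (N - n)\<bar> / real n + \<bar>g (N - n) (N + n)\<bar> / real n"
      by (rule order_trans[OF abs_triangle_ineq]) simp
    also have "\<dots> \<le> ?b / real n + ?b / real n"
      using C(1)[OF n] C(2)[OF n] by (intro add_mono divide_right_mono) auto
    finally show "\<bar>g (N + n) (N - n) / real n + g (N - n) (N + n) / - real n\<bar>
        \<le> 2 * C * (1 + harm (2 * N)) ^ J / (real n * sqrt (real (N + 1 - n)))"
      by (simp add: mult_ac)
  qed
qed

lemma sum_inverse_sqrt_le: "(\<Sum>P\<le>M. 1 / sqrt (real P + 1)) \<le> 2 * sqrt (real M + 1)"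
proof (induction M)
  case (Suc M)
  have "1 / sqrt (real M + 2) \<le> 2 * (sqrt (real M + 2) - sqrt (real M + 1))"
  proof -
    define a b where "a = sqrt (real M + 2)" and "b = sqrt (real M + 1)"
    have ab: "a > 0" "b \<ge> 0" "b \<le> a" "a * a - b * b = 1" by (auto simp: a_def b_def)
    then have "1 = (a - b) * (a + b)" by (simp add: algebra_simps)
    also have "\<dots> \<le> (a - b) * (2 * a)" using ab by (intro mult_left_mono) auto
    finally have "1 / a \<le> (a - b) * (2 * a) / a" using ab by (intro divide_right_mono) auto
    then show ?thesis using ab by (simp add: a_def b_def)
  qed
  with Suc show ?case by (simp add: add.commute)
qed simp

text \<open>The error of \<open>g P (2 N - P)\<close> summed over \<open>P\<close> is of order \<open>sqrt N\<close> up to logarithms, so a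
  nonzero \<open>p\<close> would make the sum grow linearly.\<close>
lemma asym_poly2_sum_zero_imp_zero:
  assumes g: "asym_poly2 g p" and zero: "\<And>N. (\<Sum>P\<le>2 * N. g P (2 * N - P)) = 0"
  shows "p = 0"
proof (rule poly_zero_if_not_bounded_below)
  fix q :: "real poly" and d :: real
  assume q: "q = p \<or> q = - p" and d: "d > 0"
  from g obtain C J where C: "C \<ge> 0" "\<And>P Q. \<bar>g P Q - poly p (harm P)\<bar>
     \<le> C * (1 + harm (P + Q)) ^ J * (1 / sqrt (real P + 1) + 1 / sqrt (real Q + 1))"
    by (rule asym_poly2E) blast
  have small: "\<bar>\<Sum>P\<le>2 * N. poly p (harm P)\<bar> \<le> 4 * C * (1 + harm (2 * N)) ^ J * sqrt (real (2 * N) + 1)" for N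
  proof -
    have "\<bar>\<Sum>P\<le>2 * N. poly p (harm P)\<bar> = \<bar>\<Sum>P\<le>2 * N. g P (2 * N - P) - poly p (harm P)\<bar>"
      by (simp add: sum_subtractf zero)
    also have "\<dots> \<le> (\<Sum>P\<le>2 * N. C * (1 + harm (2 * N)) ^ J
        * (1 / sqrt (real P + 1) + 1 / sqrt (real (2 * N - P) + 1)))"
    proof (intro order_trans[OF sum_abs] sum_mono)
      fix P assume "P \<in> {..2 * N}"
      then show "\<bar>g P (2 * N - P) - poly p (harm P)\<bar> \<le> C * (1 + harm (2 * N)) ^ J
        * (1 / sqrt (real P + 1) + 1 / sqrt (real (2 * N - P) + 1))"
        using C(2)[of P "2 * N - P"] by simp
    qed
    also have "\<dots> = C * (1 + harm (2 * N)) ^ J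
        * ((\<Sum>P\<le>2 * N. 1 / sqrt (real P + 1)) + (\<Sum>P\<le>2 * N. 1 / sqrt (real (2 * N - P) + 1)))"
      by (simp add: sum_distrib_left sum.distrib distrib_left)
    also have "(\<Sum>P\<le>2 * N. 1 / sqrt (real (2 * N - P) + 1)) = (\<Sum>P\<le>2 * N. 1 / sqrt (real P + 1))"
      by (rule sum.reindex_bij_witness[of _ "\<lambda>P. 2 * N - P" "\<lambda>P. 2 * N - P"]) auto
    also have "C * (1 + harm (2 * N)) ^ J * ((\<Sum>P\<le>2 * N. 1 / sqrt (real P + 1)) + (\<Sum>P\<le>2 * N. 1 / sqrt (real P + 1)))
        \<le> C * (1 + harm (2 * N)) ^ J * (2 * sqrt (real (2 * N) + 1) + 2 * sqrt (real (2 * N) + 1))"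
      using C(1) one_le_1_plus_harm[of "2 * N"] by (intro mult_left_mono add_mono sum_inverse_sqrt_le) auto
    finally show ?thesis by simp
  qed
  show "\<not> (\<exists>x0. \<forall>x\<ge>x0. poly q x \<ge> d)"
  proof
    assume "\<exists>x0. \<forall>x\<ge>x0. poly q x \<ge> d"
    then obtain x0 where x0: "\<And>x. x \<ge> x0 \<Longrightarrow> poly q x \<ge> d" by blast
    have "\<forall>\<^sub>F n in sequentially. harm n \<ge> x0"
      using harm_at_top by (auto simp: filterlim_at_top)
    then obtain P0 where P0: "\<And>P. P \<ge> P0 \<Longrightarrow> harm P \<ge> x0" by (auto simp: eventually_sequentially)
    \<comment> \<open>\<open>A\<close> compensates for the finitely many \<open>P\<close> where the lower bound \<open>d\<close> may fail.\<close>
    define A where "A = (\<Sum>P<P0. \<bar>poly q (harm P)\<bar> + d)"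
    have lower: "(\<Sum>P\<le>M. poly q (harm P)) \<ge> d * (real M + 1) - A" for M
    proof -
      have "d - (if P < P0 then \<bar>poly q (harm P)\<bar> + d else 0) \<le> poly q (harm P)" for P
        using x0[OF P0[of P]] by auto
      then have "(\<Sum>P\<le>M. d - (if P < P0 then \<bar>poly q (harm P)\<bar> + d else 0)) \<le> (\<Sum>P\<le>M. poly q (harm P))"
        by (intro sum_mono)
      moreover have "(\<Sum>P\<le>M. if P < P0 then \<bar>poly q (harm P)\<bar> + d else 0) \<le> A"
      proof -
        have "(\<Sum>P\<le>M. if P < P0 then \<bar>poly q (harm P)\<bar> + d else 0)
            = (\<Sum>P\<in>{..M} \<inter> {..<P0}. \<bar>poly q (harm P)\<bar> + d)"
          by (subst sum.inter_restrict) auto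
        also have "\<dots> \<le> A" unfolding A_def using d by (intro sum_mono2) auto
        finally show ?thesis .
      qed
      ultimately show ?thesis by (simp add: sum_subtractf algebra_simps)
    qed
    have "(\<Sum>P\<le>2 * N. poly q (harm P)) = (\<Sum>P\<le>2 * N. poly p (harm P))
        \<or> (\<Sum>P\<le>2 * N. poly q (harm P)) = - (\<Sum>P\<le>2 * N. poly p (harm P))" for N
      using q by (auto simp: sum_negf)
    then have upper: "(\<Sum>P\<le>2 * N. poly q (harm P)) \<le> 4 * C * (1 + harm (2 * N)) ^ J * sqrt (real (2 * N) + 1)" for N
      using small[of N] by (metis abs_le_iff minus_le_iff abs_minus_cancel)
    have "d \<le> 4 * C * harm_rate J (2 * N) + A / (real (2 * N) + 1)" for N
    proof -
      define y where "y = real (2 * N) + 1"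
      have y: "y > 0" by (simp add: y_def)
      have "d * y \<le> 4 * C * (1 + harm (2 * N)) ^ J * sqrt y + A"
        using order_trans[OF lower upper, of N] by (simp add: y_def)
      then have "d \<le> (4 * C * (1 + harm (2 * N)) ^ J * sqrt y + A) / y"
        using y by (simp add: pos_le_divide_eq)
      also have "\<dots> = 4 * C * (1 + harm (2 * N)) ^ J * (sqrt y / y) + A / y"
        by (simp add: add_divide_distrib)
      also have "sqrt y / y = 1 / sqrt y"
        using y by (simp add: divide_simps)
      finally show ?thesis by (simp add: harm_rate_def y_def)
    qed
    moreover have "(\<lambda>N. 4 * C * harm_rate J (2 * N) + A / (real (2 * N) + 1)) \<longlonglongrightarrow> 4 * C * 0 + 0"
    proof (intro tendsto_add tendsto_mult tendsto_const)
      show "(\<lambda>N. harm_rate J (2 * N)) \<longlonglongrightarrow> 0"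
        by (rule filterlim_compose[OF harm_rate_tendsto_0]) real_asymp
      show "(\<lambda>N. A / (real (2 * N) + 1)) \<longlonglongrightarrow> 0" by real_asymp
    qed
    ultimately have "d \<le> 4 * C * 0 + 0" by (intro tendsto_lowerbound) auto
    with d show False by simp
  qed
qed

section \<open>Linear extension to finitely supported functions on words\<close>

lemma lookup_qscale [simp]: "Poly_Mapping.lookup (qscale c p) w = c * Poly_Mapping.lookup p w"
  by (simp add: qscale_def Poly_Mapping.map.rep_eq when_def)

lemma keys_qscale: "Poly_Mapping.keys (qscale c p) \<subseteq> Poly_Mapping.keys p"
  by (auto simp: in_keys_iff)

lemma qscale_0_left [simp]: "qscale 0 p = 0"
  by (intro poly_mapping_eqI) simp

lemma qscale_1 [simp]: "qscale 1 p = p"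
  by (intro poly_mapping_eqI) simp

lemma qscale_add_left: "qscale (c + d) p = qscale c p + qscale d p"
  by (intro poly_mapping_eqI) (simp add: lookup_add algebra_simps)

lemma qscale_add_right: "qscale c (p + q) = qscale c p + qscale c q"
  by (intro poly_mapping_eqI) (simp add: lookup_add algebra_simps)

lemma qscale_Suc: "qscale (of_nat (Suc n)) p = qscale (of_nat n) p + p"
  by (simp add: qscale_add_left add.commute)

lemma qscale_qscale: "qscale c (qscale d p) = qscale (c * d) p"
  by (intro poly_mapping_eqI) simp

lemma qscale_sum: "qscale c (sum f A) = (\<Sum>x\<in>A. qscale c (f x))"
  by (intro poly_mapping_eqI) (simp add: lookup_sum sum_distrib_left)

lemma vector_space_qscale: "vector_space qscale"
  by unfold_locales (auto simp: qscale_add_left qscale_add_right qscale_qscale)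

lemma vector_space_of_rat_mult: "vector_space (\<lambda>c x. of_rat c * (x :: real))"
  by unfold_locales (auto simp: algebra_simps of_rat_add of_rat_mult)

lemma lin_ext_eq_sum:
  "finite A \<Longrightarrow> Poly_Mapping.keys p \<subseteq> A \<Longrightarrow>
     lin_ext f p = (\<Sum>w\<in>A. qscale (Poly_Mapping.lookup p w) (f w))"
  unfolding lin_ext_def by (intro sum.mono_neutral_left) (auto simp: in_keys_iff)

lemma lin_ext_add: "lin_ext f (p + q) = lin_ext f p + lin_ext f q"
  using keys_add[of p q]
  by (simp add: lin_ext_eq_sum[of "Poly_Mapping.keys p \<union> Poly_Mapping.keys q"] lookup_add
      qscale_add_left sum.distrib)

lemma lin_ext_qscale: "lin_ext f (qscale c p) = qscale c (lin_ext f p)"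
  unfolding lin_ext_def[of f p] qscale_sum
  by (subst lin_ext_eq_sum[OF _ keys_qscale]) (simp_all add: qscale_qscale)

lemma lin_ext_word [simp]: "lin_ext f (word w) = f w"
  by (simp add: lin_ext_def word_def)

lemma keys_word [simp]: "Poly_Mapping.keys (word w) = {w}"
  by (simp add: word_def)

lemma keys_lin_ext: "Poly_Mapping.keys (lin_ext f p) \<subseteq> (\<Union>w\<in>Poly_Mapping.keys p. Poly_Mapping.keys (f w))"
proof -
  have "Poly_Mapping.keys (lin_ext f p)
      \<subseteq> (\<Union>w\<in>Poly_Mapping.keys p. Poly_Mapping.keys (qscale (Poly_Mapping.lookup p w) (f w)))"
    unfolding lin_ext_def by (rule keys_sum)
  also have "\<dots> \<subseteq> (\<Union>w\<in>Poly_Mapping.keys p. Poly_Mapping.keys (f w))"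
    by (intro UN_mono keys_qscale order_refl)
  finally show ?thesis .
qed

definition real_ext :: "(nat list \<Rightarrow> real) \<Rightarrow> (nat list \<Rightarrow>\<^sub>0 rat) \<Rightarrow> real" where
  "real_ext g p = (\<Sum>w\<in>Poly_Mapping.keys p. of_rat (Poly_Mapping.lookup p w) * g w)"

lemma real_ext_eq_sum:
  "finite A \<Longrightarrow> Poly_Mapping.keys p \<subseteq> A \<Longrightarrow>
     real_ext g p = (\<Sum>w\<in>A. of_rat (Poly_Mapping.lookup p w) * g w)"
  unfolding real_ext_def by (intro sum.mono_neutral_left) (auto simp: in_keys_iff)

lemma real_ext_add: "real_ext g (p + q) = real_ext g p + real_ext g q"
  using keys_add[of p q]
  by (simp add: real_ext_eq_sum[of "Poly_Mapping.keys p \<union> Poly_Mapping.keys q"] lookup_add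
      of_rat_add algebra_simps sum.distrib)

lemma real_ext_qscale: "real_ext g (qscale c p) = of_rat c * real_ext g p"
  unfolding real_ext_def[of g p] sum_distrib_left
  by (subst real_ext_eq_sum[OF _ keys_qscale]) (simp_all add: of_rat_mult mult.assoc)

lemma real_ext_word [simp]: "real_ext g (word w) = g w"
  by (simp add: real_ext_def word_def)

lemma real_ext_zero [simp]: "real_ext g 0 = 0"
  by (simp add: real_ext_def)

lemma real_ext_sum: "real_ext g (sum f A) = (\<Sum>x\<in>A. real_ext g (f x))"
  by (induction A rule: infinite_finite_induct) (auto simp: real_ext_add)

lemma real_ext_lin_ext: "real_ext g (lin_ext f p) = real_ext (\<lambda>w. real_ext g (f w)) p"
  by (simp add: lin_ext_def real_ext_sum real_ext_qscale) (simp add: real_ext_def)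

lemma real_ext_append_last: "real_ext g (append_last a p) = real_ext (\<lambda>w. g (w @ [a])) p"
  by (simp add: append_last_def real_ext_lin_ext)

lemma real_ext_plus_fun: "real_ext (\<lambda>w. g w + c * h w) p = real_ext g p + c * real_ext h p"
  by (simp add: real_ext_def sum.distrib sum_distrib_left algebra_simps)

lemma real_ext_cong: "(\<And>w. w \<in> Poly_Mapping.keys p \<Longrightarrow> g w = h w) \<Longrightarrow> real_ext g p = real_ext h p"
  by (simp add: real_ext_def)

lemma linear_real_ext: "Vector_Spaces.linear qscale (\<lambda>c x. of_rat c * x) (real_ext g)"
  by (intro Vector_Spaces.linear.intro vector_space_qscale vector_space_of_rat_mult
      module_hom.intro module_hom_axioms.intro)
     (auto simp: real_ext_add real_ext_qscale module_iff_vector_space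
       intro: vector_space_qscale vector_space_of_rat_mult)

text \<open>A linear map is determined by its values on words, so the regularization can be studied there.\<close>
lemma linear_eq_real_ext:
  assumes "Vector_Spaces.linear qscale (\<lambda>c x. of_rat c * x) Z"
  shows "Z p = real_ext (\<lambda>w. Z (word w)) p"
proof -
  interpret Vector_Spaces.linear qscale "\<lambda>c x. of_rat c * x" Z by fact
  have "p = lin_ext word p"
    by (intro poly_mapping_eqI)
       (simp add: lin_ext_def lookup_sum word_def lookup_single when_def in_keys_iff
         if_distrib[of "(*) _"] sum.delta cong: if_cong)
  then have "Z p = Z (\<Sum>w\<in>Poly_Mapping.keys p. qscale (Poly_Mapping.lookup p w) (word w))"
    by (simp add: lin_ext_def)
  then show ?thesis by (simp add: sum scale real_ext_def)
qed

lemma keys_append_last: "Poly_Mapping.keys (append_last a p) \<subseteq> (\<lambda>w. w @ [a]) ` Poly_Mapping.keys p"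
  unfolding append_last_def by (rule order_trans[OF keys_lin_ext]) auto

lemma append_last_add: "append_last a (p + q) = append_last a p + append_last a q"
  by (simp add: append_last_def lin_ext_add)

lemma append_last_qscale: "append_last a (qscale c p) = qscale c (append_last a p)"
  by (simp add: append_last_def lin_ext_qscale)

lemma append_last_word [simp]: "append_last a (word w) = word (w @ [a])"
  by (simp add: append_last_def)

lemma is_index_simps [simp]:
  "is_index []" "is_index (k # w) \<longleftrightarrow> 0 < k \<and> is_index w"
  "is_index (u @ v) \<longleftrightarrow> is_index u \<and> is_index v" "is_index (rev u) \<longleftrightarrow> is_index u"
  by (auto simp: is_index_def)

lemma keys_addD: "w \<in> Poly_Mapping.keys (p + q) \<Longrightarrow> w \<in> Poly_Mapping.keys p \<or> w \<in> Poly_Mapping.keys q"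
  using keys_add[of p q] by blast

lemma keys_stuffle_words:
  "is_index u \<Longrightarrow> is_index v \<Longrightarrow> w \<in> Poly_Mapping.keys (stuffle_words u v) \<Longrightarrow> is_index w"
proof (induction u v arbitrary: w rule: stuffle_words.induct)
  case prems: (3 k a l b)
  have "w \<in> Poly_Mapping.keys (append_last a (stuffle_words k (l @ [b]))
      + append_last b (stuffle_words (k @ [a]) l) + append_last (a + b) (stuffle_words k l))"
    using prems(6) by simp
  then consider
      "w \<in> Poly_Mapping.keys (append_last a (stuffle_words k (l @ [b])))"
    | "w \<in> Poly_Mapping.keys (append_last b (stuffle_words (k @ [a]) l))"
    | "w \<in> Poly_Mapping.keys (append_last (a + b) (stuffle_words k l))"
    using keys_addD by meson
  then show ?case
  proof cases
    case 1
    then obtain u where "u \<in> Poly_Mapping.keys (stuffle_words k (l @ [b]))" "w = u @ [a]"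
      using keys_append_last by blast
    then show ?thesis using prems(1)[of u] prems(4,5) by simp
  next
    case 2
    then obtain u where "u \<in> Poly_Mapping.keys (stuffle_words (k @ [a]) l)" "w = u @ [b]"
      using keys_append_last by blast
    then show ?thesis using prems(2)[of u] prems(4,5) by simp
  next
    case 3
    then obtain u where "u \<in> Poly_Mapping.keys (stuffle_words k l)" "w = u @ [a + b]"
      using keys_append_last by blast
    then show ?thesis using prems(3)[of u] prems(4,5) by simp
  qed
qed auto

lemma stuffle_index_space: "p \<in> index_space \<Longrightarrow> q \<in> index_space \<Longrightarrow> stuffle p q \<in> index_space"
proof -
  assume pq: "p \<in> index_space" "q \<in> index_space"
  have sub: "Poly_Mapping.keys (stuffle p q)
      \<subseteq> (\<Union>u\<in>Poly_Mapping.keys p. \<Union>v\<in>Poly_Mapping.keys q. Poly_Mapping.keys (stuffle_words u v))"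
    unfolding stuffle_def by (intro order_trans[OF keys_lin_ext] UN_mono keys_lin_ext order_refl)
  have "is_index w" if w: "w \<in> Poly_Mapping.keys (stuffle p q)" for w
  proof -
    obtain u v where "u \<in> Poly_Mapping.keys p" "v \<in> Poly_Mapping.keys q"
      "w \<in> Poly_Mapping.keys (stuffle_words u v)"
      using subsetD[OF sub w] by (elim UN_E)
    then show ?thesis using pq keys_stuffle_words[of u v w] by (simp add: index_space_def)
  qed
  then show "stuffle p q \<in> index_space" by (simp add: index_space_def)
qed

section \<open>Truncated multiple zeta values\<close>

definition mzv_trunc :: "nat \<Rightarrow> nat list \<Rightarrow> real" where
  "mzv_trunc N w = nested_sum (\<lambda>m k. 1 / real m ^ k) [1..<Suc N] w"

lemma mzv_trunc_Nil [simp]: "mzv_trunc N [] = 1"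
  by (simp add: mzv_trunc_def)

lemma mzv_trunc_0: "mzv_trunc 0 w = conv_unit w"
  by (simp add: mzv_trunc_def nested_sum_no_points)

lemma mzv_trunc_Suc_snoc:
  "mzv_trunc (Suc N) (w @ [k]) = mzv_trunc N (w @ [k]) + 1 / real (Suc N) ^ k * mzv_trunc N w"
  using nested_sum_snoc_snoc[of "\<lambda>m k. 1 / real m ^ k" "[1..<Suc N]" "Suc N" w k]
  by (simp add: mzv_trunc_def del: of_nat_Suc)

lemma mzv_trunc_snoc: "mzv_trunc N (w @ [k]) = (\<Sum>m=1..N. mzv_trunc (m - 1) w / real m ^ k)"
  by (induction N) (auto simp: mzv_trunc_0 mzv_trunc_Suc_snoc conv_unit_def)

lemma mzv_trunc_nonneg: "mzv_trunc N w \<ge> 0"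
  by (induction w arbitrary: N rule: rev_induct) (auto simp: mzv_trunc_snoc intro!: sum_nonneg)

lemma mzv_trunc_1: "mzv_trunc N [1] = harm N"
  using mzv_trunc_snoc[of N "[]" 1] by (simp add: harm_def inverse_eq_divide)

lemma mzv_trunc_le: "is_index w \<Longrightarrow> mzv_trunc N w \<le> harm N ^ length w"
proof (induction w arbitrary: N rule: rev_induct)
  case (snoc k w)
  have "mzv_trunc N (w @ [k]) \<le> (\<Sum>m=1..N. harm N ^ length w * inverse (real m))"
    unfolding mzv_trunc_snoc
  proof (intro sum_mono)
    fix m assume m: "m \<in> {1..N}"
    have "mzv_trunc (m - 1) w \<le> harm (m - 1) ^ length w" using snoc by simp
    also have "\<dots> \<le> harm N ^ length w"
      using m by (intro power_mono harm_mono harm_nonneg) auto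
    finally have "mzv_trunc (m - 1) w / real m ^ k \<le> harm N ^ length w / real m ^ k"
      by (intro divide_right_mono) auto
    also have "\<dots> \<le> harm N ^ length w / real m ^ 1"
      using snoc.prems m by (intro divide_left_mono power_increasing zero_le_power harm_nonneg) auto
    finally show "mzv_trunc (m - 1) w / real m ^ k \<le> harm N ^ length w * inverse (real m)"
      by (simp add: divide_inverse)
  qed
  also have "\<dots> = harm N ^ length (w @ [k])"
    by (simp add: harm_def flip: sum_distrib_left)
  finally show ?case .
qed simp

text \<open>Truncated values are multiplicative for the stuffle product: in the product of two nested sums
  the largest summation variable of one factor is smaller than, larger than, or equal to that of the
  other one.\<close>
lemma mzv_trunc_stuffle_words:
  "real_ext (mzv_trunc N) (stuffle_words u v) = mzv_trunc N u * mzv_trunc N v"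
proof (induction N arbitrary: u v)
  case 0
  have "mzv_trunc 0 = conv_unit" by (intro ext mzv_trunc_0)
  moreover have "real_ext conv_unit (append_last a p) = 0" for a p
    unfolding real_ext_append_last unfolding real_ext_def by (simp add: conv_unit_def)
  ultimately show ?case
    by (cases "(u, v)" rule: stuffle_words.cases) (auto simp: real_ext_add)
next
  case (Suc N)
  have step: "real_ext (mzv_trunc (Suc N)) (append_last a p)
      = real_ext (mzv_trunc N) (append_last a p) + 1 / real (Suc N) ^ a * real_ext (mzv_trunc N) p" for a p
    unfolding real_ext_append_last mzv_trunc_Suc_snoc real_ext_plus_fun ..
  show ?case
  proof (cases "(u, v)" rule: stuffle_words.cases)
    case (3 k a l b)
    then have uv: "u = k @ [a]" "v = l @ [b]" by auto
    have "real_ext (mzv_trunc (Suc N)) (stuffle_words u v)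
        = real_ext (mzv_trunc N) (stuffle_words u v)
        + 1 / real (Suc N) ^ a * real_ext (mzv_trunc N) (stuffle_words k v)
        + 1 / real (Suc N) ^ b * real_ext (mzv_trunc N) (stuffle_words u l)
        + 1 / real (Suc N) ^ (a + b) * real_ext (mzv_trunc N) (stuffle_words k l)"
      by (simp add: uv real_ext_add step)
    also have "\<dots> = mzv_trunc (Suc N) u * mzv_trunc (Suc N) v"
      unfolding Suc.IH by (simp add: uv mzv_trunc_Suc_snoc power_add algebra_simps)
    finally show ?thesis .
  qed auto
qed

section \<open>Existence and uniqueness of the stuffle regularization\<close>

definition trailing_ones :: "nat list \<Rightarrow> nat" where
  "trailing_ones w = length (takeWhile (\<lambda>k. k = 1) (rev w))"

lemma trailing_ones_simps [simp]:
  "trailing_ones [] = 0" "trailing_ones (w @ [k]) = (if k = 1 then Suc (trailing_ones w) else 0)"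
  by (auto simp: trailing_ones_def)

lemma stuffle_words_Nil_right [simp]: "stuffle_words u [] = word u"
  by (cases u rule: rev_cases) auto

text \<open>Inserting a \<open>1\<close> next to \<open>r\<close> trailing ones can be done in \<open>r + 1\<close> ways; all other terms of the
  stuffle product have fewer trailing ones. This determines regularized values recursively.\<close>
lemma stuffle_words_one:
  assumes "is_index w"
  shows "\<exists>q. stuffle_words w [1] = qscale (of_nat (Suc (trailing_ones w))) (word (w @ [1])) + q
    \<and> (\<forall>v\<in>Poly_Mapping.keys q. is_index v \<and> trailing_ones v \<le> trailing_ones w)"
  using assms
proof (induction w rule: rev_induct)
  case Nil
  then show ?case by (auto intro!: exI[of _ 0])
next
  case (snoc a k)
  then obtain q where q: "stuffle_words k [1] = qscale (of_nat (Suc (trailing_ones k))) (word (k @ [1])) + q"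
    "\<forall>v\<in>Poly_Mapping.keys q. is_index v \<and> trailing_ones v \<le> trailing_ones k"
    by auto
  have eq: "stuffle_words (k @ [a]) [1]
      = qscale (of_nat (Suc (trailing_ones k))) (word (k @ [1, a])) + append_last a q
        + word (k @ [a, 1]) + word (k @ [a + 1])"
    using stuffle_words.simps(3)[of k a "[]" 1] q(1)
    by (simp add: append_last_add append_last_qscale)
  show ?case
  proof (cases "a = 1")
    case True
    have "stuffle_words (k @ [a]) [1] = qscale (of_nat (Suc (trailing_ones (k @ [a])))) (word ((k @ [a]) @ [1]))
        + (append_last 1 q + word (k @ [2]))"
      unfolding eq by (simp add: True qscale_Suc add_ac numeral_2_eq_2 del: of_nat_Suc)
    moreover have "\<forall>v\<in>Poly_Mapping.keys (append_last 1 q + word (k @ [2])).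
        is_index v \<and> trailing_ones v \<le> trailing_ones (k @ [a])"
      using keys_add[of "append_last 1 q" "word (k @ [2])"] keys_append_last[of 1 q] q(2) snoc.prems
      by (fastforce simp: True)
    ultimately show ?thesis by blast
  next
    case False
    define q' where "q' = qscale (of_nat (Suc (trailing_ones k))) (word ((k @ [1]) @ [a])) + append_last a q
        + word (k @ [a + 1])"
    have "stuffle_words (k @ [a]) [1] = qscale (of_nat (Suc (trailing_ones (k @ [a])))) (word ((k @ [a]) @ [1])) + q'"
      unfolding eq q'_def using False by (simp add: add_ac)
    moreover have "is_index v \<and> trailing_ones v \<le> trailing_ones (k @ [a])" if v: "v \<in> Poly_Mapping.keys q'" for v
    proof -
      have "v \<in> Poly_Mapping.keys (qscale (of_nat (Suc (trailing_ones k))) (word ((k @ [1]) @ [a])))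
          \<union> Poly_Mapping.keys (append_last a q) \<union> Poly_Mapping.keys (word (k @ [a + 1]))"
        using v unfolding q'_def by (meson UnCI UnE keys_add subsetD)
      then consider "v = (k @ [1]) @ [a]" | u where "v = u @ [a]" "u \<in> Poly_Mapping.keys q" | "v = k @ [a + 1]"
        using keys_qscale[of _ "word ((k @ [1]) @ [a])"] keys_append_last[of a q] by auto
      then show ?thesis
        using q(2) snoc.prems False by cases (auto simp: trailing_ones_def)
    qed
    ultimately show ?thesis by blast
  qed
qed

lemma trailing_ones_cases:
  assumes "is_index w"
  obtains "w = []" | u where "w = u @ [1]" | "w \<noteq> []" "2 \<le> last w" "trailing_ones w = 0"
proof (cases w rule: rev_cases)
  case (snoc u k)
  then show ?thesis using assms that by (cases "k = 1") auto
qed (use that in auto)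

lemma mzv_trunc_convergent:
  assumes "is_index w" "w \<noteq> []" "2 \<le> last w"
  shows "\<exists>c. asym_poly (\<lambda>N. mzv_trunc N w) [:c:]"
proof -
  from assms obtain u k where w: "w = u @ [k]" "2 \<le> k" "is_index u"
    by (cases w rule: rev_cases) auto
  show ?thesis unfolding w(1) mzv_trunc_snoc
  proof (rule asym_poly_convergent_sum[of _ 1 "length u"])
    fix m :: nat assume m: "m > 0"
    have "mzv_trunc (m - 1) u \<le> harm (m - 1) ^ length u" by (rule mzv_trunc_le) fact
    also have "\<dots> \<le> (1 + harm m) ^ length u"
      using harm_mono[of "m - 1" m, where 'a = real] by (intro power_mono harm_nonneg) auto
    finally have "mzv_trunc (m - 1) u / real m ^ k \<le> (1 + harm m) ^ length u / real m ^ k"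
      by (intro divide_right_mono) auto
    also have "\<dots> \<le> (1 + harm m) ^ length u / real m ^ 2"
      using m w one_le_1_plus_harm[of m] by (intro divide_left_mono power_increasing) auto
    finally show "\<bar>mzv_trunc (m - 1) u / real m ^ k\<bar> \<le> 1 * (1 + harm m) ^ length u / (real m)\<^sup>2"
      using mzv_trunc_nonneg by simp
  qed
qed

lemma asym_poly_real_ext:
  assumes "\<And>v. v \<in> Poly_Mapping.keys q \<Longrightarrow> asym_poly (\<lambda>N. mzv_trunc N v) (P v)"
  shows "asym_poly (\<lambda>N. real_ext (mzv_trunc N) q)
    (\<Sum>v\<in>Poly_Mapping.keys q. smult (of_rat (Poly_Mapping.lookup q v)) (P v))"
  unfolding real_ext_def using assms by (intro asym_poly_sum asym_poly_cmult)

text \<open>Solving the stuffle product of \<open>w\<close> and \<open>1\<close> for the word with the most trailing ones expresses a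
  divergent truncated value through \<open>harm\<close> and words with fewer trailing ones.\<close>
lemma mzv_trunc_asym_poly: "is_index w \<Longrightarrow> \<exists>p. asym_poly (\<lambda>N. mzv_trunc N w) p"
proof (induction "trailing_ones w" arbitrary: w rule: less_induct)
  case less
  from less.prems show ?case
  proof (cases rule: trailing_ones_cases)
    case 1
    then show ?thesis using asym_poly_const[of 1] by auto
  next
    case (2 u)
    have u: "is_index u" using less.prems 2 by simp
    define r where "r = trailing_ones u"
    obtain q where q: "stuffle_words u [1] = qscale (of_nat (Suc r)) (word w) + q"
      "\<forall>v\<in>Poly_Mapping.keys q. is_index v \<and> trailing_ones v \<le> r"
      using stuffle_words_one[OF u] unfolding 2 r_def by blast
    have "\<exists>P. \<forall>v\<in>Poly_Mapping.keys q. asym_poly (\<lambda>N. mzv_trunc N v) (P v)"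
      using q(2) less.hyps 2 by (intro bchoice) (auto simp: r_def)
    then obtain P where P: "\<And>v. v \<in> Poly_Mapping.keys q \<Longrightarrow> asym_poly (\<lambda>N. mzv_trunc N v) (P v)"
      by blast
    obtain p where p: "asym_poly (\<lambda>N. mzv_trunc N u) p"
      using less.hyps[of u] u 2 by auto
    have h: "asym_poly (\<lambda>N. mzv_trunc N [1]) [:0, 1:]"
      unfolding mzv_trunc_1 by (rule asym_poly_exact) simp
    have "mzv_trunc N w = 1 / real (Suc r) * (mzv_trunc N u * mzv_trunc N [1] - real_ext (mzv_trunc N) q)" for N
      unfolding mzv_trunc_stuffle_words[symmetric] q(1)
      by (simp add: real_ext_add real_ext_qscale of_rat_add of_rat_of_nat_eq)
    then show ?thesis
      using asym_poly_cmult[OF asym_poly_minus[OF asym_poly_mult[OF p h] asym_poly_real_ext[OF P]], where c = "1 / real (Suc r)"]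
      by auto
  next
    case 3
    then show ?thesis using mzv_trunc_convergent less.prems by blast
  qed
qed

definition trunc_poly :: "nat list \<Rightarrow> real poly" where
  "trunc_poly w = (THE p. asym_poly (\<lambda>N. mzv_trunc N w) p)"

lemma trunc_poly: "is_index w \<Longrightarrow> asym_poly (\<lambda>N. mzv_trunc N w) (trunc_poly w)"
  unfolding trunc_poly_def using mzv_trunc_asym_poly asym_poly_unique by (metis theI)

lemma trunc_poly_eqI: "asym_poly (\<lambda>N. mzv_trunc N w) p \<Longrightarrow> trunc_poly w = p"
  unfolding trunc_poly_def using asym_poly_unique by blast

subsection \<open>Convergent values as limits of truncated ones\<close>

definition trunc_domain :: "nat \<Rightarrow> nat \<Rightarrow> nat list set" where
  "trunc_domain N l = {ms. length ms = l \<and> sorted_wrt (<) ms \<and> set ms \<subseteq> {1..N}}"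

lemma finite_trunc_domain [simp]: "finite (trunc_domain N l)"
  by (rule finite_subset[OF _ finite_lists_length_eq[of "{1..N}" l]]) (auto simp: trunc_domain_def)

lemma trunc_domain_Suc:
  "trunc_domain N (Suc l) = (\<lambda>(m, ms). ms @ [m]) ` (SIGMA m:{1..N}. trunc_domain (m - 1) l)"
proof (intro equalityI subsetI)
  fix xs assume xs: "xs \<in> trunc_domain N (Suc l)"
  then obtain ms m where [simp]: "xs = ms @ [m]"
    by (cases xs rule: rev_cases) (auto simp: trunc_domain_def)
  have "x \<in> {1..m - 1}" if "x \<in> set ms" for x
  proof -
    have "x < m" "x \<in> {1..N}" using xs that by (auto simp: trunc_domain_def sorted_wrt_append)
    then show ?thesis by auto
  qed
  then have "(m, ms) \<in> (SIGMA m:{1..N}. trunc_domain (m - 1) l)"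
    using xs by (auto simp: trunc_domain_def sorted_wrt_append)
  then show "xs \<in> (\<lambda>(m, ms). ms @ [m]) ` (SIGMA m:{1..N}. trunc_domain (m - 1) l)"
    by (force intro: image_eqI)
next
  fix xs assume "xs \<in> (\<lambda>(m, ms). ms @ [m]) ` (SIGMA m:{1..N}. trunc_domain (m - 1) l)"
  then show "xs \<in> trunc_domain N (Suc l)"
    by (fastforce simp: trunc_domain_def sorted_wrt_append subset_iff)
qed

lemma sum_trunc_domain:
  "(\<Sum>ms\<in>trunc_domain N (length w). \<Prod>j<length w. 1 / real (ms ! j) ^ (w ! j)) = mzv_trunc N w"
proof (induction w arbitrary: N rule: rev_induct)
  case Nil
  have "trunc_domain N 0 = {[]}" by (auto simp: trunc_domain_def)
  then show ?case by simp
next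
  case (snoc k w)
  have inj: "inj_on (\<lambda>(m, ms). ms @ [m]) (SIGMA m:{1..N}. trunc_domain (m - 1) (length w))"
    by (auto simp: inj_on_def)
  have "(\<Sum>ms\<in>trunc_domain N (length (w @ [k])). \<Prod>j<length (w @ [k]). 1 / real (ms ! j) ^ ((w @ [k]) ! j))
      = (\<Sum>(m, ms)\<in>(SIGMA m:{1..N}. trunc_domain (m - 1) (length w)).
          \<Prod>j<Suc (length w). 1 / real ((ms @ [m]) ! j) ^ ((w @ [k]) ! j))"
  proof -
    have "length (w @ [k]) = Suc (length w)" by simp
    then show ?thesis unfolding \<open>length _ = _\<close> trunc_domain_Suc sum.reindex[OF inj] by (simp add: case_prod_unfold)
  qed
  also have "\<dots> = (\<Sum>(m, ms)\<in>(SIGMA m:{1..N}. trunc_domain (m - 1) (length w)).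
          (\<Prod>j<length w. 1 / real (ms ! j) ^ (w ! j)) * (1 / real m ^ k))"
  proof (intro sum.cong refl, clarify)
    fix m ms assume "ms \<in> trunc_domain (m - 1) (length w)"
    then have len: "length ms = length w" by (simp add: trunc_domain_def)
    have "(\<Prod>j<length w. 1 / real ((ms @ [m]) ! j) ^ ((w @ [k]) ! j)) = (\<Prod>j<length w. 1 / real (ms ! j) ^ (w ! j))"
      by (intro prod.cong) (auto simp: nth_append len)
    moreover have "(ms @ [m]) ! length w = m" by (simp add: nth_append len)
    ultimately show "(\<Prod>j<Suc (length w). 1 / real ((ms @ [m]) ! j) ^ ((w @ [k]) ! j))
        = (\<Prod>j<length w. 1 / real (ms ! j) ^ (w ! j)) * (1 / real m ^ k)" by simp
  qed
  also have "\<dots> = (\<Sum>m=1..N. \<Sum>ms\<in>trunc_domain (m - 1) (length w).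
          (\<Prod>j<length w. 1 / real (ms ! j) ^ (w ! j)) * (1 / real m ^ k))"
    by (simp add: sum.Sigma)
  also have "\<dots> = mzv_trunc N (w @ [k])"
    unfolding sum_distrib_right[symmetric] snoc.IH mzv_trunc_snoc by simp
  finally show ?case .
qed

text \<open>The truncated domains exhaust the summation domain, and the terms are nonnegative.\<close>
lemma mzv_eq_limit:
  assumes L: "(\<lambda>N. mzv_trunc N w) \<longlonglongrightarrow> L"
  shows "mzv w = L"
proof -
  define S where "S = {ms :: nat list. length ms = length w \<and> sorted_wrt (<) ms \<and> (\<forall>m\<in>set ms. 0 < m)}"
  define f where "f ms = (\<Prod>j<length w. 1 / real (ms ! j) ^ (w ! j))" for ms :: "nat list"
  let ?T = "\<lambda>N. trunc_domain N (length w)"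
  have sub: "?T N \<subseteq> S" for N by (auto simp: trunc_domain_def S_def)
  have ev: "\<forall>\<^sub>F N in sequentially. X \<subseteq> ?T N" if "finite X" "X \<subseteq> S" for X
  proof -
    have "finite (\<Union>(set ` X))" using that(1) by auto
    then obtain B where B: "\<And>m. m \<in> \<Union>(set ` X) \<Longrightarrow> m \<le> B"
      by (meson finite_nat_set_iff_bounded_le)
    have "X \<subseteq> ?T N" if "N \<ge> B" for N
      using \<open>X \<subseteq> S\<close> B that by (fastforce simp: S_def trunc_domain_def)
    then show ?thesis by (auto simp: eventually_sequentially)
  qed
  have f0: "f ms \<ge> 0" for ms by (simp add: f_def prod_nonneg)
  have lim: "filterlim ?T (finite_subsets_at_top S) sequentially"
    using ev sub by (auto simp: filterlim_finite_subsets_at_top)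
  have "Bseq (\<lambda>N. mzv_trunc N w)" using L by (intro convergent_imp_Bseq) (auto simp: convergent_def)
  then obtain K where K: "\<And>N. mzv_trunc N w \<le> K"
    by (auto simp: Bseq_def abs_le_iff)
  have "sum f X \<le> K" if X: "finite X" "X \<subseteq> S" for X
  proof -
    obtain N where "X \<subseteq> ?T N" using ev[OF X] by (auto simp: eventually_sequentially)
    then have "sum f X \<le> sum f (?T N)" using f0 by (intro sum_mono2) auto
    also have "\<dots> \<le> K" using K[of N] by (simp add: f_def sum_trunc_domain)
    finally show ?thesis .
  qed
  then have "f summable_on S"
    using f0 by (intro nonneg_bdd_above_summable_on) (auto intro!: bdd_aboveI[of _ K])
  then have "(f has_sum infsum f S) S" by (rule has_sum_infsum)
  then have "(\<lambda>N. sum f (?T N)) \<longlonglongrightarrow> infsum f S"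
    using filterlim_compose[OF _ lim] by (auto simp: has_sum_def)
  then have "(\<lambda>N. mzv_trunc N w) \<longlonglongrightarrow> infsum f S"
    by (simp add: f_def sum_trunc_domain)
  moreover have "mzv w = infsum f S" unfolding mzv_def S_def f_def ..
  ultimately show ?thesis using LIMSEQ_unique[OF _ L] by simp
qed

lemma trunc_poly_convergent:
  assumes "is_index w" "w \<noteq> []" "2 \<le> last w"
  shows "trunc_poly w = [:mzv w:]"
proof -
  obtain c where c: "asym_poly (\<lambda>N. mzv_trunc N w) [:c:]" using mzv_trunc_convergent[OF assms] by blast
  from mzv_eq_limit[OF asym_poly_const_tendsto[OF this]] trunc_poly_eqI[OF c] show ?thesis by simp
qed

subsection \<open>The regularized values are the constant terms\<close>

definition reg_value :: "nat list \<Rightarrow> real" where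
  "reg_value w = (if is_index w then poly (trunc_poly w) 0 else 0)"

text \<open>Multiplicativity holds for the truncated values, hence for their asymptotic polynomials by
  uniqueness, hence for the constant terms.\<close>
lemma is_stuffle_regularization_real_ext: "is_stuffle_regularization (real_ext reg_value)"
  unfolding is_stuffle_regularization_def
proof (intro conjI ballI allI impI)
  show "Vector_Spaces.linear qscale (\<lambda>c x. of_rat c * x) (real_ext reg_value)"
    by (rule linear_real_ext)
next
  fix p q assume p: "p \<in> index_space" and q: "q \<in> index_space"
  define Q where "Q p = (\<Sum>v\<in>Poly_Mapping.keys p. smult (of_rat (Poly_Mapping.lookup p v)) (trunc_poly v))"
    for p :: "nat list \<Rightarrow>\<^sub>0 rat"
  have Q: "asym_poly (\<lambda>N. real_ext (mzv_trunc N) p) (Q p)" "poly (Q p) 0 = real_ext reg_value p"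
    if "p \<in> index_space" for p
  proof -
    show "asym_poly (\<lambda>N. real_ext (mzv_trunc N) p) (Q p)"
      unfolding Q_def using that by (intro asym_poly_real_ext trunc_poly) (auto simp: index_space_def)
    show "poly (Q p) 0 = real_ext reg_value p"
      unfolding Q_def real_ext_def poly_sum using that
      by (intro sum.cong) (auto simp: reg_value_def index_space_def)
  qed
  have "real_ext (mzv_trunc N) (stuffle p q) = real_ext (mzv_trunc N) p * real_ext (mzv_trunc N) q" for N
  proof -
    have "real_ext (mzv_trunc N) (stuffle p q)
        = real_ext (\<lambda>u. real_ext (\<lambda>v. mzv_trunc N u * mzv_trunc N v) q) p"
      by (simp add: stuffle_def real_ext_lin_ext mzv_trunc_stuffle_words)
    also have "\<dots> = (\<Sum>u\<in>Poly_Mapping.keys p. \<Sum>v\<in>Poly_Mapping.keys q.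
        (of_rat (Poly_Mapping.lookup p u) * mzv_trunc N u) * (of_rat (Poly_Mapping.lookup q v) * mzv_trunc N v))"
      by (simp add: real_ext_def sum_distrib_left mult_ac)
    also have "\<dots> = real_ext (mzv_trunc N) p * real_ext (mzv_trunc N) q"
      by (simp only: real_ext_def sum_product)
    finally show ?thesis .
  qed
  then have "asym_poly (\<lambda>N. real_ext (mzv_trunc N) (stuffle p q)) (Q p * Q q)"
    using asym_poly_mult[OF Q(1)[OF p] Q(1)[OF q]] by simp
  from asym_poly_unique[OF Q(1)[OF stuffle_index_space[OF p q]] this]
  have "poly (Q (stuffle p q)) 0 = poly (Q p) 0 * poly (Q q) 0" by simp
  then show "real_ext reg_value (stuffle p q) = real_ext reg_value p * real_ext reg_value q"
    using Q(2) p q stuffle_index_space by simp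
next
  show "real_ext reg_value (word []) = 1"
    using trunc_poly_eqI[of "[]" "[:1:]"] asym_poly_const[of 1] by (simp add: reg_value_def)
next
  have "asym_poly (\<lambda>N. mzv_trunc N [1]) [:0, 1:]"
    unfolding mzv_trunc_1 by (rule asym_poly_exact) simp
  then show "real_ext reg_value (word [1]) = 0"
    by (simp add: reg_value_def trunc_poly_eqI)
qed (auto simp: reg_value_def trunc_poly_convergent)

text \<open>The same recursion on the number of trailing ones computes every regularized value from the
  convergent ones, because the value of the index \<open>1\<close> is prescribed.\<close>
lemma stuffle_regularization_unique:
  assumes Z: "is_stuffle_regularization Z" and Y: "is_stuffle_regularization Y"
  shows "Z = Y"
proof -
  have lin: "X p = real_ext (\<lambda>w. X (word w)) p" if "is_stuffle_regularization X" for X p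
    using that linear_eq_real_ext by (auto simp: is_stuffle_regularization_def)
  have one: "X (stuffle_words u [1]) = 0" if X: "is_stuffle_regularization X" and u: "is_index u" for X u
  proof -
    have "X (stuffle (word u) (word [1])) = X (word u) * X (word [1])"
      using X u by (simp add: is_stuffle_regularization_def index_space_def)
    then show ?thesis using X by (simp add: stuffle_def is_stuffle_regularization_def)
  qed
  have "Z (word w) = Y (word w)" if "is_index w" for w
    using that
  proof (induction "trailing_ones w" arbitrary: w rule: less_induct)
    case less
    from less.prems show ?case
    proof (cases rule: trailing_ones_cases)
      case 1
      then show ?thesis using Z Y by (simp add: is_stuffle_regularization_def)
    next
      case (2 u)
      have u: "is_index u" using less.prems 2 by simp
      define r where "r = trailing_ones u"
      obtain q where q: "stuffle_words u [1] = qscale (of_nat (Suc r)) (word w) + q"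
        "\<forall>v\<in>Poly_Mapping.keys q. is_index v \<and> trailing_ones v \<le> r"
        using stuffle_words_one[OF u] unfolding 2 r_def by blast
      have rec: "X (word w) = - real_ext (\<lambda>w. X (word w)) q / real (Suc r)"
        if X: "is_stuffle_regularization X" for X
      proof -
        have "real_ext (\<lambda>w. X (word w)) (stuffle_words u [1]) = 0"
          using one[OF X u] unfolding lin[OF X, of "stuffle_words u [1]"] .
        then show ?thesis unfolding q(1)
          by (simp add: real_ext_add real_ext_qscale of_rat_of_nat_eq eq_neg_iff_add_eq_0 field_simps
              del: of_nat_Suc)
      qed
      have "real_ext (\<lambda>w. Z (word w)) q = real_ext (\<lambda>w. Y (word w)) q"
        using q(2) 2 less.hyps by (intro real_ext_cong) (auto simp: r_def)
      then show ?thesis using rec[OF Z] rec[OF Y] by simp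
    next
      case 3
      then show ?thesis using Z Y less.prems by (simp add: is_stuffle_regularization_def)
    qed
  qed
  then have eq: "Z (word w) = Y (word w)" for w
    using Z Y by (cases "is_index w") (auto simp: is_stuffle_regularization_def)
  show ?thesis
  proof (rule ext)
    fix p show "Z p = Y p"
      unfolding lin[OF Z, of p] lin[OF Y, of p] by (simp add: eq)
  qed
qed

theorem zeta_stuffle_eq:
  assumes "is_index w"
  shows "zeta_stuffle w = poly (trunc_poly w) 0"
proof -
  have "stuffle_regularization = real_ext reg_value"
    unfolding stuffle_regularization_def
    using is_stuffle_regularization_real_ext stuffle_regularization_unique by blast
  then have "zeta_stuffle w = real_ext reg_value (word w)" by (metis zeta_stuffle_def)
  then show ?thesis using assms by (simp add: reg_value_def)
qed

section \<open>Taylor coefficients of truncated sums\<close>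

text \<open>The combination of shifted indices in the definition of \<open>zeta_shift_stuffle\<close>, for an arbitrary
  function on words. It arises from the binomial series of the factors \<open>1/(n + z)\<^sup>k\<close>.\<close>
definition shift_index :: "(nat list \<Rightarrow> real) \<Rightarrow> nat \<Rightarrow> nat list \<Rightarrow> real" where
  "shift_index f a ks = (-1) ^ a * (\<Sum>as\<in>{as. length as = length ks \<and> sum_list as = a}.
     f (map2 (+) ks as) * (\<Prod>j<length ks. real ((ks ! j - 1 + as ! j) choose (as ! j))))"

lemma finite_compositions: "finite {as :: nat list. length as = l \<and> sum_list as = a}"
proof (rule finite_subset)
  show "{as :: nat list. length as = l \<and> sum_list as = a} \<subseteq> {as. set as \<subseteq> {..a} \<and> length as = l}"
    using member_le_sum_list by fastforce
  show "finite {as. set as \<subseteq> {..a} \<and> length as = l}"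
    by (rule finite_lists_length_eq) simp
qed

lemma compositions_Suc:
  "{as :: nat list. length as = Suc l \<and> sum_list as = a}
   = (\<lambda>(i, as). i # as) ` (SIGMA i:{..a}. {as. length as = l \<and> sum_list as = a - i})"
proof (intro equalityI subsetI)
  fix xs :: "nat list" assume xs: "xs \<in> {as. length as = Suc l \<and> sum_list as = a}"
  then obtain i as where [simp]: "xs = i # as" by (cases xs) auto
  from xs have "(i, as) \<in> (SIGMA i:{..a}. {as. length as = l \<and> sum_list as = a - i})" by auto
  then show "xs \<in> (\<lambda>(i, as). i # as) ` (SIGMA i:{..a}. {as. length as = l \<and> sum_list as = a - i})"
    by (force intro: image_eqI)
qed auto

lemma shift_index_Nil: "shift_index f a [] = (if a = 0 then f [] else 0)"
proof -
  have "{as :: nat list. length as = length ([] :: nat list) \<and> sum_list as = a} = (if a = 0 then {[]} else {})"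
    by auto
  then show ?thesis by (simp add: shift_index_def)
qed

lemma shift_index_Cons:
  "shift_index f a (k # w) = (\<Sum>i\<le>a. (-1) ^ i * real ((k - 1 + i) choose i)
     * shift_index (\<lambda>t. f ((k + i) # t)) (a - i) w)"
proof -
  let ?C = "\<lambda>i. {as :: nat list. length as = length w \<and> sum_list as = a - i}"
  let ?p = "\<lambda>as. (\<Prod>j<length w. real ((w ! j - 1 + as ! j) choose (as ! j)))"
  have inj: "inj_on (\<lambda>(i, as). i # as) (SIGMA i:{..a}. ?C i)"
    by (auto simp: inj_on_def)
  have len: "length (k # w) = Suc (length w)" by simp
  have "shift_index f a (k # w) = (-1) ^ a * (\<Sum>(i, as)\<in>(SIGMA i:{..a}. ?C i).
      f ((k + i) # map2 (+) w as) * (real ((k - 1 + i) choose i) * ?p as))"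
    unfolding shift_index_def len compositions_Suc sum.reindex[OF inj]
    by (simp add: case_prod_unfold prod.lessThan_Suc_shift del: prod.lessThan_Suc)
  also have "\<dots> = (\<Sum>i\<le>a. \<Sum>as\<in>?C i. (-1) ^ a * (f ((k + i) # map2 (+) w as) * (real ((k - 1 + i) choose i) * ?p as)))"
    by (subst sum.Sigma) (simp_all add: finite_compositions sum_distrib_left case_prod_unfold)
  also have "\<dots> = (\<Sum>i\<le>a. (-1) ^ i * real ((k - 1 + i) choose i) * shift_index (\<lambda>t. f ((k + i) # t)) (a - i) w)"
    unfolding shift_index_def sum_distrib_left
  proof (intro sum.cong refl)
    fix i as assume "i \<in> {..a}"
    then have "(-1) ^ a = (-1) ^ i * (-1 :: real) ^ (a - i)" by (simp flip: power_add)
    then show "(-1) ^ a * (f ((k + i) # map2 (+) w as) * (real (k - 1 + i choose i) * ?p as))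
      = (-1) ^ i * real (k - 1 + i choose i) * ((-1) ^ (a - i) * (f ((k + i) # map2 (+) w as) * ?p as))"
      by (simp add: mult_ac)
  qed
  finally show ?thesis .
qed

lemma shift_index_add: "shift_index (\<lambda>t. f t + c * g t) a w = shift_index f a w + c * shift_index g a w"
  by (simp add: shift_index_def sum.distrib sum_distrib_left algebra_simps)

lemma shift_index_0_fun [simp]: "shift_index (\<lambda>t. 0) a w = 0"
  by (simp add: shift_index_def)

lemma nth_hpow:
  assumes "k \<ge> 1" "r \<noteq> 0"
  shows "hpow r k $ i = (-1) ^ i * real ((k - 1 + i) choose i) / r ^ (k + i)"
proof -
  have "fps_X + fps_const r = fps_const r * (1 - fps_const (- 1 / r) * fps_X)"
    using assms by (simp add: right_diff_distrib flip: mult.assoc)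
  then have "hpow r k = inverse ((fps_const r * (1 - fps_const (- 1 / r) * fps_X)) ^ k)"
    by (simp only: hpow_def fps_inverse_power)
  also have "\<dots> = fps_const (1 / r ^ k) * inverse ((1 - fps_const (- 1 / r) * fps_X) ^ k)"
    using assms by (simp add: power_mult_distrib fps_inverse_mult fps_const_inverse inverse_eq_divide)
  also have "\<dots> $ i = 1 / r ^ k * (real ((k + i - 1) choose i) * (- 1 / r) ^ i)"
    using assms by (subst one_minus_const_fps_X_neg_power') auto
  also have "k + i - 1 = k - 1 + i" using assms by simp
  finally show ?thesis by (simp add: power_add power_divide power_minus' field_simps)
qed

lemma nested_sum_hpow_nth:
  assumes "is_index w" "\<And>x. x \<in> set xs \<Longrightarrow> r x \<noteq> 0"
  shows "nested_sum (\<lambda>x. hpow (r x)) xs w $ a = shift_index (nested_sum (\<lambda>x k. 1 / r x ^ k) xs) a w"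
  using assms
proof (induction "\<lambda>x. hpow (r x)" xs w arbitrary: a rule: nested_sum.induct)
  case (1 xs)
  then show ?case by (simp add: shift_index_Nil)
next
  case (2 k w)
  then show ?case by (simp add: shift_index_Cons)
next
  case (3 x xs k w)
  let ?f = "nested_sum (\<lambda>x k. 1 / r x ^ k)"
  have "nested_sum (\<lambda>x. hpow (r x)) (x # xs) (k # w) $ a
      = shift_index (?f xs) a (k # w) + (\<Sum>i\<le>a. hpow (r x) k $ i * shift_index (?f xs) (a - i) w)"
    using 3 by (simp add: fps_mult_nth atLeast0AtMost)
  also have "\<dots> = (\<Sum>i\<le>a. (-1) ^ i * real ((k - 1 + i) choose i) *
       (shift_index (\<lambda>t. ?f xs ((k + i) # t)) (a - i) w + 1 / r x ^ (k + i) * shift_index (?f xs) (a - i) w))"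
    unfolding shift_index_Cons sum.distrib[symmetric]
    using 3(3,4) by (intro sum.cong refl) (auto simp: nth_hpow Suc_le_eq algebra_simps)
  also have "\<dots> = shift_index (?f (x # xs)) a (k # w)"
    unfolding shift_index_Cons by (simp only: nested_sum.simps shift_index_add)
  finally show ?case .
qed

lemma right_sum_nth: "is_index w \<Longrightarrow> right_sum N w $ a = shift_index (mzv_trunc N) a w"
  unfolding right_sum_def mzv_trunc_def[abs_def] by (subst nested_sum_hpow_nth) auto

text \<open>The coefficients of \<open>1/(z - n)\<^sup>k\<close> and \<open>1/(z + n)\<^sup>k\<close> at \<open>z\<^sup>i\<close> differ by the sign of \<open>k + i\<close>.\<close>
lemma nested_sum_hpow_minus_nth:
  assumes "is_index w" "\<And>x. x \<in> set xs \<Longrightarrow> r x \<noteq> 0"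
  shows "nested_sum (\<lambda>x. hpow (- r x)) xs w $ a = (-1) ^ (sum_list w + a) * nested_sum (\<lambda>x. hpow (r x)) xs w $ a"
  using assms
proof (induction "\<lambda>x. hpow (r x)" xs w arbitrary: a rule: nested_sum.induct)
  case (3 x xs k w)
  have m: "hpow (- r x) k $ i = (-1) ^ (k + i) * hpow (r x) k $ i" for i
    using 3(3,4) nth_hpow[of k "r x" i] nth_hpow[of k "- r x" i]
    by (cases "even (k + i)") (auto simp: Suc_le_eq)
  have "hpow (- r x) k $ i * ((-1) ^ (sum_list w + (a - i)) * y)
      = (-1) ^ (k + sum_list w + a) * (hpow (r x) k $ i * y)" if "i \<le> a" for i y
  proof -
    have "(-1) ^ (k + i) * (-1) ^ (sum_list w + (a - i)) = (-1 :: real) ^ (k + sum_list w + a)"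
      using that by (simp add: algebra_simps flip: power_add)
    then show ?thesis unfolding m by (metis (no_types, opaque_lifting) mult.assoc mult.left_commute)
  qed
  note sign = this
  have "(\<Sum>i=0..a. hpow (- r x) k $ i * nested_sum (\<lambda>x. hpow (- r x)) xs w $ (a - i))
      = (-1) ^ (k + sum_list w + a) * (\<Sum>i=0..a. hpow (r x) k $ i * nested_sum (\<lambda>x. hpow (r x)) xs w $ (a - i))"
    unfolding sum_distrib_left
  proof (intro sum.cong refl)
    fix i assume i: "i \<in> {0..a}"
    have IH: "nested_sum (\<lambda>x. hpow (- r x)) xs w $ (a - i)
        = (-1) ^ (sum_list w + (a - i)) * nested_sum (\<lambda>x. hpow (r x)) xs w $ (a - i)"
      using 3(3,4) by (intro 3(2)) auto
    show "hpow (- r x) k $ i * nested_sum (\<lambda>x. hpow (- r x)) xs w $ (a - i)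
        = (-1) ^ (k + sum_list w + a) * (hpow (r x) k $ i * nested_sum (\<lambda>x. hpow (r x)) xs w $ (a - i))"
      unfolding IH using i by (intro sign) simp
  qed
  then show ?case
    using 3 by (simp add: fps_mult_nth distrib_left)
qed auto

lemma left_sum_nth:
  "is_index w \<Longrightarrow> left_sum N w $ a = (-1) ^ (sum_list w + a) * shift_index (mzv_trunc N) a (rev w)"
proof -
  assume w: "is_index w"
  have "left_sum N w $ a = (-1) ^ (sum_list w + a) * right_sum N (rev w) $ a"
    using nested_sum_hpow_minus_nth[of "rev w" "[1..<Suc N]" real a] w
    by (simp add: left_sum_def right_sum_def sum_list_rev del: upt_Suc)
  then show ?thesis using w by (simp add: right_sum_nth)
qed

definition shift_poly :: "nat \<Rightarrow> nat list \<Rightarrow> real poly" where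
  "shift_poly a ks = smult ((-1) ^ a) (\<Sum>as\<in>{as. length as = length ks \<and> sum_list as = a}.
     smult (\<Prod>j<length ks. real ((ks ! j - 1 + as ! j) choose (as ! j))) (trunc_poly (map2 (+) ks as)))"

lemma is_index_map2_add: "is_index ks \<Longrightarrow> length as = length ks \<Longrightarrow> is_index (map2 (+) ks as)"
  by (auto simp: is_index_def set_zip)

lemma shift_poly:
  assumes "is_index ks"
  shows "asym_poly (\<lambda>N. shift_index (mzv_trunc N) a ks) (shift_poly a ks)"
    and "poly (shift_poly a ks) 0 = zeta_shift_stuffle a ks"
proof -
  have "asym_poly (\<lambda>N. (-1) ^ a * (\<Sum>as\<in>{as. length as = length ks \<and> sum_list as = a}.
     (\<Prod>j<length ks. real ((ks ! j - 1 + as ! j) choose (as ! j))) * mzv_trunc N (map2 (+) ks as))) (shift_poly a ks)"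
    unfolding shift_poly_def
    by (intro asym_poly_cmult asym_poly_sum trunc_poly is_index_map2_add assms) simp
  then show "asym_poly (\<lambda>N. shift_index (mzv_trunc N) a ks) (shift_poly a ks)"
    by (simp add: shift_index_def mult.commute)
  show "poly (shift_poly a ks) 0 = zeta_shift_stuffle a ks"
    using assms by (simp add: shift_poly_def zeta_shift_stuffle_def poly_sum zeta_stuffle_eq is_index_map2_add mult.commute)
qed

text \<open>Shifting only increases the last entry, so convergence is preserved.\<close>
lemma shift_poly_convergent:
  assumes "is_index ks" "ks = [] \<or> 2 \<le> last ks"
  shows "shift_poly a ks = [:zeta_shift_stuffle a ks:]"
proof -
  have "\<exists>c. trunc_poly (map2 (+) ks as) = [:c:]" if "length as = length ks" for as
  proof (cases "ks = []")
    case True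
    then show ?thesis using trunc_poly_eqI[of "[]" "[:1:]"] asym_poly_const[of 1] by auto
  next
    case False
    have "zip ks as \<noteq> []" using False that by (cases ks; cases as) auto
    then have "last (map2 (+) ks as) \<ge> last ks"
      using False that by (cases as) (auto simp: last_map last_zip)
    then have "2 \<le> last (map2 (+) ks as)" using assms(2) False by simp
    moreover have "map2 (+) ks as \<noteq> []" using False that by (cases ks; cases as) auto
    ultimately show ?thesis
      using trunc_poly_convergent[OF is_index_map2_add[OF assms(1) that]] by blast
  qed
  then have "degree (trunc_poly (map2 (+) ks as)) = 0" if "length as = length ks" for as
    using that by (metis degree_pCons_0)
  then have "degree (shift_poly a ks) = 0"
    unfolding shift_poly_def
    by (intro le_antisym[OF order_trans[OF degree_smult_le degree_sum_le]])
       (auto simp: finite_compositions intro!: order_trans[OF degree_smult_le])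
  then obtain c where c: "shift_poly a ks = [:c:]" by (rule degree_eq_zeroE)
  with shift_poly(2)[OF assms(1), of a] show ?thesis by simp
qed

section \<open>The constant term identity for regularized multitangent functions\<close>

text \<open>The polynomial in \<open>harm P\<close> to which \<open>polar_coeff w c P Q\<close> is asymptotic.\<close>
definition polar_poly :: "nat list \<Rightarrow> nat \<Rightarrow> real poly" where
  "polar_poly w c = (\<Sum>i<length w. if c \<le> w ! i then \<Sum>a\<le>w ! i - c.
     smult (zeta_shift_stuffle (w ! i - c - a) (drop (Suc i) w))
       (smult ((-1) ^ (sum_list (take i w) + a)) (shift_poly a (rev (take i w)))) else 0)"

lemma is_index_take_drop [simp]: "is_index w \<Longrightarrow> is_index (take i w)" "is_index w \<Longrightarrow> is_index (drop i w)"
  by (auto simp: is_index_def dest: in_set_takeD in_set_dropD)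

lemma asym_poly2_polar_coeff:
  assumes w: "is_index w" "w \<noteq> []" "2 \<le> last w"
  shows "asym_poly2 (polar_coeff w c) (polar_poly w c)"
proof -
  have "asym_poly2 (\<lambda>P Q. \<Sum>i<length w. if c \<le> w ! i then \<Sum>a\<le>w ! i - c.
     left_sum P (take i w) $ a * right_sum Q (drop (Suc i) w) $ (w ! i - c - a) else 0) (polar_poly w c)"
    unfolding polar_poly_def
  proof (intro asym_poly2_sum)
    fix i assume i: "i \<in> {..<length w}"
    have conv: "is_index (drop (Suc i) w)" "drop (Suc i) w = [] \<or> 2 \<le> last (drop (Suc i) w)"
      using w by (cases "length w \<le> Suc i"; simp)+
    have "asym_poly2 (\<lambda>P Q. left_sum P (take i w) $ a * right_sum Q (drop (Suc i) w) $ b)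
      (smult (zeta_shift_stuffle b (drop (Suc i) w))
       (smult ((-1) ^ (sum_list (take i w) + a)) (shift_poly a (rev (take i w)))))" for a b
    proof (rule asym_poly2_mult)
      show "asym_poly (\<lambda>P. left_sum P (take i w) $ a) (smult ((-1) ^ (sum_list (take i w) + a)) (shift_poly a (rev (take i w))))"
        using w by (simp only: left_sum_nth is_index_take_drop) (intro asym_poly_cmult shift_poly(1), simp)
      show "asym_poly (\<lambda>Q. right_sum Q (drop (Suc i) w) $ b) [:zeta_shift_stuffle b (drop (Suc i) w):]"
        unfolding right_sum_nth[OF conv(1)] shift_poly_convergent[OF conv, symmetric] by (rule shift_poly(1)[OF conv(1)])
    qed
    then show "asym_poly2 (\<lambda>P Q. if c \<le> w ! i then \<Sum>a\<le>w ! i - c.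
     left_sum P (take i w) $ a * right_sum Q (drop (Suc i) w) $ (w ! i - c - a) else 0)
     (if c \<le> w ! i then \<Sum>a\<le>w ! i - c.
     smult (zeta_shift_stuffle (w ! i - c - a) (drop (Suc i) w))
       (smult ((-1) ^ (sum_list (take i w) + a)) (shift_poly a (rev (take i w)))) else 0)"
      using asym_poly2_zero by (auto intro!: asym_poly2_sum)
  qed
  then show ?thesis
    unfolding polar_coeff_def[abs_def] fps_mult_nth atLeast0AtMost .
qed

lemma sum_list_ge_2:
  assumes "w \<noteq> []" "2 \<le> last w" shows "sum_list w \<ge> (2::nat)"
  using assms member_le_sum_list[of "last w" w] by (auto intro: order_trans)

text \<open>The limit of a multitangent function has no monotangent component with \<open>c = 1\<close>.\<close>
lemma polar_poly_1:
  assumes w: "is_index w" "w \<noteq> []" "2 \<le> last w"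
  shows "polar_poly w 1 = 0"
proof (rule asym_poly2_sum_zero_imp_zero[OF asym_poly2_polar_coeff[OF w]])
  fix N
  have "(\<Sum>P\<le>2 * N. polar_coeff w 1 P (2 * N - P))
      = (\<Sum>n\<in>{- int N..int N}. polar_coeff w 1 (nat (int N + n)) (nat (int N - n)))"
    by (rule sum.reindex_bij_witness[of _ "\<lambda>n. nat (int N + n)" "\<lambda>P. int P - int N"])
       (auto simp: nat_diff_distrib' nat_mult_distrib)
  then show "(\<Sum>P\<le>2 * N. polar_coeff w 1 P (2 * N - P)) = 0"
    using sum_polar_coeff_1[OF sum_list_ge_2[OF w(2,3)]] by simp
qed

lemma sum_nonzero_int_eq:
  fixes f :: "int \<Rightarrow> 'a::comm_monoid_add"
  shows "(\<Sum>n\<in>{- int N..int N} - {0}. f n) = (\<Sum>n=1..N. f (int n) + f (- int n))"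
proof -
  have "{- int N..int N} - {0} = {1..int N} \<union> {- int N.. - 1}" by auto
  then have "(\<Sum>n\<in>{- int N..int N} - {0}. f n) = sum f {1..int N} + sum f {- int N.. - 1}"
    by (simp add: sum.union_disjoint)
  moreover have "sum f {1..int N} = (\<Sum>n=1..N. f (int n))"
    by (rule sum.reindex_bij_witness[of _ int nat]) auto
  moreover have "sum f {- int N.. - 1} = (\<Sum>n=1..N. f (- int n))"
    by (rule sum.reindex_bij_witness[of _ "\<lambda>n. - int n" "\<lambda>n. nat (- n)"]) auto
  ultimately show ?thesis by (simp add: sum.distrib)
qed

text \<open>The values of \<open>2 \<zeta>(c)\<close> for even \<open>c\<close>, with \<open>\<zeta>(0) = -1/2\<close>.\<close>
definition even_zeta2 :: "nat \<Rightarrow> real" where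
  "even_zeta2 c = (if c = 0 then - 1 else if even c then 2 * zeta_nat c else 0)"

theorem regularized_multitangent_identity:
  assumes w: "is_index w" "w \<noteq> []" "2 \<le> last w" and K: "\<And>k. k \<in> set w \<Longrightarrow> k \<le> K"
  shows "(\<Sum>i\<le>length w. (-1) ^ sum_list (take i w) * zeta_stuffle (rev (take i w)) * zeta_stuffle (drop i w))
    = (\<Sum>c\<le>K. even_zeta2 c * poly (polar_poly w c) 0)"
proof -
  define q where "q = (\<Sum>i\<le>length w. smult ((-1) ^ sum_list (take i w)) (trunc_poly (rev (take i w)))
      * trunc_poly (drop i w))"
  have q: "asym_poly (\<lambda>N. conv (left_sum N) (right_sum N) w $ 0) q"
  proof -
    have sh: "shift_index f 0 u = f u" for f u
      by (induction u arbitrary: f) (auto simp: shift_index_Nil shift_index_Cons)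
    have "conv (left_sum N) (right_sum N) w $ 0 = (\<Sum>i\<le>length w.
        (-1) ^ sum_list (take i w) * mzv_trunc N (rev (take i w)) * mzv_trunc N (drop i w))" for N
      using w(1) by (simp add: conv_def fps_sum_nth left_sum_nth right_sum_nth sh)
    then show ?thesis
      unfolding q_def using w(1)
      by (simp only:) (intro asym_poly_sum asym_poly_mult asym_poly_cmult trunc_poly, auto)
  qed
  define e where "e c N = (\<Sum>n=1..N. polar_coeff w c (N + n) (N - n) / real n ^ c
      + polar_coeff w c (N - n) (N + n) / (- real n) ^ c)" for c N
  have e: "asym_poly (e c) (smult (even_zeta2 c) (polar_poly w c))" if "c \<in> {1..K}" for c
  proof (cases "c = 1")
    case True
    have "asym_poly2 (polar_coeff w 1) 0"
      using asym_poly2_polar_coeff[OF w, of 1] polar_poly_1[OF w] by simp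
    from asym_poly_sum_over_moving_point_1[OF this] show ?thesis
      using True by (simp add: e_def[abs_def] even_zeta2_def)
  next
    case False
    then have "c \<ge> 2" using that by auto
    then show ?thesis
      using asym_poly_sum_over_moving_point[OF asym_poly2_polar_coeff[OF w, of c]]
      by (simp add: e_def[abs_def] even_zeta2_def)
  qed
  have eq: "conv (left_sum N) (right_sum N) w $ 0 + polar_coeff w 0 N N = (\<Sum>c=1..K. e c N)" for N
  proof -
    have "(\<Sum>c=1..K. e c N) = (\<Sum>n=1..N. \<Sum>c=1..K. polar_coeff w c (N + n) (N - n) / real n ^ c
      + polar_coeff w c (N - n) (N + n) / (- real n) ^ c)"
      unfolding e_def by (rule sum.swap)
    also have "\<dots> = (\<Sum>n\<in>{- int N..int N} - {0}. \<Sum>c=1..K.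
         polar_coeff w c (nat (int N + n)) (nat (int N - n)) / of_int n ^ c)"
      unfolding sum_nonzero_int_eq
      by (intro sum.cong refl) (auto simp: sum.distrib nat_add_distrib nat_diff_distrib')
    finally show ?thesis
      using constant_term_eq_sum_polar_coeffs[of w K N] sum_list_ge_2[OF w(2,3)] K by simp
  qed
  have "asym_poly (\<lambda>N. conv (left_sum N) (right_sum N) w $ 0 + polar_coeff w 0 N N) (q + polar_poly w 0)"
    by (intro asym_poly_add q asym_poly2_diagonal asym_poly2_polar_coeff w)
  moreover have "asym_poly (\<lambda>N. \<Sum>c=1..K. e c N) (\<Sum>c=1..K. smult (even_zeta2 c) (polar_poly w c))"
    by (intro asym_poly_sum e)
  ultimately have "q + polar_poly w 0 = (\<Sum>c=1..K. smult (even_zeta2 c) (polar_poly w c))"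
    unfolding eq by (rule asym_poly_unique)
  then have "poly q 0 + poly (polar_poly w 0) 0 = (\<Sum>c=1..K. even_zeta2 c * poly (polar_poly w c) 0)"
    by (metis (mono_tags, lifting) poly_add poly_sum poly_smult sum.cong)
  moreover have "(\<Sum>c\<le>K. even_zeta2 c * poly (polar_poly w c) 0)
      = - poly (polar_poly w 0) 0 + (\<Sum>c=1..K. even_zeta2 c * poly (polar_poly w c) 0)"
  proof -
    have "{..K} = insert 0 {1..K}" by auto
    then show ?thesis by (simp add: even_zeta2_def[of 0])
  qed
  moreover have "poly q 0 = (\<Sum>i\<le>length w. (-1) ^ sum_list (take i w) * zeta_stuffle (rev (take i w)) * zeta_stuffle (drop i w))"
    unfolding q_def poly_sum using w(1) by (simp add: zeta_stuffle_eq mult.assoc)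
  ultimately show ?thesis by simp
qed

section \<open>Star values and the antipode relation\<close>

definition star_sum :: "(nat list \<Rightarrow> real) \<Rightarrow> nat list \<Rightarrow> real" where
  "star_sum f ks = (\<Sum>s\<in>{s. length s = length ks - 1}. f (join_entries s ks))"

lemma finite_separator_lists [simp]: "finite {s :: separator list. length s = n}"
proof -
  have "(UNIV :: separator set) \<subseteq> {Comma, Plus}" using separator.exhaust by auto
  then have "finite (UNIV :: separator set)" by (rule finite_subset) simp
  then show ?thesis using finite_lists_length_eq[of UNIV n] by simp
qed

lemma star_sum_Nil [simp]: "star_sum f [] = f []"
  by (simp add: star_sum_def)

lemma star_sum_single [simp]: "star_sum f [k] = f [k]"
  by (simp add: star_sum_def)

lemma star_sum_Cons_Cons: "star_sum f (k # l # w) = star_sum (\<lambda>t. f (k # t)) (l # w) + star_sum f ((k + l) # w)"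
proof -
  let ?S = "{s :: separator list. length s = length w}"
  have S: "{s :: separator list. length s = length (k # l # w) - 1} = (#) Comma ` ?S \<union> (#) Plus ` ?S"
  proof (intro equalityI subsetI)
    fix s :: "separator list" assume "s \<in> {s. length s = length (k # l # w) - 1}"
    then obtain c t where "s = c # t" "length t = length w" by (cases s) auto
    then show "s \<in> (#) Comma ` ?S \<union> (#) Plus ` ?S" by (cases c) auto
  qed auto
  have "star_sum f (k # l # w) = (\<Sum>s\<in>(#) Comma ` ?S. f (join_entries s (k # l # w)))
      + (\<Sum>s\<in>(#) Plus ` ?S. f (join_entries s (k # l # w)))"
    unfolding star_sum_def S by (rule sum.union_disjoint) auto
  then show ?thesis by (simp add: sum.reindex star_sum_def)
qed

lemma star_sum_add: "star_sum (\<lambda>t. f t + c * g t) w = star_sum f w + c * star_sum g w"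
  by (simp add: star_sum_def sum.distrib sum_distrib_left)

lemma join_entries_nonempty: "ks \<noteq> [] \<Longrightarrow> join_entries s ks \<noteq> []"
  by (induction s ks rule: join_entries.induct) auto

lemma is_index_join_entries: "is_index ks \<Longrightarrow> is_index (join_entries s ks)"
  by (induction s ks rule: join_entries.induct) auto

lemma star_sum_cong: "(\<And>t. t \<noteq> [] \<Longrightarrow> f t = g t) \<Longrightarrow> w \<noteq> [] \<Longrightarrow> star_sum f w = star_sum g w"
  by (simp add: star_sum_def join_entries_nonempty)

text \<open>Star sums run over weakly increasing points: the smallest point may be used repeatedly.\<close>
lemma star_sum_nested_sum_Cons:
  assumes mult: "\<And>k l. \<phi> x (k + l) = \<phi> x k * \<phi> x l"
  shows "star_sum (nested_sum \<phi> (x # xs)) (k # w)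
    = star_sum (nested_sum \<phi> xs) (k # w) + \<phi> x k * star_sum (nested_sum \<phi> (x # xs)) w"
proof -
  let ?B = "\<lambda>u. \<phi> x (hd u) * nested_sum \<phi> xs (tl u)"
  have split: "star_sum (nested_sum \<phi> (x # xs)) (k # w) = star_sum (nested_sum \<phi> xs) (k # w) + 1 * star_sum ?B (k # w)"
    for k w
  proof -
    have "nested_sum \<phi> (x # xs) t = nested_sum \<phi> xs t + 1 * ?B t" if "t \<noteq> []" for t
      using that by (cases t) auto
    then have "star_sum (nested_sum \<phi> (x # xs)) (k # w) = star_sum (\<lambda>t. nested_sum \<phi> xs t + 1 * ?B t) (k # w)"
      by (intro star_sum_cong) auto
    then show ?thesis by (simp only: star_sum_add)
  qed
  have "star_sum ?B (k # w) = \<phi> x k * star_sum (nested_sum \<phi> (x # xs)) w" for k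
  proof (induction w arbitrary: k)
    case (Cons l w)
    have "star_sum ?B (k # l # w) = star_sum (\<lambda>t. 0 + \<phi> x k * nested_sum \<phi> xs t) (l # w) + star_sum ?B ((k + l) # w)"
      unfolding star_sum_Cons_Cons by simp
    also have "\<dots> = \<phi> x k * (star_sum (nested_sum \<phi> xs) (l # w) + \<phi> x l * star_sum (nested_sum \<phi> (x # xs)) w)"
      unfolding star_sum_add Cons.IH mult by (simp add: star_sum_def algebra_simps)
    also have "star_sum (nested_sum \<phi> xs) (l # w) + \<phi> x l * star_sum (nested_sum \<phi> (x # xs)) w
        = star_sum (nested_sum \<phi> (x # xs)) (l # w)"
      using split[of l w] Cons.IH[of l] by simp
    finally show ?case .
  qed simp
  then show ?thesis using split by simp
qed

text \<open>Under \<open>conv\<close> the nested sum is the ordered product of the one-letter series \<open>1 + \<phi> x\<close>, and the signed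
  star sum is the ordered product of their inverses. The product of inverses in the same order inverts
  the product in reversed order, which is the nested sum of the reversed word.\<close>
lemma conv_star_sum_nested_sum_rev:
  assumes mult: "\<And>x k l. \<phi> x (k + l) = \<phi> x k * \<phi> x l"
  shows "(\<Sum>i\<le>length w. (-1) ^ i * star_sum (nested_sum \<phi> xs) (take i w) * nested_sum \<phi> xs (rev (drop i w)))
    = conv_unit w"
proof -
  define S where "S xs w = (-1) ^ length w * star_sum (nested_sum \<phi> xs) w" for xs w
  have step: "conv (nested_sum \<phi> [x]) (S (x # xs)) w = S xs w" for x xs w
  proof (cases w)
    case (Cons k v)
    have "(\<lambda>u. nested_sum \<phi> [x] (k # u)) = (\<lambda>u. \<phi> x k * conv_unit u)"
      by (intro ext) (simp add: nested_sum_no_points conv_unit_def)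
    then have "conv (nested_sum \<phi> [x]) (S (x # xs)) w = S (x # xs) (k # v) + \<phi> x k * S (x # xs) v"
      by (simp add: Cons conv_Cons conv_mult_left)
    then show ?thesis
      by (simp add: Cons S_def star_sum_nested_sum_Cons[OF mult] algebra_simps)
  qed (simp add: S_def)
  have S0: "S [] = conv_unit"
  proof
    have *: "star_sum (\<lambda>u. 0) w = 0" for w by (simp add: star_sum_def)
    have "star_sum (nested_sum \<phi> []) w = star_sum (\<lambda>u. 0) w" if "w \<noteq> []" for w
      using that by (intro star_sum_cong) (simp_all add: nested_sum_no_points conv_unit_def)
    then show "S [] w = conv_unit w" for w
      by (cases "w = []") (auto simp: S_def * conv_unit_def)
  qed
  have right_inverse: "conv (nested_sum \<phi> (rev xs)) (S xs) w = conv_unit w" for xs w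
  proof (induction xs arbitrary: w)
    case Nil
    have "nested_sum \<phi> [] = conv_unit" by (intro ext nested_sum_no_points)
    then show ?case by (simp add: S0)
  next
    case (Cons x xs)
    have "nested_sum \<phi> (rev (x # xs)) = conv (nested_sum \<phi> (rev xs)) (nested_sum \<phi> [x])"
      by (intro ext) (simp add: nested_sum_append)
    moreover have "conv (nested_sum \<phi> [x]) (S (x # xs)) = S xs"
      by (intro ext step)
    ultimately show ?case using Cons.IH by (simp add: conv_assoc)
  qed
  have "conv (S xs) (nested_sum \<phi> (rev xs)) w = conv_unit w"
    by (rule conv_inverse_commute[OF right_inverse]) (simp add: S_def)
  moreover have "nested_sum \<phi> (rev xs) v = nested_sum \<phi> xs (rev v)" for v
    using nested_sum_rev[of \<phi> xs "rev v"] by simp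
  ultimately show ?thesis by (simp add: conv_def S_def)
qed

theorem zeta_star_antipode:
  assumes w: "is_index w"
  shows "(\<Sum>i\<le>length w. (-1) ^ i * zeta_star_stuffle (take i w) * zeta_stuffle (rev (drop i w))) = conv_unit w"
proof -
  define sp where "sp u = (\<Sum>s\<in>{s. length s = length u - 1}. trunc_poly (join_entries s u))" for u
  have sp: "asym_poly (\<lambda>N. star_sum (mzv_trunc N) u) (sp u)" "poly (sp u) 0 = zeta_star_stuffle u"
    if "is_index u" for u
    unfolding star_sum_def sp_def zeta_star_stuffle_def poly_sum using that
    by (auto intro!: asym_poly_sum trunc_poly is_index_join_entries sum.cong simp: zeta_stuffle_eq is_index_join_entries)
  have "(\<Sum>i\<le>length w. (-1) ^ i * star_sum (mzv_trunc N) (take i w) * mzv_trunc N (rev (drop i w))) = conv_unit w" for N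
    unfolding mzv_trunc_def[abs_def] by (rule conv_star_sum_nested_sum_rev) (simp add: power_add)
  then have "asym_poly (\<lambda>N. \<Sum>i\<le>length w. (-1) ^ i * star_sum (mzv_trunc N) (take i w) * mzv_trunc N (rev (drop i w)))
      [:conv_unit w:]"
    using asym_poly_const by simp
  moreover have "asym_poly (\<lambda>N. \<Sum>i\<le>length w. (-1) ^ i * star_sum (mzv_trunc N) (take i w) * mzv_trunc N (rev (drop i w)))
      (\<Sum>i\<le>length w. smult ((-1) ^ i) (sp (take i w)) * trunc_poly (rev (drop i w)))"
    using w by (intro asym_poly_sum asym_poly_mult asym_poly_cmult sp(1) trunc_poly)
      (auto simp: is_index_def dest: in_set_takeD in_set_dropD)
  ultimately have "[:conv_unit w:] = (\<Sum>i\<le>length w. smult ((-1) ^ i) (sp (take i w)) * trunc_poly (rev (drop i w)))"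
    by (rule asym_poly_unique)
  then have "poly [:conv_unit w:] 0 = poly (\<Sum>i\<le>length w. smult ((-1) ^ i) (sp (take i w)) * trunc_poly (rev (drop i w))) 0"
    by simp
  moreover have "is_index (take i w)" "is_index (rev (drop i w))" for i
    using w by (auto simp: is_index_def dest: in_set_takeD in_set_dropD)
  ultimately show ?thesis by (simp add: poly_sum sp(2) zeta_stuffle_eq mult.assoc)
qed

section \<open>Even zeta values\<close>

text \<open>Partial fractions in \<open>q\<close> leave two harmonic sums that cancel up to the boundary terms.\<close>
lemma sum_inverse_square_difference:
  assumes p: "1 \<le> p" "p \<le> N"
  shows "(\<Sum>q\<in>{1..N} - {p}. 1 / (real q ^ 2 - real p ^ 2))
    = 3 / (4 * real p ^ 2) - (harm (N + p) - harm (N - p)) / (2 * real p)"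
proof -
  have pf: "1 / (real q ^ 2 - real p ^ 2) = (1 / (real q - real p) - 1 / (real q + real p)) / (2 * real p)"
    if "q \<noteq> p" "q \<ge> 1" for q
  proof -
    have nz: "real q - real p \<noteq> 0" "real q + real p \<noteq> 0" "real p \<noteq> 0" using that p by auto
    have "real q ^ 2 - real p ^ 2 = (real q - real p) * (real q + real p)"
      by (simp add: power2_eq_square algebra_simps)
    then show ?thesis using nz by (simp add: divide_simps)
  qed
  have s1: "(\<Sum>q\<in>{1..N} - {p}. 1 / (real q - real p)) = harm (N - p) - harm (p - 1)"
  proof -
    have "{1..N} - {p} = {1..p - 1} \<union> {p + 1..N}" using p by auto
    then have "(\<Sum>q\<in>{1..N} - {p}. 1 / (real q - real p))
        = (\<Sum>q=1..p - 1. 1 / (real q - real p)) + (\<Sum>q=p + 1..N. 1 / (real q - real p))"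
      by (simp add: sum.union_disjoint)
    also have "(\<Sum>q=1..p - 1. 1 / (real q - real p)) = (\<Sum>q=1..p - 1. - (1 / real q))"
    proof (rule sum.reindex_bij_witness[of _ "\<lambda>q. p - q" "\<lambda>q. p - q"])
      fix q assume "q \<in> {1..p - 1}"
      then have "q \<le> p" by auto
      then have "real (p - q) = - (real q - real p)" by (simp add: of_nat_diff)
      then show "- (1 / real (p - q)) = 1 / (real q - real p)" by (simp only: divide_minus_right minus_minus)
    qed auto
    also have "(\<Sum>q=p + 1..N. 1 / (real q - real p)) = (\<Sum>q=1..N - p. 1 / real q)"
      by (rule sum.reindex_bij_witness[of _ "\<lambda>q. q + p" "\<lambda>q. q - p"]) auto
    finally show ?thesis by (simp add: sum_negf harm_eq_sum)
  qed
  have s2: "(\<Sum>q\<in>{1..N} - {p}. 1 / (real q + real p)) = harm (N + p) - harm p - 1 / (2 * real p)"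
  proof -
    have "(\<Sum>q=1..N. 1 / (real q + real p)) = (\<Sum>q=p + 1..N + p. 1 / real q)"
      by (rule sum.reindex_bij_witness[of _ "\<lambda>q. q - p" "\<lambda>q. q + p"]) auto
    moreover have "harm (N + p) = harm p + (\<Sum>q=p + 1..N + p. 1 / real q)"
    proof -
      have "{1..N + p} = {1..p} \<union> {p + 1..N + p}" by auto
      then show ?thesis by (simp add: harm_eq_sum sum.union_disjoint)
    qed
    moreover have "(\<Sum>q=1..N. 1 / (real q + real p)) = 1 / (2 * real p) + (\<Sum>q\<in>{1..N} - {p}. 1 / (real q + real p))"
      using p by (subst sum.remove[of _ p]) auto
    ultimately show ?thesis by simp
  qed
  have hp: "harm p = harm (p - 1) + 1 / real p"
    using p harm_Suc[of "p - 1", where 'a = real] by (simp add: inverse_eq_divide)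
  have "(\<Sum>q\<in>{1..N} - {p}. 1 / (real q ^ 2 - real p ^ 2))
      = (\<Sum>q\<in>{1..N} - {p}. (1 / (real q - real p) - 1 / (real q + real p)) / (2 * real p))"
    using pf by (intro sum.cong) auto
  also have "\<dots> = ((harm (N - p) - harm (p - 1)) - (harm (N + p) - harm p - 1 / (2 * real p))) / (2 * real p)"
    unfolding sum_divide_distrib[symmetric] sum_subtractf s1 s2 ..
  also have "\<dots> = 3 / (4 * real p ^ 2) - (harm (N + p) - harm (N - p)) / (2 * real p)"
    using p unfolding hp by (simp add: field_simps power2_eq_square)
  finally show ?thesis .
qed

lemma sum_even_powers_geometric:
  fixes x y :: real
  assumes "x \<noteq> 0" "y \<noteq> 0" "x ^ 2 \<noteq> y ^ 2" "m \<ge> 1"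
  shows "(\<Sum>i=1..m - 1. 1 / (x ^ (2 * i) * y ^ (2 * m - 2 * i)))
    = (1 / x ^ (2 * m - 2)) * (1 / (y ^ 2 - x ^ 2)) + (1 / y ^ (2 * m - 2)) * (1 / (x ^ 2 - y ^ 2))"
  using assms(4)
proof (induction m rule: dec_induct)
  case base
  have "1 / (y ^ 2 - x ^ 2) + 1 / (x ^ 2 - y ^ 2) = 0"
    by (metis add.right_inverse divide_minus_right minus_diff_eq)
  then show ?case by simp
next
  case (step m)
  obtain n where m: "m = Suc n" using step by (cases m) auto
  define d where "d = x ^ 2 - y ^ 2"
  have d: "d \<noteq> 0" "y ^ 2 - x ^ 2 = - d" using assms by (auto simp: d_def)
  have "(\<Sum>i=1..Suc m - 1. 1 / (x ^ (2 * i) * y ^ (2 * Suc m - 2 * i)))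
      = (\<Sum>i=1..m - 1. 1 / (x ^ (2 * i) * y ^ (2 * Suc m - 2 * i))) + 1 / (x ^ (2 * m) * y ^ 2)"
    unfolding m by simp
  also have "(\<Sum>i=1..m - 1. 1 / (x ^ (2 * i) * y ^ (2 * Suc m - 2 * i)))
      = (\<Sum>i=1..m - 1. 1 / (x ^ (2 * i) * y ^ (2 * m - 2 * i))) / y ^ 2"
    unfolding sum_divide_distrib
  proof (intro sum.cong refl)
    fix i assume "i \<in> {1..m - 1}"
    then have "2 * Suc m - 2 * i = (2 * m - 2 * i) + 2" by auto
    then show "1 / (x ^ (2 * i) * y ^ (2 * Suc m - 2 * i)) = 1 / (x ^ (2 * i) * y ^ (2 * m - 2 * i)) / y ^ 2"
      by (simp add: power_add mult.assoc power2_eq_square del: mult_Suc_right)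
  qed
  also have "(\<Sum>i=1..m - 1. 1 / (x ^ (2 * i) * y ^ (2 * m - 2 * i))) / y ^ 2 + 1 / (x ^ (2 * m) * y ^ 2)
      = (1 / x ^ (2 * n) * (1 / - d) + 1 / y ^ (2 * n) * (1 / d)) / y ^ 2 + 1 / (x ^ (2 * n) * x ^ 2 * y ^ 2)"
    using step.IH unfolding d(2) d_def[symmetric] by (simp add: m power2_eq_square)
  also have "\<dots> = 1 / (x ^ (2 * n) * x ^ 2) * (1 / - d) + 1 / (y ^ (2 * n) * y ^ 2) * (1 / d)"
  proof -
    define X Y a b where "X = x ^ (2 * n)" "Y = y ^ (2 * n)" "a = x ^ 2" "b = y ^ 2"
    have nz: "X \<noteq> 0" "Y \<noteq> 0" "a \<noteq> 0" "b \<noteq> 0" "a = b + d"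
      using assms by (auto simp: X_Y_a_b_def d_def)
    have "(1 / X * (1 / - d) + 1 / Y * (1 / d)) / b + 1 / (X * a * b) = 1 / (X * a) * (1 / - d) + 1 / (Y * b) * (1 / d)"
    proof -
      have "1 / (X * d * b) - 1 / (X * a * b) = 1 / (X * a * d)"
        using nz d(1) by (simp add: divide_simps)
      moreover have "(1 / X * (1 / - d) + 1 / Y * (1 / d)) / b = 1 / (Y * b * d) - 1 / (X * d * b)"
        using nz d(1) by (simp add: add_divide_distrib diff_divide_distrib mult_ac)
      ultimately show ?thesis by simp
    qed
    then show ?thesis unfolding X_Y_a_b_def .
  qed
  finally show ?case unfolding d(2) d_def[symmetric] by (simp add: m power2_eq_square mult_ac)
qed

text \<open>Euler's convolution formula: summing the products over all \<open>p \<noteq> q\<close> up to \<open>N\<close>, the geometric sum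
  leaves \<open>1 / (q\<^sup>2 - p\<^sup>2)\<close>, whose sum over \<open>q\<close> is \<open>3 / (4 p\<^sup>2)\<close> up to a small error.\<close>
lemma zeta_nat_convolution:
  assumes "m \<ge> 2"
  shows "(\<Sum>i=1..m - 1. zeta_nat (2 * i) * zeta_nat (2 * m - 2 * i)) = (real m + 1 / 2) * zeta_nat (2 * m)"
proof -
  define Z where "Z c N = (\<Sum>n=1..N. 1 / real n ^ c)" for c N
  have Z: "asym_poly (Z c) [:zeta_nat c:]" if "c \<ge> 2" for c
    using asym_poly_inverse_power_sum[OF that] by (simp add: Z_def[abs_def])
  define e where "e N p = - (harm (N + p) - harm (N - p)) / (real p ^ (2 * m - 1))" for N p
  have eq: "(\<Sum>i=1..m - 1. Z (2 * i) N * Z (2 * m - 2 * i) N) = (real m - 1 + 3 / 2) * Z (2 * m) N + (\<Sum>p=1..N. e N p)" for N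
  proof -
    let ?g = "\<lambda>p q. \<Sum>i=1..m - 1. 1 / (real p ^ (2 * i) * real q ^ (2 * m - 2 * i))"
    let ?r = "\<lambda>p q. 1 / real p ^ (2 * m - 2) * (1 / (real q ^ 2 - real p ^ 2))"
    have "(\<Sum>i=1..m - 1. Z (2 * i) N * Z (2 * m - 2 * i) N) = (\<Sum>p=1..N. \<Sum>q=1..N. ?g p q)"
    proof -
      have "(\<Sum>i=1..m - 1. Z (2 * i) N * Z (2 * m - 2 * i) N)
          = (\<Sum>i=1..m - 1. \<Sum>p=1..N. \<Sum>q=1..N. 1 / (real p ^ (2 * i) * real q ^ (2 * m - 2 * i)))"
        by (simp add: Z_def sum_product)
      also have "\<dots> = (\<Sum>p=1..N. \<Sum>i=1..m - 1. \<Sum>q=1..N. 1 / (real p ^ (2 * i) * real q ^ (2 * m - 2 * i)))"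
        by (rule sum.swap)
      also have "\<dots> = (\<Sum>p=1..N. \<Sum>q=1..N. ?g p q)"
        by (intro sum.cong refl sum.swap)
      finally show ?thesis .
    qed
    also have "\<dots> = (\<Sum>p=1..N. ?g p p + (\<Sum>q\<in>{1..N} - {p}. ?g p q))"
      by (intro sum.cong refl) (simp add: sum.remove)
    also have "\<dots> = (\<Sum>p=1..N. (real m - 1) * (1 / real p ^ (2 * m))) + (\<Sum>p=1..N. \<Sum>q\<in>{1..N} - {p}. ?g p q)"
    proof -
      have "?g p p = (real m - 1) * (1 / real p ^ (2 * m))" for p
      proof -
        have "?g p p = (\<Sum>i=1..m - 1. 1 / real p ^ (2 * m))"
          by (intro sum.cong refl) (auto simp flip: power_add)
        then show ?thesis using assms by (simp add: of_nat_diff)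
      qed
      then show ?thesis by (simp add: sum.distrib)
    qed
    also have "(\<Sum>p=1..N. (real m - 1) * (1 / real p ^ (2 * m))) = (real m - 1) * Z (2 * m) N"
      by (simp add: Z_def sum_distrib_left)
    also have "(\<Sum>p=1..N. \<Sum>q\<in>{1..N} - {p}. ?g p q) = (\<Sum>p=1..N. \<Sum>q\<in>{1..N} - {p}. ?r p q + ?r q p)"
    proof (intro sum.cong refl)
      fix p q assume "p \<in> {1..N}" "q \<in> {1..N} - {p}"
      then show "?g p q = ?r p q + ?r q p"
        using assms by (intro sum_even_powers_geometric) (auto simp: power2_eq_iff_nonneg)
    qed
    also have "\<dots> = (\<Sum>p=1..N. \<Sum>q\<in>{1..N} - {p}. ?r p q) + (\<Sum>p=1..N. \<Sum>q\<in>{1..N} - {p}. ?r q p)"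
      by (simp only: sum.distrib)
    also have "(\<Sum>p=1..N. \<Sum>q\<in>{1..N} - {p}. ?r q p) = (\<Sum>p=1..N. \<Sum>q\<in>{1..N} - {p}. ?r p q)"
    proof -
      have "(\<Sum>p=1..N. \<Sum>q\<in>{1..N} - {p}. ?r q p) = (\<Sum>p=1..N. \<Sum>q=1..N. if p = q then 0 else ?r q p)"
        by (intro sum.cong refl sum.mono_neutral_cong_left) auto
      also have "\<dots> = (\<Sum>p=1..N. \<Sum>q=1..N. if p = q then 0 else ?r p q)"
        by (subst sum.swap) (intro sum.cong refl, auto)
      also have "\<dots> = (\<Sum>p=1..N. \<Sum>q\<in>{1..N} - {p}. ?r p q)"
        by (intro sum.cong refl sum.mono_neutral_cong_right) auto
      finally show ?thesis .
    qed
    also have "(\<Sum>p=1..N. \<Sum>q\<in>{1..N} - {p}. ?r p q) = (\<Sum>p=1..N. 3 / 4 * (1 / real p ^ (2 * m)) + e N p / 2)"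
    proof (intro sum.cong refl)
      fix p assume p: "p \<in> {1..N}"
      obtain n where n: "m = Suc (Suc n)" using assms by (metis One_nat_def Suc_1 Suc_le_D Suc_le_mono)
      have "(\<Sum>q\<in>{1..N} - {p}. ?r p q) = 1 / real p ^ (2 * m - 2)
          * (3 / (4 * real p ^ 2) - (harm (N + p) - harm (N - p)) / (2 * real p))"
        using p by (simp only: sum_distrib_left[symmetric]) (subst sum_inverse_square_difference, auto)
      also have "\<dots> = 3 / 4 * (1 / real p ^ (2 * m)) + e N p / 2"
        using p by (simp add: e_def n power2_eq_square field_simps)
      finally show "(\<Sum>q\<in>{1..N} - {p}. ?r p q) = 3 / 4 * (1 / real p ^ (2 * m)) + e N p / 2" .
    qed
    also have "\<dots> = 3 / 4 * Z (2 * m) N + (\<Sum>p=1..N. e N p) / 2"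
      by (simp add: Z_def sum.distrib sum_distrib_left sum_divide_distrib)
    finally show ?thesis by (simp add: algebra_simps)
  qed
  have "asym_poly (\<lambda>N. \<Sum>p=1..N. e N p) 0"
  proof (rule asym_poly_sum_remainder[of _ 2 0])
    fix N p :: nat assume p: "1 \<le> p" "p \<le> N"
    define s where "s = real (N + 1 - p)"
    have s: "s \<ge> 1" using p by (simp add: s_def)
    have "harm (N + p) - harm (N - p) \<le> real (2 * p) / (real (N - p) + 1)"
      using harm_add_le[of "N - p" "2 * p"] p by (simp add: add.commute)
    also have "real (N - p) + 1 = s" using p by (simp add: s_def of_nat_diff)
    also have "real (2 * p) / s \<le> real (2 * p) / sqrt s"
      using s by (intro divide_left_mono) (auto simp: real_le_lsqrt power2_eq_square mult_le_cancel_left1 intro!: mult_pos_pos)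
    finally have d: "harm (N + p) - harm (N - p) \<le> 2 * real p / sqrt s" by simp
    have "harm (N - p) \<le> (harm (N + p) :: real)" by (intro harm_mono) auto
    then have "\<bar>e N p\<bar> = (harm (N + p) - harm (N - p)) / real p ^ (2 * m - 1)"
      by (simp add: e_def)
    also have "\<dots> \<le> (2 * real p / sqrt s) / real p ^ 2"
      using d p s assms by (intro frac_le power_increasing) auto
    also have "\<dots> = 2 * (1 + harm (2 * N)) ^ 0 / (real p * sqrt (real (N + 1 - p)))"
      using p by (simp add: s_def power2_eq_square)
    finally show "\<bar>e N p\<bar> \<le> 2 * (1 + harm (2 * N)) ^ 0 / (real p * sqrt (real (N + 1 - p)))" .
  qed
  then have "asym_poly (\<lambda>N. \<Sum>i=1..m - 1. Z (2 * i) N * Z (2 * m - 2 * i) N)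
      (smult (real m - 1 + 3 / 2) [:zeta_nat (2 * m):] + 0)"
    unfolding eq using assms by (intro asym_poly_add asym_poly_cmult Z) auto
  moreover have "asym_poly (\<lambda>N. \<Sum>i=1..m - 1. Z (2 * i) N * Z (2 * m - 2 * i) N)
      (\<Sum>i=1..m - 1. [:zeta_nat (2 * i):] * [:zeta_nat (2 * m - 2 * i):])"
  proof (intro asym_poly_sum asym_poly_mult Z)
    fix i assume "i \<in> {1..m - 1}"
    then show "2 \<le> 2 * i" "2 \<le> 2 * m - 2 * i" by auto
  qed
  ultimately have "smult (real m - 1 + 3 / 2) [:zeta_nat (2 * m):] + 0
      = (\<Sum>i=1..m - 1. [:zeta_nat (2 * i):] * [:zeta_nat (2 * m - 2 * i):])"
    by (rule asym_poly_unique)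
  from arg_cong[OF this, of "\<lambda>p. poly p 0"] show ?thesis
    by (simp add: poly_sum algebra_simps)
qed

subsection \<open>Bernoulli numbers\<close>

text \<open>The even part \<open>(X / 2) coth (X / 2)\<close> of the generating function of the Bernoulli numbers.\<close>
definition bernoulli_even_fps :: "real fps" where
  "bernoulli_even_fps = fps_X / (fps_exp 1 - 1) + fps_const (1 / 2) * fps_X"

text \<open>With \<open>b = X / (exp X - 1)\<close>, differentiating \<open>b (exp X - 1) = X\<close> gives a Riccati equation,
  in which the shift by \<open>X / 2\<close> removes the term \<open>X b\<close>.\<close>
lemma bernoulli_even_fps_riccati:
  "bernoulli_even_fps ^ 2 = bernoulli_even_fps - fps_X * fps_deriv bernoulli_even_fps + fps_const (1 / 4) * fps_X ^ 2"
  and bernoulli_even_fps_0: "bernoulli_even_fps $ 0 = 1"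
proof -
  define E where "E = fps_exp (1 :: real) - 1"
  define b where "b = fps_X / E"
  have E1: "E $ 1 = 1" and E0: "E $ 0 = 0" by (auto simp: E_def)
  have Enz: "E \<noteq> 0" using E1 by auto
  have "subdegree E = 1" using E0 E1 by (intro subdegreeI) auto
  then have bE: "b * E = fps_X"
    unfolding b_def using Enz by (simp add: fps_times_divide_eq)
  have dE: "fps_deriv E = E + 1" by (simp add: E_def)
  have "fps_deriv b * E + b * (E + 1) = 1"
    using arg_cong[OF bE, of fps_deriv] by (simp add: dE add.commute)
  then have X: "fps_X * (fps_deriv b * E + b * (E + 1)) = fps_X" by simp
  have "E * (fps_X * fps_deriv b + fps_X * b + b * b)
      = fps_X * (fps_deriv b * E + b * (E + 1)) - fps_X * b + (b * E) * b"
    by (simp add: algebra_simps)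
  also have "\<dots> = E * b"
    unfolding X bE by (simp add: bE[symmetric] mult.commute)
  finally have "E * (fps_X * fps_deriv b + fps_X * b + b * b) = E * b" .
  then have ric: "fps_X * fps_deriv b + fps_X * b + b * b = b"
    using Enz by simp
  have beta: "bernoulli_even_fps = b + fps_const (1 / 2) * fps_X"
    by (simp add: bernoulli_even_fps_def b_def E_def)
  define h where "h = fps_const (1 / 2 :: real)"
  have hh: "h + h = 1" "fps_const (1 / 4) = h * h" by (simp_all add: h_def)
  have bb: "b * b = b - fps_X * fps_deriv b - fps_X * b"
    using ric by (simp add: algebra_simps)
  have "(b + h * fps_X) ^ 2 = b * b + (h + h) * (fps_X * b) + h * h * fps_X ^ 2"
    by (simp add: power2_eq_square algebra_simps)
  also have "\<dots> = b - fps_X * fps_deriv b + h * h * fps_X ^ 2"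
    unfolding hh(1) bb by simp
  also have "\<dots> = (b + h * fps_X) - fps_X * (fps_deriv b + h) + h * h * fps_X ^ 2"
    by (simp add: algebra_simps)
  also have "fps_deriv b + h = fps_deriv (b + h * fps_X)"
    by (simp add: h_def)
  finally show "bernoulli_even_fps ^ 2 = bernoulli_even_fps - fps_X * fps_deriv bernoulli_even_fps + fps_const (1 / 4) * fps_X ^ 2"
    unfolding beta hh(2) h_def[symmetric] .
  have "(b * E) $ 1 = b $ 0" by (simp add: fps_mult_nth_1 E1[simplified] E0)
  then show "bernoulli_even_fps $ 0 = 1" using bE by (simp add: beta)
qed

lemma bernoulli_even_fps_recurrence:
  "(\<Sum>i=0..n. bernoulli_even_fps $ i * bernoulli_even_fps $ (n - i))
    = (1 - real n) * bernoulli_even_fps $ n + (if n = 2 then 1 / 4 else 0)"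
proof -
  have "(\<Sum>i=0..n. bernoulli_even_fps $ i * bernoulli_even_fps $ (n - i)) = (bernoulli_even_fps ^ 2) $ n"
    by (simp add: power2_eq_square fps_mult_nth)
  also have "\<dots> = (1 - real n) * bernoulli_even_fps $ n + (if n = 2 then 1 / 4 else 0)"
    unfolding bernoulli_even_fps_riccati
    by (cases n) (simp_all add: algebra_simps fps_X_power_iff)
  finally show ?thesis .
qed

lemma bernoulli_even_fps_odd: "odd n \<Longrightarrow> bernoulli_even_fps $ n = 0"
proof (induction n rule: less_induct)
  case (less n)
  then obtain m where n: "n = Suc m" by (cases n) auto
  let ?b = "\<lambda>i. bernoulli_even_fps $ i"
  have "?b i * ?b (n - i) = 0" if "i \<in> {1..m}" for i
    using less that n by (cases "odd i") auto
  then have "(\<Sum>i=1..m. ?b i * ?b (n - i)) = 0" by (intro sum.neutral) blast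
  moreover have "(\<Sum>i=0..n. ?b i * ?b (n - i)) = 2 * ?b n + (\<Sum>i=1..m. ?b i * ?b (n - i))"
    unfolding n by (simp add: sum.atLeast_Suc_atMost[of 0] bernoulli_even_fps_0)
  ultimately have "(1 + real n) * ?b n = 0"
    using bernoulli_even_fps_recurrence[of n] less.prems
    by (cases "n = 2") (auto simp: algebra_simps)
  moreover have "1 + real n \<noteq> 0" by linarith
  ultimately show ?case by simp
qed

lemma bernoulli_even_eq: "bernoulli (2 * m) / fact (2 * m) = bernoulli_even_fps $ (2 * m)"
proof -
  have "2 * m \<noteq> Suc 0" by presburger
  then show ?thesis by (simp add: bernoulli_def bernoulli_even_fps_def)
qed

lemma bernoulli_even_fps_convolution:
  assumes "m \<ge> 2"
  shows "(\<Sum>i=1..m - 1. bernoulli_even_fps $ (2 * i) * bernoulli_even_fps $ (2 * m - 2 * i))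
    = - (2 * real m + 1) * bernoulli_even_fps $ (2 * m)"
proof -
  let ?b = "\<lambda>i. bernoulli_even_fps $ i"
  have "(\<Sum>i=0..2 * m. ?b i * ?b (2 * m - i)) = (\<Sum>i\<in>(*) 2 ` {0..m}. ?b i * ?b (2 * m - i))"
  proof (rule sum.mono_neutral_right)
    show "\<forall>i\<in>{0..2 * m} - (*) 2 ` {0..m}. ?b i * ?b (2 * m - i) = 0"
    proof
      fix i assume i: "i \<in> {0..2 * m} - (*) 2 ` {0..m}"
      have "odd i"
      proof
        assume "even i"
        then obtain j where "i = 2 * j" by (elim evenE)
        with i show False by auto
      qed
      then show "?b i * ?b (2 * m - i) = 0" by (simp add: bernoulli_even_fps_odd)
    qed
  qed auto
  also have "\<dots> = (\<Sum>i=0..m. ?b (2 * i) * ?b (2 * m - 2 * i))"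
    by (subst sum.reindex) (auto simp: inj_on_def)
  also have "{0..m} = insert 0 (insert m {1..m - 1})" using assms by auto
  also have "(\<Sum>i\<in>\<dots>. ?b (2 * i) * ?b (2 * m - 2 * i))
      = 2 * ?b (2 * m) + (\<Sum>i=1..m - 1. ?b (2 * i) * ?b (2 * m - 2 * i))"
    using assms by (simp add: bernoulli_even_fps_0)
  finally show ?thesis
    using bernoulli_even_fps_recurrence[of "2 * m"] assms by (simp add: algebra_simps)
qed

text \<open>Both sides satisfy the same recurrence, starting from \<open>\<zeta>(2) = \<pi>\<^sup>2/6\<close>.\<close>
theorem zeta_nat_even:
  "m \<ge> 1 \<Longrightarrow> zeta_nat (2 * m) = (-1) ^ (m + 1) * ((2 * pi) ^ (2 * m) / (2 * fact (2 * m)) * bernoulli (2 * m))"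
proof (induction m rule: less_induct)
  case (less m)
  let ?b = "\<lambda>i. bernoulli_even_fps $ i"
  have conv: "(-1) ^ (i + 1) * ((2 * pi) ^ (2 * i) / (2 * fact (2 * i)) * bernoulli (2 * i))
      = (-1) ^ (i + 1) * (2 * pi) ^ (2 * i) / 2 * ?b (2 * i)" for i
    unfolding bernoulli_even_eq[symmetric] by simp
  show ?case
  proof (cases "m = 1")
    case True
    have b2: "?b 2 = 1 / 12"
      using bernoulli_even_fps_recurrence[of 2] bernoulli_even_fps_odd[of 1]
      by (simp add: numeral_2_eq_2 bernoulli_even_fps_0 field_simps)
    have z2: "zeta_nat 2 = pi ^ 2 / 6"
      using inverse_squares_sums by (simp add: zeta_nat_def sums_iff add.commute)
    show ?thesis unfolding conv by (simp add: True b2 z2 power2_eq_square)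
  next
    case False
    then have m: "m \<ge> 2" using less.prems by simp
    have "(real m + 1 / 2) * zeta_nat (2 * m) = (\<Sum>i=1..m - 1. zeta_nat (2 * i) * zeta_nat (2 * m - 2 * i))"
      using zeta_nat_convolution[OF m] by simp
    also have "\<dots> = (\<Sum>i=1..m - 1. (-1) ^ m * (2 * pi) ^ (2 * m) / 4 * (?b (2 * i) * ?b (2 * m - 2 * i)))"
    proof (intro sum.cong refl)
      fix i assume i: "i \<in> {1..m - 1}"
      define j where "j = m - i"
      have j: "1 \<le> j" "j < m" "m = i + j" "2 * m - 2 * i = 2 * j" using i by (auto simp: j_def)
      have zi: "zeta_nat (2 * i) = (-1) ^ (i + 1) * (2 * pi) ^ (2 * i) / 2 * ?b (2 * i)"
        unfolding conv[symmetric] using i by (intro less.IH) auto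
      have zj: "zeta_nat (2 * j) = (-1) ^ (j + 1) * (2 * pi) ^ (2 * j) / 2 * ?b (2 * j)"
        unfolding conv[symmetric] using j by (intro less.IH) auto
      show "zeta_nat (2 * i) * zeta_nat (2 * m - 2 * i) = (-1) ^ m * (2 * pi) ^ (2 * m) / 4 * (?b (2 * i) * ?b (2 * m - 2 * i))"
        unfolding j(4) zi zj by (simp add: j(3) power_add distrib_left)
    qed
    also have "\<dots> = (-1) ^ m * (2 * pi) ^ (2 * m) / 4 * (- (2 * real m + 1) * ?b (2 * m))"
      unfolding sum_distrib_left[symmetric] bernoulli_even_fps_convolution[OF m] ..
    also have "\<dots> = (real m + 1 / 2) * ((-1) ^ (m + 1) * (2 * pi) ^ (2 * m) / 2 * ?b (2 * m))"
      by (simp add: field_simps)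
    finally show ?thesis unfolding conv
      by (metis (no_types, lifting) add_pos_nonneg half_gt_zero_iff less_add_same_cancel2 mult_cancel_left of_nat_0_le_iff
          order_less_irrefl zero_less_one add.commute)
  qed
qed

section \<open>The parity theorem\<close>

lemma even_zeta2_double:
  "even_zeta2 (2 * m) = - 2 * ((-1) ^ m * ((2 * pi) ^ (2 * m) / (2 * fact (2 * m)) * bernoulli (2 * m)))"
proof (cases "m = 0")
  case True
  have "bernoulli 0 = 1" using bernoulli_even_eq[of 0] by (simp add: bernoulli_even_fps_0)
  then show ?thesis using True by (simp add: even_zeta2_def)
next
  case False
  then show ?thesis by (simp add: even_zeta2_def zeta_nat_even)
qed

lemma even_zeta2_odd: "odd c \<Longrightarrow> even_zeta2 c = 0"
  by (auto simp: even_zeta2_def odd_pos)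

text \<open>Odd \<open>c\<close> contribute nothing, so \<open>c = 2 m\<close>, and \<open>b\<close> is what remains of \<open>n\<close>.\<close>
lemma sum_even_compositions:
  fixes G :: "nat \<Rightarrow> nat \<Rightarrow> real"
  assumes "n \<le> K"
  shows "(\<Sum>c\<le>K. even_zeta2 c * (if c \<le> n then \<Sum>a\<le>n - c. G a (n - c - a) else 0))
    = (\<Sum>(a, m, b)\<in>{(a, m, b). a + 2 * m + b = n}. even_zeta2 (2 * m) * G a b)"
proof -
  let ?S = "SIGMA c:{..n}. {..n - c}"
  have "(\<Sum>c\<le>K. even_zeta2 c * (if c \<le> n then \<Sum>a\<le>n - c. G a (n - c - a) else 0))
      = (\<Sum>c\<le>n. \<Sum>a\<le>n - c. even_zeta2 c * G a (n - c - a))"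
    using assms by (intro sum.mono_neutral_cong_right) (auto simp: sum_distrib_left)
  also have "\<dots> = (\<Sum>(c, a)\<in>?S. even_zeta2 c * G a (n - c - a))"
    by (rule sum.Sigma) auto
  also have "\<dots> = (\<Sum>(c, a)\<in>{x\<in>?S. even (fst x)}. even_zeta2 c * G a (n - c - a))"
    using even_zeta2_odd by (intro sum.mono_neutral_right) (auto, blast)
  also have "\<dots> = (\<Sum>(a, m, b)\<in>{(a, m, b). a + 2 * m + b = n}. even_zeta2 (2 * m) * G a b)"
    by (rule sum.reindex_bij_witness[of _ "\<lambda>(a, m, b). (2 * m, a)" "\<lambda>(c, a). (a, c div 2, n - c - a)"])
       (auto elim!: evenE)
  finally show ?thesis .
qed

text \<open>The right-hand side of the regularized multitangent identity, with \<open>2 m\<close> in place of the even \<open>c\<close>.\<close>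
definition parity_rhs :: "nat list \<Rightarrow> real" where
  "parity_rhs w = (\<Sum>t<length w. \<Sum>(a, m, b)\<in>{(a, m, b). a + 2 * m + b = w ! t}. even_zeta2 (2 * m)
     * ((-1) ^ (sum_list (take t w) + a) * zeta_shift_stuffle a (rev (take t w)) * zeta_shift_stuffle b (drop (Suc t) w)))"

lemma regularized_multitangent_identity':
  assumes w: "is_index w" "w \<noteq> []" "2 \<le> last w"
  shows "(\<Sum>i\<le>length w. (-1) ^ sum_list (take i w) * zeta_stuffle (rev (take i w)) * zeta_stuffle (drop i w))
    = parity_rhs w"
proof -
  define K where "K = sum_list w"
  have K: "k \<le> K" if "k \<in> set w" for k
    using that unfolding K_def by (rule member_le_sum_list) simp
  define G where "G t a b = (-1) ^ (sum_list (take t w) + a) * zeta_shift_stuffle a (rev (take t w))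
      * zeta_shift_stuffle b (drop (Suc t) w)" for t a b
  have "(\<Sum>c\<le>K. even_zeta2 c * poly (polar_poly w c) 0)
      = (\<Sum>c\<le>K. \<Sum>t<length w. even_zeta2 c * (if c \<le> w ! t then \<Sum>a\<le>w ! t - c. G t a (w ! t - c - a) else 0))"
    using w(1) unfolding sum_distrib_left[symmetric]
    by (intro sum.cong refl arg_cong2[where f = "(*)"])
       (auto simp: polar_poly_def poly_sum G_def shift_poly(2) mult_ac intro!: sum.cong)
  also have "\<dots> = (\<Sum>t<length w. \<Sum>c\<le>K. even_zeta2 c * (if c \<le> w ! t then \<Sum>a\<le>w ! t - c. G t a (w ! t - c - a) else 0))"
    by (rule sum.swap)
  also have "\<dots> = parity_rhs w"
    unfolding parity_rhs_def G_def[symmetric]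
    by (intro sum.cong refl sum_even_compositions K nth_mem) simp
  finally show ?thesis using regularized_multitangent_identity[OF w K] by simp
qed

text \<open>With \<open>F i j\<close> the \<open>i\<close>-th term of the antipode relation for the prefix of length \<open>j\<close>, the left-hand
  sides of the identities for the suffixes are the rows of the triangular sum of \<open>F i j * H j\<close>, while its
  columns vanish for \<open>j > 0\<close>. The row \<open>i = length w\<close>, belonging to the empty suffix, is the star value.\<close>
theorem parity_identity:
  assumes w: "is_index w" "w \<noteq> []" "2 \<le> last w"
  shows "zeta_stuffle w - (-1) ^ (length w + sum_list w) * zeta_star_stuffle w
    = (\<Sum>i<length w. (-1) ^ (i + sum_list (take i w)) * zeta_star_stuffle (take i w) * parity_rhs (drop i w))"
proof -
  define L where "L = length w"
  define s where "s j = sum_list (take j w)" for j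
  define F where "F i j = (-1) ^ i * zeta_star_stuffle (take i w) * zeta_stuffle (rev (drop i (take j w)))" for i j
  define H where "H j = (-1) ^ s j * zeta_stuffle (drop j w)" for j
  have empty: "zeta_stuffle [] = 1"
    using trunc_poly_eqI[of "[]" "[:1:]"] asym_poly_const[of 1] by (simp add: zeta_stuffle_eq)
  have row: "(-1) ^ (i + s i) * zeta_star_stuffle (take i w) * parity_rhs (drop i w) = (\<Sum>j=i..L. F i j * H j)"
    if i: "i < L" for i
  proof -
    have d: "is_index (drop i w)" "drop i w \<noteq> []" "2 \<le> last (drop i w)"
      using w i by (auto simp: L_def)
    have "(-1) ^ (i + s i) * zeta_star_stuffle (take i w) * parity_rhs (drop i w)
        = (\<Sum>t\<le>L - i. (-1) ^ (i + s i) * zeta_star_stuffle (take i w) *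
           ((-1) ^ sum_list (take t (drop i w)) * zeta_stuffle (rev (take t (drop i w))) * zeta_stuffle (drop t (drop i w))))"
      unfolding regularized_multitangent_identity'[OF d, symmetric] sum_distrib_left by (simp add: L_def)
    also have "\<dots> = (\<Sum>t\<le>L - i. F i (i + t) * H (i + t))"
    proof (intro sum.cong refl)
      fix t
      have "s (i + t) = s i + sum_list (take t (drop i w))"
        by (simp add: s_def take_add)
      moreover have "take t (drop i w) = drop i (take (i + t) w)"
        by (simp add: take_drop add.commute)
      ultimately show "(-1) ^ (i + s i) * zeta_star_stuffle (take i w) *
           ((-1) ^ sum_list (take t (drop i w)) * zeta_stuffle (rev (take t (drop i w))) * zeta_stuffle (drop t (drop i w)))
          = F i (i + t) * H (i + t)"
        by (simp add: F_def H_def power_add add.commute mult_ac)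
    qed
    also have "\<dots> = (\<Sum>j=i..L. F i j * H j)"
      using i by (intro sum.reindex_bij_witness[of _ "\<lambda>j. j - i" "\<lambda>t. i + t"]) auto
    finally show ?thesis .
  qed
  have column: "(\<Sum>i\<le>j. F i j) = (if j = 0 then 1 else 0)" if j: "j \<le> L" for j
  proof -
    have "(\<Sum>i\<le>j. F i j) = conv_unit (take j w)"
      using zeta_star_antipode[of "take j w"] w(1) j by (simp add: F_def L_def min_absorb1 min_absorb2)
    then show ?thesis using w(2) by (auto simp: conv_unit_def)
  qed
  have "(\<Sum>i\<le>L. \<Sum>j=i..L. F i j * H j) = (\<Sum>j\<le>L. \<Sum>i\<le>j. F i j * H j)"
    by (subst (1 2) sum.Sigma) (auto intro!: sum.reindex_bij_witness[of _ prod.swap prod.swap])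
  also have "\<dots> = (\<Sum>j\<le>L. if j = 0 then H 0 else 0)"
    unfolding sum_distrib_right[symmetric] using column by (intro sum.cong) auto
  also have "\<dots> = zeta_stuffle w" by (simp add: H_def s_def)
  finally have "zeta_stuffle w = (\<Sum>i<L. \<Sum>j=i..L. F i j * H j) + F L L * H L"
    by (simp flip: lessThan_Suc_atMost)
  moreover have "F L L * H L = (-1) ^ (L + s L) * zeta_star_stuffle w"
    by (simp add: F_def H_def L_def empty power_add)
  moreover have "(\<Sum>i<L. \<Sum>j=i..L. F i j * H j)
      = (\<Sum>i<L. (-1) ^ (i + s i) * zeta_star_stuffle (take i w) * parity_rhs (drop i w))"
    using row by (intro sum.cong) auto
  ultimately show ?thesis by (simp add: L_def s_def)
qed

theorem theorem2:
  fixes d :: nat and k :: "nat \<Rightarrow> nat"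
  assumes "d \<ge> 1"
    and "\<And>j. 1 \<le> j \<Longrightarrow> j \<le> d \<Longrightarrow> k j \<ge> 1"
    and "k d \<ge> 2"
    and "(\<Sum>j=1..d. k j) mod 2 \<noteq> d mod 2"
  shows "mzv (map k [1..<d+1]) =
    (mzv (map k [1..<d+1]) - zeta_star_stuffle (map k [1..<d+1])) / 2
    - (\<Sum>(i, j)\<in>{(i, j). i < j \<and> j \<le> d}.
        \<Sum>(a, m, b)\<in>{(a, m, b). a + 2 * m + b = k j}.
          (-1) ^ (m + i + b + (\<Sum>l=1..j. k l))
          * ((2 * pi) ^ (2 * m) / (2 * fact (2 * m)) * bernoulli (2 * m))
          * zeta_star_stuffle (map k [1..<i+1])
          * zeta_shift_stuffle a (map k (rev [i+1..<j]))
          * zeta_shift_stuffle b (map k [j+1..<d+1]))"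
proof -
  define w where "w = map k [1..<d+1]"
  have len: "length w = d" by (simp add: w_def)
  have w: "is_index w" "w \<noteq> []" "2 \<le> last w"
    using assms(1,2,3) by (auto simp: w_def is_index_def Suc_le_eq last_map)
  have sum_upt: "sum_list (map k [1..<j+1]) = (\<Sum>l=1..j. k l)" for j
    by (simp add: interv_sum_list_conv_sum_set_nat atLeastLessThanSuc_atLeastAtMost del: upt_Suc)
  have "odd (length w + sum_list w)"
  proof -
    have "sum_list w = (\<Sum>j=1..d. k j)" unfolding w_def by (rule sum_upt)
    moreover have "odd (d + n)" if "n mod 2 \<noteq> d mod 2" for n :: nat
      using that by presburger
    ultimately show ?thesis using assms(4) unfolding len by simp
  qed
  then have sign: "(-1) ^ (length w + sum_list w) = (- 1 :: real)" by simp
  have "zeta_stuffle w = mzv w"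
    using w by (simp add: zeta_stuffle_eq trunc_poly_convergent)
  define T where "T i j = (\<Sum>(a, m, b)\<in>{(a, m, b). a + 2 * m + b = k j}.
          (-1) ^ (m + i + b + (\<Sum>l=1..j. k l))
          * ((2 * pi) ^ (2 * m) / (2 * fact (2 * m)) * bernoulli (2 * m))
          * zeta_star_stuffle (map k [1..<i+1])
          * zeta_shift_stuffle a (map k (rev [i+1..<j]))
          * zeta_shift_stuffle b (map k [j+1..<d+1]))" for i j
  define X where "X i t = (-1) ^ (i + sum_list (take i w)) * zeta_star_stuffle (take i w) *
     (\<Sum>(a, m, b)\<in>{(a, m, b). a + 2 * m + b = drop i w ! t}. even_zeta2 (2 * m)
     * ((-1) ^ (sum_list (take t (drop i w)) + a) * zeta_shift_stuffle a (rev (take t (drop i w)))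
        * zeta_shift_stuffle b (drop (Suc t) (drop i w))))" for i t
  have X: "X i t = - 2 * T i (i + t + 1)" if "i < d" "t < d - i" for i t
  proof -
    define j where "j = i + t + 1"
    have j: "i < j" "j \<le> d" using that by (auto simp: j_def)
    have nth: "drop i w ! t = k j"
      using that by (simp add: w_def j_def nth_append del: upt_Suc)
    have left: "take i w = map k [1..<i+1]"
      using that by (simp add: w_def take_map take_upt del: upt_Suc)
    have middle: "take t (drop i w) = map k [i+1..<j]"
      using that by (simp add: w_def take_map drop_map take_upt drop_upt j_def del: upt_Suc)
    have right: "drop (Suc t) (drop i w) = map k [j+1..<d+1]"
      by (simp add: w_def drop_map drop_upt j_def add.commute del: upt_Suc)
    have s: "sum_list (take i w) + sum_list (take t (drop i w)) = (\<Sum>l=1..i+t. k l)"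
    proof -
      have "take i w @ take t (drop i w) = map k [1..<(i+t)+1]"
        unfolding take_add[symmetric] using that by (simp add: w_def take_map take_upt del: upt_Suc)
      then show ?thesis using sum_upt[of "i + t"] by (metis sum_list_append)
    qed
    have sj: "(\<Sum>l=1..j. k l) = (\<Sum>l=1..i+t. k l) + k j"
      by (simp add: j_def)
    have "(-1) ^ (i + sum_list (take i w)) * zeta_star_stuffle (take i w) * (even_zeta2 (2 * m)
     * ((-1) ^ (sum_list (take t (drop i w)) + a) * zeta_shift_stuffle a (rev (take t (drop i w)))
        * zeta_shift_stuffle b (drop (Suc t) (drop i w))))
      = - 2 * ((-1) ^ (m + i + b + (\<Sum>l=1..j. k l))
          * ((2 * pi) ^ (2 * m) / (2 * fact (2 * m)) * bernoulli (2 * m))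
          * zeta_star_stuffle (map k [1..<i+1])
          * zeta_shift_stuffle a (map k (rev [i+1..<j]))
          * zeta_shift_stuffle b (map k [j+1..<d+1]))"
      if abm: "a + 2 * m + b = k j" for a m b
    proof -
      \<comment> \<open>As \<open>a + b\<close> and \<open>k j\<close> have the same parity, the sign of \<open>a\<close> is that of \<open>b + k j\<close>.\<close>
      have "(-1) ^ (i + sum_list (take i w)) * (-1) ^ (sum_list (take t (drop i w)) + a)
          = (-1 :: real) ^ (i + a + (\<Sum>l=1..i+t. k l))"
        unfolding s[symmetric] by (simp add: power_add)
      also have "\<dots> = (-1) ^ (i + b + (\<Sum>l=1..j. k l))"
      proof -
        have "i + b + (\<Sum>l=1..j. k l) = (i + a + (\<Sum>l=1..i+t. k l)) + 2 * (b + m)"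
          unfolding sj abm[symmetric] by simp
        then show ?thesis by (simp add: power_add)
      qed
      finally have sgn: "(-1) ^ (i + sum_list (take i w)) * (-1) ^ (sum_list (take t (drop i w)) + a)
          = (-1 :: real) ^ (i + b + (\<Sum>l=1..j. k l))" .
      have "(-1) ^ (i + sum_list (take i w)) * S * (- 2 * ((-1) ^ m * E) * ((-1) ^ (sum_list (take t (drop i w)) + a) * A * B))
          = - 2 * ((-1) ^ (m + i + b + (\<Sum>l=1..j. k l)) * E * S * A * B)" for S E A B :: real
      proof -
        have "(-1) ^ (i + sum_list (take i w)) * S * (- 2 * ((-1) ^ m * E) * ((-1) ^ (sum_list (take t (drop i w)) + a) * A * B))
            = ((-1) ^ (i + sum_list (take i w)) * (-1) ^ (sum_list (take t (drop i w)) + a)) * (- 2 * ((-1) ^ m * E) * S * A * B)"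
          by (simp only: mult_ac)
        then show ?thesis unfolding sgn by (simp add: power_add mult_ac)
      qed
      then show ?thesis
        unfolding even_zeta2_double middle right rev_map[symmetric] left[symmetric] by simp
    qed
    then show ?thesis
      unfolding X_def T_def j_def[symmetric] nth sum_distrib_left
      by (intro sum.cong refl) (auto simp: case_prod_unfold)
  qed
  have "mzv w + zeta_star_stuffle w = (\<Sum>i<d. \<Sum>t<d - i. X i t)"
    using parity_identity[OF w] unfolding sign \<open>zeta_stuffle w = mzv w\<close>
    by (simp add: parity_rhs_def X_def len sum_distrib_left)
  also have "\<dots> = (\<Sum>i<d. \<Sum>t<d - i. - 2 * T i (i + t + 1))"
    by (intro sum.cong refl X) auto
  also have "\<dots> = (\<Sum>(i, t)\<in>(SIGMA i:{..<d}. {..<d - i}). - 2 * T i (i + t + 1))"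
    by (rule sum.Sigma) auto
  also have "\<dots> = (\<Sum>(i, j)\<in>{(i, j). i < j \<and> j \<le> d}. - 2 * T i j)"
    by (rule sum.reindex_bij_witness[of _ "\<lambda>(i, j). (i, j - i - 1)" "\<lambda>(i, t). (i, i + t + 1)"]) auto
  also have "\<dots> = - 2 * (\<Sum>(i, j)\<in>{(i, j). i < j \<and> j \<le> d}. T i j)"
    by (simp add: sum_distrib_left case_prod_unfold)
  finally have total: "mzv w + zeta_star_stuffle w = - 2 * (\<Sum>(i, j)\<in>{(i, j). i < j \<and> j \<le> d}. T i j)" .
  have "x = (x - y) / 2 - r" if "x + y = - 2 * r" for x y r :: real
    using that by (simp add: field_simps)
  from this[OF total] show ?thesis unfolding w_def T_def .
qed

end
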